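(* Let $1\le p<\infty$ and let $\alpha,\beta\in\mathbb{C}$ satisfy $|\alpha|^2+|\beta|^2=1$ and $\alpha\neq 0$. Let $T:H^p_{\alpha,\beta}\to H^p_{\alpha,\beta}$ be a continuous surjective linear map such that $(Tg)(z)\neq 0$ for every cyclic function $g\in H^p_{\alpha,\beta}$ and every $z\in\mathbb{D}$. Then $T$ is invertible, and there exist a scalar $\lambda\in\mathbb{C}$ with $|\lambda|=1$ and a function $\psi$ that is invertible in the algebra $H^\infty$ such that $(Tf)(z)=\psi(z)f(\lambda z)$ for every $f\in H^p_{\alpha,\beta}$ and every $z\in\mathbb{D}$.
   Context: $\mathbb{D}$ is the open unit disc in $\mathbb{C}$. For $1\le p<\infty$, $H^p$ is the Hardy space of analytic functions on $\mathbb{D}$ with its usual norm, and $H^\infty$ is the Banach algebra of bounded analytic functions on $\mathbb{D}$. For $\alpha,\beta\in\mathbb{C}$ with $|\alpha|^2+|\beta|^2=1$, $H^p_{\alpha,\beta}=\mathrm{span}\{\alpha+\beta z,\ z^2H^p\}$, i.e. the set of functions $c(\alpha+\beta z)+z^2g$ with $c\in\mathbb{C}$, $g\in H^p$; it is a closed subspace of $H^p$ and carries the $H^p$ norm. Put $H^\infty_1=\{f\in H^\infty: f'(0)=0\}$. A function $f\in H^p_{\alpha,\beta}$ is called cyclic if $\overline{fH^\infty_1}=H^p_{\alpha,\beta}$, where $fH^\infty_1=\{fh:h\in H^\infty_1\}$ and the closure is taken in the $H^p$ norm. *)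

theory Defs
  imports "HOL-Complex_Analysis.Complex_Analysis"
begin

text \<open>Functions on the unit disc are represented by total functions that vanish off the disc,
  so that equality of functions is equality on the disc.\<close>

definition disc_holomorphic :: "(complex \<Rightarrow> complex) set" where
  "disc_holomorphic = {f. f holomorphic_on ball 0 1 \<and> (\<forall>z. z \<notin> ball 0 1 \<longrightarrow> f z = 0)}"

definition hardy_mean :: "real \<Rightarrow> (complex \<Rightarrow> complex) \<Rightarrow> real \<Rightarrow> real" where
  "hardy_mean p f r =
     (1 / (2 * pi) * integral {0..2 * pi} (\<lambda>t. cmod (f (of_real r * cis t)) powr p)) powr (1 / p)"

definition hardy_space :: "real \<Rightarrow> (complex \<Rightarrow> complex) set" where
  "hardy_space p = {f \<in> disc_holomorphic. bdd_above (hardy_mean p f ` {0<..<1})}"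

text \<open>The default value off \<^term>\<open>hardy_space p\<close> is there because \<^locale>\<open>Metric_space\<close> asks for
  a distance that is nonnegative off the carrier as well.\<close>

definition hardy_norm :: "real \<Rightarrow> (complex \<Rightarrow> complex) \<Rightarrow> real" where
  "hardy_norm p f =
     (if f \<in> hardy_space p then (SUP r\<in>{0<..<1}. hardy_mean p f r) else 0)"

definition hardy_topology :: "real \<Rightarrow> (complex \<Rightarrow> complex) topology" where
  "hardy_topology p =
     Metric_space.mtopology (hardy_space p) (\<lambda>f g. hardy_norm p (\<lambda>z. f z - g z))"

definition hardy_ab :: "real \<Rightarrow> complex \<Rightarrow> complex \<Rightarrow> (complex \<Rightarrow> complex) set" where
  "hardy_ab p \<alpha> \<beta> = {f \<in> disc_holomorphic. \<exists>c. \<exists>g\<in>hardy_space p.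
     \<forall>z\<in>ball 0 1. f z = c * (\<alpha> + \<beta> * z) + z\<^sup>2 * g z}"

definition hardy_ab_topology :: "real \<Rightarrow> complex \<Rightarrow> complex \<Rightarrow> (complex \<Rightarrow> complex) topology" where
  "hardy_ab_topology p \<alpha> \<beta> = subtopology (hardy_topology p) (hardy_ab p \<alpha> \<beta>)"

definition H_infinity :: "(complex \<Rightarrow> complex) set" where
  "H_infinity = {f \<in> disc_holomorphic. bounded (f ` ball 0 1)}"

definition H_infinity_invertible :: "(complex \<Rightarrow> complex) \<Rightarrow> bool" where
  "H_infinity_invertible \<psi> \<longleftrightarrow>
     \<psi> \<in> H_infinity \<and> (\<exists>\<phi>\<in>H_infinity. \<forall>z\<in>ball 0 1. \<psi> z * \<phi> z = 1)"

definition H_infinity_1 :: "(complex \<Rightarrow> complex) set" where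
  "H_infinity_1 = {f \<in> H_infinity. deriv f 0 = 0}"

definition cyclic_ab :: "real \<Rightarrow> complex \<Rightarrow> complex \<Rightarrow> (complex \<Rightarrow> complex) \<Rightarrow> bool" where
  "cyclic_ab p \<alpha> \<beta> f \<longleftrightarrow> f \<in> hardy_ab p \<alpha> \<beta> \<and>
     hardy_topology p closure_of ((\<lambda>h z. f z * h z) ` H_infinity_1) = hardy_ab p \<alpha> \<beta>"

text \<open>Continuous linear self-maps of \<^term>\<open>hardy_ab p \<alpha> \<beta>\<close>; the values of \<open>T\<close> off this space are
  irrelevant.\<close>

definition hardy_ab_operator ::
    "real \<Rightarrow> complex \<Rightarrow> complex \<Rightarrow> ((complex \<Rightarrow> complex) \<Rightarrow> (complex \<Rightarrow> complex)) \<Rightarrow> bool" where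
  "hardy_ab_operator p \<alpha> \<beta> T \<longleftrightarrow>
     T \<in> hardy_ab p \<alpha> \<beta> \<rightarrow> hardy_ab p \<alpha> \<beta> \<and>
     (\<forall>f\<in>hardy_ab p \<alpha> \<beta>. \<forall>g\<in>hardy_ab p \<alpha> \<beta>. T (\<lambda>z. f z + g z) = (\<lambda>z. T f z + T g z)) \<and>
     (\<forall>c. \<forall>f\<in>hardy_ab p \<alpha> \<beta>. T (\<lambda>z. c * f z) = (\<lambda>z. c * T f z)) \<and>
     continuous_map (hardy_ab_topology p \<alpha> \<beta>) (hardy_ab_topology p \<alpha> \<beta>) T"

definition hardy_ab_invertible ::
    "real \<Rightarrow> complex \<Rightarrow> complex \<Rightarrow> ((complex \<Rightarrow> complex) \<Rightarrow> (complex \<Rightarrow> complex)) \<Rightarrow> bool" where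
  "hardy_ab_invertible p \<alpha> \<beta> T \<longleftrightarrow> hardy_ab_operator p \<alpha> \<beta> T \<and>
     (\<exists>S. hardy_ab_operator p \<alpha> \<beta> S \<and> (\<forall>f\<in>hardy_ab p \<alpha> \<beta>. S (T f) = f \<and> T (S f) = f))"


text \<open>The function \<^const>\<open>hardy_topology\<close> is built from is a metric when \<open>p \<ge> 1\<close>.\<close>

lemma powr_convex_nonneg:
  fixes u v s t p :: real
  assumes "1 \<le> p" "0 \<le> u" "0 \<le> v" "0 < s" "0 < t" "s + t = 1"
  shows "(s * u + t * v) powr p \<le> s * u powr p + t * v powr p"
proof -
  have small: "x powr p \<le> x" if "0 < x" "x \<le> 1" for x :: real
    using powr_mono'[of 1 p x] that assms(1) by simp
  consider "u = 0" | "v = 0" | "0 < u" "0 < v" using assms by linarith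
  then show ?thesis
  proof cases
    case 1
    then show ?thesis using assms small[of t] by (simp add: powr_mult mult_right_mono)
  next
    case 2
    then show ?thesis using assms small[of s] by (simp add: powr_mult mult_right_mono)
  next
    case 3
    have s: "s = 1 - t" using assms(6) by simp
    show ?thesis
      using convex_onD[OF powr_convex[OF assms(1)], of t u v] assms 3 unfolding s by simp
  qed
qed

lemma powr_add_le_weighted:
  fixes x y a b p :: real
  assumes p: "1 \<le> p" and xy: "0 \<le> x" "0 \<le> y" and ab: "0 < a" "0 < b"
  shows "(x + y) powr p
    \<le> (a + b) powr p * (a / (a + b) * (x powr p / a powr p) + b / (a + b) * (y powr p / b powr p))"
proof -
  define s t where "s = a / (a + b)" and "t = b / (a + b)"
  have st: "0 < s" "0 < t" "s + t = 1"
    using ab by (auto simp: s_def t_def add_divide_distrib[symmetric])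
  have "(a + b) * (s * (x / a)) = x" "(a + b) * (t * (y / b)) = y"
    using ab unfolding s_def t_def by auto
  then have "x + y = (a + b) * (s * (x / a) + t * (y / b))"
    unfolding distrib_left by presburger
  then have "(x + y) powr p = (a + b) powr p * (s * (x / a) + t * (y / b)) powr p"
    using powr_mult[of "a + b" "s * (x / a) + t * (y / b)" p] by presburger
  also have "\<dots> \<le> (a + b) powr p * (s * (x / a) powr p + t * (y / b) powr p)"
    using ab xy st p by (intro mult_left_mono powr_convex_nonneg) auto
  also have "\<dots> = (a + b) powr p * (s * (x powr p / a powr p) + t * (y powr p / b powr p))"
    using ab xy by (simp only: powr_divide)
  finally show ?thesis unfolding s_def t_def .
qed

lemma weighted_integrals_le:
  fixes a b I J p :: real
  assumes ab: "0 < a" "0 < b" and "I \<le> 2 * pi * a powr p" "J \<le> 2 * pi * b powr p"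
  shows "a / (a + b) * (I / a powr p) + b / (a + b) * (J / b powr p) \<le> 2 * pi"
proof -
  have "I / a powr p \<le> 2 * pi" "J / b powr p \<le> 2 * pi" 
    using assms by (auto simp: pos_divide_le_eq)
  then have "a / (a + b) * (I / a powr p) + b / (a + b) * (J / b powr p) \<le>
    a / (a + b) * (2 * pi) + b / (a + b) * (2 * pi)"
    using ab by (intro add_mono mult_left_mono) auto
  also have "\<dots> = (a / (a + b) + b / (a + b)) * (2 * pi)" by (rule distrib_right[symmetric])
  also have "a / (a + b) + b / (a + b) = 1" using ab by (simp add: add_divide_distrib[symmetric])
  finally show ?thesis by simp
qed

lemma disc_circle: "0 < r \<Longrightarrow> r < 1 \<Longrightarrow> of_real r * cis t \<in> ball 0 (1::real)"
  by (simp add: norm_mult)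

lemma continuous_on_hardy_integrand:
  assumes f: "f \<in> disc_holomorphic" and r: "0 < r" "r < 1" and p: "1 \<le> p"
  shows "continuous_on A (\<lambda>t. cmod (f (of_real r * cis t)) powr p)"
proof -
  have "f holomorphic_on ball 0 1" using f unfolding disc_holomorphic_def by blast
  then have cf: "continuous_on (ball 0 1) f" by (rule holomorphic_on_imp_continuous_on)
  have cc: "continuous_on A (\<lambda>t. of_real r * cis t)"
    unfolding cis_conv_exp by (intro continuous_intros)
  have "continuous_on A (\<lambda>t. f (of_real r * cis t))"
    by (rule continuous_on_compose2[OF cf cc]) (use disc_circle[OF r] in blast)
  then have "continuous_on A (\<lambda>t. cmod (f (of_real r * cis t)))"
    by (rule continuous_on_norm)
  then show ?thesis
    by (rule continuous_on_powr'[OF _ continuous_on_const]) (use p in auto)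
qed

lemma hardy_integral_nonneg:
  assumes "f \<in> disc_holomorphic" "0 < r" "r < 1" "1 \<le> p"
  shows "0 \<le> integral {0..2*pi} (\<lambda>t. cmod (f (of_real r * cis t)) powr p)"
  by (rule integral_nonneg[OF integrable_continuous_real[OF
        continuous_on_hardy_integrand[OF assms]]]) (rule powr_ge_zero)

lemma disc_holomorphic_diff:
  assumes "f \<in> disc_holomorphic" "g \<in> disc_holomorphic"
  shows "(\<lambda>z. f z - g z) \<in> disc_holomorphic"
  using assms holomorphic_on_diff[of f "ball 0 1" g]
  unfolding disc_holomorphic_def by (simp del: mem_ball)

lemma hardy_mean_le_iff:
  assumes "f \<in> disc_holomorphic" "0 < r" "r < 1" "1 \<le> p" "0 < a"
  shows "hardy_mean p f r \<le> a \<longleftrightarrow>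
    integral {0..2*pi} (\<lambda>t. cmod (f (of_real r * cis t)) powr p) \<le> 2 * pi * a powr p"
    (is "_ \<longleftrightarrow> ?I \<le> _")
proof -
  define J where "J = 1 / (2 * pi) * ?I"
  have J: "0 \<le> J" using hardy_integral_nonneg[OF assms(1-4)] by (simp add: J_def)
  have mono: "x \<le> a \<longleftrightarrow> x powr p \<le> a powr p" if "0 \<le> x" for x
    using powr_less_mono2[of p a x] powr_mono2[of p x a] assms(4,5) that by linarith
  have "hardy_mean p f r \<le> a \<longleftrightarrow> (J powr (1/p)) powr p \<le> a powr p"
    unfolding hardy_mean_def J_def[symmetric] by (rule mono) simp
  also have "(J powr (1/p)) powr p = J" using J assms(4) by (simp add: powr_powr)
  also have "J \<le> a powr p \<longleftrightarrow> ?I \<le> 2 * pi * a powr p"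
    unfolding J_def by (simp add: pos_divide_le_eq mult.commute)
  finally show ?thesis .
qed

lemma hardy_mean_nonneg: "0 \<le> hardy_mean p f r"
  by (simp add: hardy_mean_def)

lemma hardy_mean_diff_le:
  assumes f: "f \<in> disc_holomorphic" and g: "g \<in> disc_holomorphic"
    and r: "0 < r" "r < 1" and p: "1 \<le> p"
  shows "hardy_mean p (\<lambda>z. f z - g z) r \<le> hardy_mean p f r + hardy_mean p g r"
proof (rule field_le_epsilon)
  fix e :: real assume "0 < e"
  define a where "a = hardy_mean p f r + e/2"
  define b where "b = hardy_mean p g r + e/2"
  have ab: "0 < a" "0 < b"
    using \<open>0 < e\<close> hardy_mean_nonneg[of p f r] hardy_mean_nonneg[of p g r]
    by (auto simp: a_def b_def)
  define F where "F t = cmod (f (of_real r * cis t))" for t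
  define G where "G t = cmod (g (of_real r * cis t))" for t
  have If: "integral {0..2*pi} (\<lambda>t. F t powr p) \<le> 2 * pi * a powr p"
    unfolding F_def
    by (rule hardy_mean_le_iff[OF f r p ab(1), THEN iffD1]) (use \<open>0 < e\<close> in \<open>simp add: a_def\<close>)
  have Ig: "integral {0..2*pi} (\<lambda>t. G t powr p) \<le> 2 * pi * b powr p"
    unfolding G_def
    by (rule hardy_mean_le_iff[OF g r p ab(2), THEN iffD1]) (use \<open>0 < e\<close> in \<open>simp add: b_def\<close>)
  have iF: "(\<lambda>t. F t powr p) integrable_on {0..2*pi}"
    and iG: "(\<lambda>t. G t powr p) integrable_on {0..2*pi}"
    unfolding F_def G_def
    by (intro integrable_continuous_real continuous_on_hardy_integrand f g r p)+
  define K where "K = (a + b) powr p"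
  let ?W = "\<lambda>x y. K * (a / (a + b) * (x / a powr p) + b / (a + b) * (y / b powr p))"
  have pw: "cmod (f (of_real r * cis x) - g (of_real r * cis x)) powr p
      \<le> ?W (F x powr p) (G x powr p)" for x
  proof -
    have "cmod (f (of_real r * cis x) - g (of_real r * cis x)) powr p \<le> (F x + G x) powr p"
      unfolding F_def G_def by (rule powr_mono2[OF _ _ norm_triangle_ineq4]) (use p in auto)
    also have "\<dots> \<le> ?W (F x powr p) (G x powr p)"
      unfolding K_def by (rule powr_add_le_weighted[OF p _ _ ab]) (auto simp: F_def G_def)
    finally show ?thesis .
  qed
  have "((\<lambda>x. ?W (F x powr p) (G x powr p)) has_integral
      ?W (integral {0..2*pi} (\<lambda>x. F x powr p)) (integral {0..2*pi} (\<lambda>x. G x powr p))) {0..2*pi}"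
    by (intro has_integral_mult_right has_integral_add has_integral_divide
        integrable_integral iF iG)
  then have "integral {0..2*pi} (\<lambda>x. cmod (f (of_real r * cis x) - g (of_real r * cis x)) powr p)
      \<le> ?W (integral {0..2*pi} (\<lambda>x. F x powr p)) (integral {0..2*pi} (\<lambda>x. G x powr p))"
    by (rule has_integral_le[OF integrable_integral[OF integrable_continuous_real[OF
          continuous_on_hardy_integrand[OF disc_holomorphic_diff[OF f g] r p]]]]) (rule pw)
  also have "\<dots> \<le> K * (2 * pi)"
    by (rule mult_left_mono[OF weighted_integrals_le[OF ab If Ig]]) (simp add: K_def)
  also have "\<dots> = 2 * pi * (a + b) powr p" by (simp add: K_def)
  finally have "hardy_mean p (\<lambda>z. f z - g z) r \<le> a + b"
    by (subst hardy_mean_le_iff[OF disc_holomorphic_diff[OF f g] r p]) (use ab in auto)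
  then show "hardy_mean p (\<lambda>z. f z - g z) r \<le> hardy_mean p f r + hardy_mean p g r + e"
    by (simp add: a_def b_def)
qed

lemma hardy_mean_le_norm:
  "f \<in> hardy_space p \<Longrightarrow> 0 < r \<Longrightarrow> r < 1 \<Longrightarrow> hardy_mean p f r \<le> hardy_norm p f"
  unfolding hardy_norm_def by (auto simp: hardy_space_def intro!: cSUP_upper)

lemma hardy_space_diff:
  assumes "f \<in> hardy_space p" "g \<in> hardy_space p" "1 \<le> p"
  shows "(\<lambda>z. f z - g z) \<in> hardy_space p"
    and "hardy_norm p (\<lambda>z. f z - g z) \<le> hardy_norm p f + hardy_norm p g"
proof -
  have D: "f \<in> disc_holomorphic" "g \<in> disc_holomorphic"
    using assms by (auto simp: hardy_space_def)
  have le: "hardy_mean p (\<lambda>z. f z - g z) r \<le> hardy_norm p f + hardy_norm p g"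
    if "r \<in> {0<..<1}" for r
    using hardy_mean_diff_le[OF D, of r p] hardy_mean_le_norm[OF assms(1), of r]
      hardy_mean_le_norm[OF assms(2), of r] that assms(3) by (simp add: greaterThanLessThan_iff)
  then have "bdd_above (hardy_mean p (\<lambda>z. f z - g z) ` {0<..<1})"
    by (intro bdd_aboveI2)
  then show H: "(\<lambda>z. f z - g z) \<in> hardy_space p"
    using disc_holomorphic_diff[OF D] by (simp add: hardy_space_def)
  show "hardy_norm p (\<lambda>z. f z - g z) \<le> hardy_norm p f + hardy_norm p g"
    unfolding hardy_norm_def[of p "\<lambda>z. f z - g z"] using le H by (auto intro!: cSUP_least)
qed

lemma hardy_norm_nonneg: "0 \<le> hardy_norm p f"
proof (cases "f \<in> hardy_space p")
  case True
  then show ?thesis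
    using hardy_mean_le_norm[of f p "1/2"] hardy_mean_nonneg[of p f "1/2"] by simp
qed (simp add: hardy_norm_def)

lemma hardy_norm_minus_commute:
  "hardy_norm p (\<lambda>z. f z - g z) = hardy_norm p (\<lambda>z. g z - f z)"
proof -
  have "(\<lambda>z. h z - k z) \<in> disc_holomorphic" if "(\<lambda>z. k z - h z) \<in> disc_holomorphic"
    for h k :: "complex \<Rightarrow> complex"
    using that holomorphic_on_minus[of "\<lambda>z. k z - h z"] by (auto simp: disc_holomorphic_def)
  moreover have "hardy_mean p (\<lambda>z. f z - g z) = hardy_mean p (\<lambda>z. g z - f z)"
    by (simp add: hardy_mean_def norm_minus_commute fun_eq_iff)
  ultimately show ?thesis by (auto simp: hardy_norm_def hardy_space_def)
qed

lemma hardy_norm_eq_0: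
  assumes f: "f \<in> hardy_space p" and p: "1 \<le> p"
  shows "hardy_norm p f = 0 \<longleftrightarrow> f = (\<lambda>z. 0)"
proof
  assume "f = (\<lambda>z. 0)"
  then show "hardy_norm p f = 0" using f p by (simp add: hardy_norm_def hardy_mean_def)
next
  assume 0: "hardy_norm p f = 0"
  have D: "f \<in> disc_holomorphic" using f by (simp add: hardy_space_def)
  have nz: "f z = 0" if z: "z \<in> ball 0 1" "z \<noteq> 0" for z
  proof -
    define r where "r = cmod z"
    have r: "0 < r" "r < 1" using z by (auto simp: r_def)
    have "hardy_mean p f r = 0"
      using hardy_mean_le_norm[OF f r] hardy_mean_nonneg[of p f r] 0 by simp
    then have "integral {0..2*pi} (\<lambda>t. cmod (f (of_real r * cis t)) powr p) = 0"
      by (simp add: hardy_mean_def)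
    then have all: "\<forall>t\<in>{0..2*pi}. cmod (f (of_real r * cis t)) powr p = 0"
      by (subst (asm) integral_eq_0_iff) (auto intro: continuous_on_hardy_integrand D r p)
    have "z = of_real r * cis (Arg2pi z)"
      using Arg2pi_eq[of z] by (simp add: r_def cis_conv_exp mult.commute)
    then show "f z = 0"
      using all Arg2pi_ge_0[of z] Arg2pi_lt_2pi[of z] by (metis atLeastAtMost_iff less_imp_le
          norm_eq_zero powr_eq_0_iff)
  qed
  have "isCont f 0"
    using D by (auto simp: disc_holomorphic_def
        intro!: continuous_on_interior[OF holomorphic_on_imp_continuous_on, of f "ball 0 1"])
  then have "f \<midarrow>0\<rightarrow> f 0" by (simp add: isCont_def)
  moreover have "f \<midarrow>0\<rightarrow> 0"
    using nz by (intro tendsto_eventually) (auto simp: eventually_at intro!: exI[of _ 1])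
  ultimately have "f 0 = 0" using LIM_unique by blast
  then show "f = (\<lambda>z. 0)" using nz D by (fastforce simp: disc_holomorphic_def)
qed

theorem Metric_space_hardy:
  assumes p: "1 \<le> p"
  shows "Metric_space (hardy_space p) (\<lambda>f g. hardy_norm p (\<lambda>z. f z - g z))"
proof
  fix f g h :: "complex \<Rightarrow> complex"
  show "0 \<le> hardy_norm p (\<lambda>z. f z - g z)" by (rule hardy_norm_nonneg)
  show "hardy_norm p (\<lambda>z. f z - g z) = hardy_norm p (\<lambda>z. g z - f z)"
    by (rule hardy_norm_minus_commute)
  assume f: "f \<in> hardy_space p" and g: "g \<in> hardy_space p"
  show "hardy_norm p (\<lambda>z. f z - g z) = 0 \<longleftrightarrow> f = g"
    using hardy_norm_eq_0[OF hardy_space_diff(1)[OF f g p] p] by (auto simp: fun_eq_iff)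
  assume h: "h \<in> hardy_space p"
  show "hardy_norm p (\<lambda>z. f z - h z)
      \<le> hardy_norm p (\<lambda>z. f z - g z) + hardy_norm p (\<lambda>z. g z - h z)"
    using hardy_space_diff(2)[OF hardy_space_diff(1)[OF f g p] hardy_space_diff(1)[OF h g p] p]
    by (simp add: hardy_norm_minus_commute[of p h g])
qed

end

theory Submission
  imports Defs
begin

text \<open>Fix \<open>w\<close> in the disc and let \<open>E0 z = exp (\<beta> z / \<alpha>)\<close>. As \<open>E0 exp u\<close> is cyclic for all
  \<open>u \<in> H\<^sup>\<infinity>\<^sub>1\<close>, the argument of Gleason, Kahane and Zelazko makes \<open>u \<mapsto> T (E0 u) w / T E0 w\<close> a character
  of \<open>H\<^sup>\<infinity>\<^sub>1\<close>. Its values \<open>s, r\<close> at \<open>z\<^sup>2, z\<^sup>3\<close> satisfy \<open>s\<^sup>3 = r\<^sup>2\<close>, so they are \<open>c\<^sup>2, c\<^sup>3\<close> for one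
  \<open>c = \<phi> w\<close>, and the character is evaluation at \<open>c\<close>; thus \<open>T f = \<psi> \<cdot> f \<circ> \<phi>\<close>. Pulling back multiples of
  \<open>T E0\<close> along the surjection \<open>T\<close> yields a holomorphic inverse of \<open>\<phi>\<close>, and \<open>\<phi> 0 = 0\<close> because the
  values of \<open>T\<close> satisfy \<open>\<alpha> f' 0 = \<beta> f 0\<close>; so \<open>\<phi>\<close> is a rotation by the Schwarz lemma. Then \<open>\<psi>\<close> and
  \<open>1 / \<psi>\<close> are essentially multipliers of \<open>H\<^sup>p\<close>, which are bounded by a gliding hump.

  That there are cyclic functions at all rests on the density of \<open>H\<^sup>\<infinity>\<close> in \<open>H\<^sup>p\<close>: dilations converge
  for \<open>p \<ge> 2\<close> by uniform convexity, and for all \<open>p \<ge> 1\<close> since every \<open>f \<in> H\<^sup>p\<close> is a product of two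
  functions in \<open>H\<^sup>2\<^sup>p\<close>.\<close>

section \<open>Entire functions and cusps\<close>

text \<open>The obstacle is that \<open>H_infinity_1\<close> does not contain the function z. A
  character of it cannot be located by its value at z, so points are recovered from z^2 and z^3
  through the cusp, once for \<open>\<phi>\<close> and once for its inverse. \<open>E0\<close> is
  bounded on the disc with bounded inverse and has logarithmic derivative
  \<open>\<beta> / \<alpha>\<close>; dividing by it turns the constraint
  \<open>\<alpha> * deriv f 0 = \<beta> * f 0\<close> into \<open>deriv h 0 = 0\<close>. The
  character is at first only known to sit in the closed disc; boundary points are excluded by the
  maximum principle and surjectivity. That the inverse of \<open>\<phi>\<close> maps into the disc
  is shown with holomorphic roots: a value of its square of modulus at least 1 would yield a
  nonconstant function that has a zero and roots of all orders. The constraint makes every zero at 0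
  of a value of \<open>T\<close> a double one, and this pins \<open>\<phi> 0 = 0\<close>. The
  gliding hump takes the place of the closed graph theorem; its limit comes from normal families and
  not from completeness of H^p.\<close>

lemma entire_Re_bound_affine:
  fixes g :: "complex \<Rightarrow> complex"
  assumes g: "g holomorphic_on UNIV" and B: "0 \<le> B" and bd: "\<And>z. Re (g z) \<le> A + B * cmod z"
  shows "\<exists>b. \<forall>z. g z = g 0 + b * z"
proof -
  define h where "h z = g z - g 0" for z
  \<comment> \<open>The summand 1 makes \<open>Re (h z) < M\<close> strict below, so that
    \<open>k\<close> maps into the open disc.\<close>
  define A' where "A' = \<bar>A\<bar> + \<bar>Re (g 0)\<bar> + 1"
  have h: "h holomorphic_on UNIV" unfolding h_def by (intro holomorphic_intros g)
  have Reh: "Re (h z) \<le> A' - 1 + B * cmod z" for z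
    using bd[of z] by (simp add: h_def A'_def)
  have A'1: "1 \<le> A'" by (simp add: A'_def)
  have hb: "cmod (h w) \<le> 2 * (A' + B * R)" if R: "0 < R" "cmod w \<le> R / 2" for w R
  proof -
    define M where "M = A' + B * R"
    have M: "1 \<le> M" using A'1 mult_nonneg_nonneg[OF B less_imp_le[OF R(1)]] by (simp add: M_def)
    have lt: "Re (h z) < M" if "cmod z < R" for z
      using Reh[of z] that mult_left_mono[of "cmod z" R B] B by (simp add: M_def)
    \<comment> \<open>The Borel-Caratheodory device: w / (2M - w) maps the half plane Re w < M into
      the unit disc and fixes 0, so the Schwarz lemma turns a one-sided bound on a disc into a bound
      on \<open>cmod (h w)\<close> at half the radius.\<close>
    define k where "k z = h (of_real R * z) / (2 * of_real M - h (of_real R * z))" for z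
    have inR: "cmod (of_real R * z) < R" if "cmod z < 1" for z
      using that R by (simp add: norm_mult)
    have nz: "2 * of_real M - h (of_real R * z) \<noteq> 0" if "cmod z < 1" for z
    proof
      assume "2 * of_real M - h (of_real R * z) = 0"
      then have "Re (h (of_real R * z)) = 2 * M" by (simp add: complex_eq_iff)
      then show False using lt[OF inR[OF that]] M by simp
    qed
    have hR: "(\<lambda>z. h (of_real R * z)) holomorphic_on ball 0 1"
      using holomorphic_on_compose_gen[of "\<lambda>z. of_real R * z" "ball 0 1" h UNIV] h
      by (auto simp: o_def intro!: holomorphic_intros)
    have k: "k holomorphic_on ball 0 1"
      unfolding k_def using nz by (intro holomorphic_intros hR) auto
    have k0: "k 0 = 0" by (simp add: k_def h_def)
    have k1: "cmod (k z) < 1" if "cmod z < 1" for z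
    proof -
      define w where "w = h (of_real R * z)"
      have "Re w < M" using lt[OF inR[OF that]] by (simp add: w_def)
      then have "(Re w)\<^sup>2 + (Im w)\<^sup>2 < (2 * M - Re w)\<^sup>2 + (Im w)\<^sup>2"
        using M by (simp add: power2_eq_square algebra_simps)
      then have "(cmod w)\<^sup>2 < (cmod (2 * of_real M - w))\<^sup>2" by (simp add: cmod_power2)
      then have "cmod w < cmod (2 * of_real M - w)" using power_less_imp_less_base by force
      moreover have "2 * of_real M - w \<noteq> 0" using nz[OF that] by (simp add: w_def)
      ultimately show ?thesis
        unfolding k_def w_def[symmetric] by (simp add: norm_divide)
    qed
    define z where "z = w / of_real R"
    have z: "cmod z \<le> 1/2" "of_real R * z = w" using R by (auto simp: z_def norm_divide field_simps)
    have "cmod (k z) \<le> cmod z" using Schwarz_Lemma(1)[OF k k0 k1, of z] z by simp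
    then have "cmod (h w) / cmod (2 * of_real M - h w) \<le> 1/2"
      using z unfolding k_def z(2) norm_divide by linarith
    then have "cmod (h w) \<le> 1/2 * cmod (2 * of_real M - h w)"
      using nz[of z] z by (simp add: pos_divide_le_eq)
    also have "cmod (2 * of_real M - h w) \<le> 2 * M + cmod (h w)"
      using norm_triangle_ineq4[of "2 * of_real M" "h w"] M by (simp add: norm_mult)
    finally show ?thesis by (simp add: M_def)
  qed
  \<comment> \<open>The radius R = 2|z| gives linear growth, and Liouville leaves a polynomial of
    degree at most one.\<close>
  have "cmod (h z) \<le> (2 * A' + 4 * B) * cmod z ^ 1" if "1 \<le> cmod z" for z
  proof -
    have "cmod (h z) \<le> 2 * (A' + B * (2 * cmod z))" using that by (intro hb) auto
    also have "\<dots> \<le> 2 * (A' * cmod z + B * (2 * cmod z))"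
      using that A'1 by (simp add: mult_le_cancel_left1)
    finally show ?thesis by (simp add: algebra_simps)
  qed
  then have "h z = (\<Sum>k\<le>1. (deriv ^^ k) h 0 / fact k * z ^ k)" for z
    by (rule Liouville_polynomial[OF h])
  then have "h z = deriv h 0 * z" for z by (simp add: h_def)
  then show ?thesis by (metis add.commute diff_add_cancel h_def)
qed

text \<open>A zero-free entire function is exp g, and the growth bound is an affine bound on Re g,
  so g is affine. This is the zero-free case of Hadamard factorization.\<close>

lemma entire_nonvanishing_exponential_type:
  fixes f :: "complex \<Rightarrow> complex"
  assumes f: "f holomorphic_on UNIV" and nz: "\<And>z. f z \<noteq> 0" and B: "0 \<le> B"
    and bd: "\<And>z. cmod (f z) \<le> K * exp (B * cmod z)"
  shows "\<exists>c. \<forall>z. f z = f 0 * exp (c * z)"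
proof -
  obtain g where g: "g holomorphic_on UNIV" and fg: "\<And>z. f z = exp (g z)"
    using simply_connected_imp_holomorphic_log[OF f] nz
      convex_imp_simply_connected[of UNIV] convex_imp_locally_path_connected[of UNIV] by auto
  have "0 < K * exp (B * cmod 0)" using bd[of 0] nz[of 0]
    by (smt (verit) zero_less_norm_iff)
  then have K: "0 < K" by simp
  have "Re (g z) \<le> ln K + B * cmod z" for z
  proof -
    have "exp (Re (g z)) \<le> exp (ln K + B * cmod z)"
      using bd[of z] K by (simp add: fg exp_add)
    then show ?thesis by simp
  qed
  from entire_Re_bound_affine[OF g B this] obtain b where "\<And>z. g z = g 0 + b * z" by blast
  then have "\<forall>z. f z = f 0 * exp (b * z)" by (metis fg exp_add)
  then show ?thesis ..
qed

text \<open>The normalization of the cusp \<open>s\<^sup>3 = r\<^sup>2\<close>.\<close>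

lemma cusp_parametrization:
  fixes S R :: "complex \<Rightarrow> complex"
  assumes U: "open U" "connected U" and S: "S holomorphic_on U" and R: "R holomorphic_on U"
    and eq: "\<And>z. z \<in> U \<Longrightarrow> S z ^ 3 = R z ^ 2"
  obtains \<phi> where "\<phi> holomorphic_on U" "\<And>z. z \<in> U \<Longrightarrow> \<phi> z ^ 2 = S z" "\<And>z. z \<in> U \<Longrightarrow> \<phi> z ^ 3 = R z"
proof -
  \<comment> \<open>Where \<open>S\<close> vanishes, \<open>R\<close> vanishes too, so the value 0
    keeps both power equations valid there.\<close>
  define \<phi> where "\<phi> z = (if S z = 0 then 0 else R z / S z)" for z
  have sq: "\<phi> z ^ 2 = S z" if "z \<in> U" for z
    using eq[OF that, symmetric] by (simp add: \<phi>_def power_divide power2_eq_square power3_eq_cube)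
  have cb: "\<phi> z ^ 3 = R z" if "z \<in> U" for z
    using eq[OF that] sq[OF that]
    by (cases "S z = 0") (simp_all add: \<phi>_def power3_eq_cube power2_eq_square)
  have "\<phi> holomorphic_on U"
  proof (cases "\<forall>z\<in>U. S z = 0")
    case True
    then have "\<And>z. z \<in> U \<Longrightarrow> \<phi> z = 0" by (simp add: \<phi>_def)
    then show ?thesis using holomorphic_cong[of U U \<phi> "\<lambda>_. 0"] by simp
  next
    case False
    then obtain b where b: "b \<in> U" "S b \<noteq> 0" by blast
    have Sc: "continuous_on U S" using S by (rule holomorphic_on_imp_continuous_on)
    have off: "\<phi> holomorphic_on V" if "V \<subseteq> U" "\<And>z. z \<in> V \<Longrightarrow> S z \<noteq> 0" for V
    proof -
      have "(\<lambda>z. R z / S z) holomorphic_on V"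
        using that by (intro holomorphic_intros holomorphic_on_subset[OF S] holomorphic_on_subset[OF R]) auto
      then show ?thesis using that by (subst holomorphic_cong[OF refl, of V _ "\<lambda>z. R z / S z"]) (auto simp: \<phi>_def)
    qed
    have "\<exists>V. open V \<and> a \<in> V \<and> V \<subseteq> U \<and> \<phi> holomorphic_on V" if a: "a \<in> U" for a
    proof (cases "S a = 0")
      case False
      obtain V where V: "open V" "U \<inter> S -` (- {0}) = V"
        using continuous_open_preimage[OF Sc U(1), of "- {0}"] by auto
      show ?thesis using V False a by (intro exI[of _ V]) (auto intro!: off)
    next
      case True
      obtain r where r: "0 < r" "ball a r \<subseteq> U" "\<And>z. z \<in> ball a r - {a} \<Longrightarrow> S z \<noteq> 0"
        using isolated_zeros[OF S U a True b] by metis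
      have hol: "\<phi> holomorphic_on (ball a r - {a})" using r by (intro off) auto
      have "isCont S a" using Sc U(1) a by (simp add: continuous_on_eq_continuous_at)
      then have S0: "S \<midarrow>a\<rightarrow> 0" using True by (simp add: isCont_def)
      \<comment> \<open>As \<open>\<phi>\<close> squares to \<open>S\<close>, its modulus is the
        square root of that of \<open>S\<close> and tends to 0; the singularity is removable with
        the value already assigned.\<close>
      have "((\<lambda>z. sqrt (cmod (S z))) \<longlongrightarrow> sqrt (cmod 0)) (at a within ball a r)"
        by (intro tendsto_intros tendsto_within_subset[OF S0]) auto
      then have "((\<lambda>z. sqrt (cmod (S z))) \<longlongrightarrow> 0) (at a within ball a r)" by simp
      moreover have "\<forall>\<^sub>F z in at a within ball a r. cmod (\<phi> z) \<le> sqrt (cmod (S z)) "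
        using r(2) by (auto simp: eventually_at_filter norm_power sq[symmetric] intro!: always_eventually)
      ultimately have "(\<phi> \<longlongrightarrow> 0) (at a within ball a r)"
        by (rule Lim_null_comparison[rotated])
      then have "(\<phi> \<longlongrightarrow> \<phi> a) (at a within ball a r)" using True by (simp add: \<phi>_def)
      then have "\<phi> holomorphic_on ball a r"
        using no_isolated_singularity'[of "{a}" \<phi> "ball a r"] hol by auto
      then show ?thesis using r by (intro exI[of _ "ball a r"]) auto
    qed
    then show ?thesis
      unfolding holomorphic_on_def using U(1)
      by (metis at_within_open field_differentiable_at_within)
  qed
  then show thesis using that sq cb by blast
qed

lemma quotient_at_point_holomorphic:
  fixes u :: "complex \<Rightarrow> complex"
  assumes "u holomorphic_on S" "open S"
  obtains v where "v holomorphic_on S" "\<And>z. u z - u w = (z - w) * v z"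
proof
  show "(\<lambda>z. if z = w then deriv u w else (u z - u w) / (z - w)) holomorphic_on S"
    by (rule pole_lemma_open[OF assms])
qed auto

section \<open>Circle means of powers of holomorphic functions\<close>

lemma holomorphic_on_compose_fun:
  assumes "g holomorphic_on B" "f holomorphic_on A" "\<And>z. z \<in> A \<Longrightarrow> f z \<in> B"
  shows "(\<lambda>z. g (f z)) holomorphic_on A"
  using holomorphic_on_compose_gen[of f A g B] assms by (auto simp: o_def)

lemma holomorphic_bounded_on_cball:
  fixes f :: "complex \<Rightarrow> complex"
  assumes f: "f holomorphic_on ball 0 R" and r: "r < R"
  shows "\<exists>B. \<forall>z. cmod z \<le> r \<longrightarrow> cmod (f z) \<le> B"
proof -
  have "continuous_on (cball 0 r) f"
    by (rule holomorphic_on_imp_continuous_on[OF holomorphic_on_subset[OF f]]) (use r in auto)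
  then have "bounded (f ` cball 0 r)" by (intro compact_imp_bounded compact_continuous_image) auto
  then show ?thesis
    by (simp only: bounded_iff ball_simps Ball_def[of "cball 0 r"] mem_cball_0)
qed

text \<open>Equals \<open>2 * pi * hardy_mean p f r powr p\<close> for \<open>1 \<le> p\<close>.
  Without the root, pointwise inequalities and limits pass to the integral directly.\<close>

definition circle_integral :: "real \<Rightarrow> (complex \<Rightarrow> complex) \<Rightarrow> real \<Rightarrow> real" where
  "circle_integral p f r = integral {0..2*pi} (\<lambda>t. cmod (f (of_real r * cis t)) powr p)"

lemma continuous_on_circle_integrand:
  fixes R :: real
  assumes f: "f holomorphic_on ball 0 R" and r: "0 \<le> r" "r < R" and p: "0 < p"
  shows "continuous_on A (\<lambda>t. cmod (f (of_real r * cis t)) powr p)"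
proof -
  have cf: "continuous_on (ball 0 R) f" using f by (rule holomorphic_on_imp_continuous_on)
  have cc: "continuous_on A (\<lambda>t. of_real r * cis t)"
    unfolding cis_conv_exp by (intro continuous_intros)
  have "continuous_on A (\<lambda>t. f (of_real r * cis t))"
    by (rule continuous_on_compose2[OF cf cc]) (use r in \<open>auto simp: norm_mult\<close>)
  then have "continuous_on A (\<lambda>t. cmod (f (of_real r * cis t)))"
    by (rule continuous_on_norm)
  then show ?thesis
    by (rule continuous_on_powr'[OF _ continuous_on_const]) (use p in auto)
qed

lemma circle_integrable:
  assumes "f holomorphic_on ball 0 R" "0 \<le> r" "r < R" "0 < p"
  shows "(\<lambda>t. cmod (f (of_real r * cis t)) powr p) integrable_on {a..b}"
  by (rule integrable_continuous_real[OF continuous_on_circle_integrand[OF assms]])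

lemma circle_integral_nonneg: "0 \<le> circle_integral p f r"
proof (cases "(\<lambda>t. cmod (f (of_real r * cis t)) powr p) integrable_on {0..2*pi}")
  case True
  then show ?thesis unfolding circle_integral_def by (rule integral_nonneg) simp
qed (simp add: circle_integral_def not_integrable_integral)

lemma circle_integral_cong:
  assumes "\<And>z. cmod z = r \<Longrightarrow> cmod (f z) = cmod (g z)" "0 \<le> r"
  shows "circle_integral p f r = circle_integral p g r"
  unfolding circle_integral_def by (rule integral_cong) (use assms in \<open>simp add: norm_mult\<close>)

lemma circle_integral_mono:
  assumes "f holomorphic_on ball 0 R" "g holomorphic_on ball 0 R" "0 \<le> r" "r < R" "0 < p"
    and "\<And>z. cmod z = r \<Longrightarrow> cmod (f z) \<le> cmod (g z)"
  shows "circle_integral p f r \<le> circle_integral p g r"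
  unfolding circle_integral_def
  by (intro integral_le circle_integrable[OF assms(1)] circle_integrable[OF assms(2)] powr_mono2)
    (use assms in \<open>auto simp: norm_mult\<close>)

lemma circle_integral_le_sup:
  assumes "f holomorphic_on ball 0 R" "0 \<le> r" "r < R" "0 < p" "\<And>z. cmod z = r \<Longrightarrow> cmod (f z) \<le> B"
  shows "circle_integral p f r \<le> 2 * pi * B powr p"
proof -
  have "0 \<le> B" using order_trans[OF norm_ge_zero assms(5)[of "of_real r"]] assms(2) by simp
  have "circle_integral p f r \<le> integral {0..2*pi} (\<lambda>t. B powr p)"
    unfolding circle_integral_def
    by (intro integral_le circle_integrable[OF assms(1)] powr_mono2 integrable_continuous_real)
      (use assms in \<open>auto simp: norm_mult\<close>)
  then show ?thesis by simp
qed

lemma circle_integral_cmult: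
  "circle_integral p (\<lambda>z. c * f z) r = cmod c powr p * circle_integral p f r"
  by (simp add: circle_integral_def norm_mult powr_mult)

text \<open>The Cauchy formula with the kernel estimated by its maximum on the circle. The factor is
  exactly 1 at \<open>z = 0\<close>, as the submean inequality requires.\<close>

lemma Cauchy_circle_bound:
  assumes f: "f holomorphic_on ball 0 R" and z: "cmod z < r" and r: "r < R"
  shows "cmod (f z) \<le> r / (r - cmod z) * (1 / (2 * pi) * circle_integral 1 f r)"
proof -
  have r0: "0 < r" using z norm_ge_zero[of z] by linarith
  have "((\<lambda>u. f u / (u - z)) has_contour_integral (2 * of_real pi * \<i> * f z)) (circlepath 0 r)"
    by (rule Cauchy_integral_circlepath)
      (use r z in \<open>auto intro!: holomorphic_on_imp_continuous_on holomorphic_on_subset[OF f]\<close>)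
  then have I: "((\<lambda>t. f (of_real r * cis t) / (of_real r * cis t - z) * of_real r * \<i> * cis t)
      has_integral (2 * of_real pi * \<i> * f z)) {0..2*pi}" (is "(?g has_integral _) _")
    unfolding circlepath_def by (subst (asm) has_contour_integral_part_circlepath_iff) auto
  have int: "(\<lambda>t. cmod (f (of_real r * cis t)) powr 1) integrable_on {0..2*pi}"
    by (rule circle_integrable[OF f]) (use r r0 in auto)
  have "cmod (integral {0..2*pi} ?g)
      \<le> integral {0..2*pi} (\<lambda>t. r / (r - cmod z) * cmod (f (of_real r * cis t)) powr 1)"
  proof (rule integral_norm_bound_integral)
    show "?g integrable_on {0..2*pi}" using I by (rule has_integral_integrable)
    show "(\<lambda>t. r / (r - cmod z) * cmod (f (of_real r * cis t)) powr 1) integrable_on {0..2*pi}"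
      by (rule integrable_on_mult_right[OF int])
    fix t
    have "r - cmod z \<le> cmod (of_real r * cis t - z)"
      using norm_triangle_ineq2[of "of_real r * cis t" z] r0 by (simp add: norm_mult)
    then have "cmod (f (of_real r * cis t)) * r / cmod (of_real r * cis t - z)
        \<le> cmod (f (of_real r * cis t)) * r / (r - cmod z)"
      using z r0 by (intro divide_left_mono mult_nonneg_nonneg mult_pos_pos) auto
    then show "cmod (?g t) \<le> r / (r - cmod z) * cmod (f (of_real r * cis t)) powr 1"
      using r0 by (simp add: norm_mult norm_divide mult_ac)
  qed
  then have "cmod (2 * of_real pi * \<i> * f z) \<le> r / (r - cmod z) * circle_integral 1 f r"
    using I by (simp add: integral_unique circle_integral_def)
  then have "2 * pi * cmod (f z) \<le> r / (r - cmod z) * circle_integral 1 f r"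
    by (simp add: norm_mult)
  moreover have "cmod (f z) = 1 / (2 * pi) * (2 * pi * cmod (f z))" by simp
  ultimately have "cmod (f z) \<le> 1 / (2 * pi) * (r / (r - cmod z) * circle_integral 1 f r)"
    by (metis divide_nonneg_nonneg mult_left_mono pi_ge_zero zero_le_mult_iff zero_le_numeral zero_le_one)
  then show ?thesis by (simp add: mult_ac)
qed

lemma powr_mean_le_mean_powr:
  fixes g :: "real \<Rightarrow> real"
  assumes g: "continuous_on {0..2*pi} g" "\<And>t. 0 \<le> g t" and p: "1 \<le> p"
  shows "(1 / (2 * pi) * integral {0..2*pi} g) powr p
    \<le> 1 / (2 * pi) * integral {0..2*pi} (\<lambda>t. g t powr p)"
proof -
  define m where "m = 1 / (2 * pi) * integral {0..2*pi} g"
  have gi: "g integrable_on {0..2*pi}" by (rule integrable_continuous_real[OF g(1)])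
  have m0: "0 \<le> m" unfolding m_def by (intro mult_nonneg_nonneg integral_nonneg gi g) auto
  have pi: "(\<lambda>t. g t powr p) integrable_on {0..2*pi}"
    by (intro integrable_continuous_real continuous_on_powr'[OF g(1) continuous_on_const]) (use g p in auto)
  have "m powr p \<le> 1 / (2 * pi) * integral {0..2*pi} (\<lambda>t. g t powr p)"
  proof (cases "m = 0")
    case True
    then show ?thesis using integral_nonneg[OF pi] by simp
  next
    case False
    then have m: "0 < m" using m0 by simp
    define d where "d = p * m powr (p - 1)"
    \<comment> \<open>Jensen by the tangent of \<open>x powr p\<close> at the mean \<open>m\<close>:
      its linear part integrates to 0. The point \<open>x = 0\<close> lies outside the interval on
      which the derivative is taken and is checked by hand.\<close>
    have tangent: "m powr p + d * (x - m) \<le> x powr p" if "0 \<le> x" for x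
    proof (cases "x = 0")
      case True
      have "d * m = p * m powr p" using m by (simp add: d_def powr_diff)
      then show ?thesis using True p m by (simp add: mult_le_cancel_right1)
    next
      case False
      have "((\<lambda>x. x powr p) has_field_derivative d) (at m within {0<..})"
        unfolding d_def by (rule DERIV_subset[OF has_real_derivative_powr[OF m]]) auto
      then have "x powr p - m powr p \<ge> d * (x - m)"
        using m that False
        by (intro convex_on_imp_above_tangent[OF powr_convex[OF p]]) (auto simp: interior_open)
      then show ?thesis by simp
    qed
    have I: "((\<lambda>t. m powr p + d * (g t - m)) has_integral
        (2 * pi * m powr p + d * (integral {0..2*pi} g - 2 * pi * m))) {0..2*pi}"
      using has_integral_add[OF has_integral_const_real[of "m powr p" 0 "2*pi"]
          has_integral_mult_right[OF has_integral_diff[OF integrable_integral[OF gi]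
              has_integral_const_real[of m 0 "2*pi"]], of d]] by simp
    have "2 * pi * m powr p + d * (integral {0..2*pi} g - 2 * pi * m)
        \<le> integral {0..2*pi} (\<lambda>t. g t powr p)"
      by (rule has_integral_le[OF I integrable_integral[OF pi]]) (use tangent g in auto)
    moreover have "integral {0..2*pi} g = 2 * pi * m" by (simp add: m_def)
    ultimately show ?thesis by (simp add: field_simps)
  qed
  then show ?thesis by (simp add: m_def)
qed

lemma circle_integral_Jensen:
  assumes f: "f holomorphic_on ball 0 R" and r: "0 \<le> r" "r < R" and p: "1 \<le> p"
  shows "(1 / (2 * pi) * circle_integral 1 f r) powr p \<le> 1 / (2 * pi) * circle_integral p f r"
proof -
  have "continuous_on {0..2*pi} (\<lambda>t. cmod (f (of_real r * cis t)) powr 1)"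
    by (rule continuous_on_circle_integrand[OF f r]) simp
  then show ?thesis
    using powr_mean_le_mean_powr[of "\<lambda>t. cmod (f (of_real r * cis t))" p] p
    by (simp add: circle_integral_def)
qed

text \<open>Subharmonicity of the p-th power of the modulus: the Cauchy bound at the centre,
  followed by Jensen.\<close>

lemma powr_norm_submean:
  assumes f: "f holomorphic_on ball a R" and r: "0 < r" "r < R" and p: "1 \<le> p"
  shows "2 * pi * cmod (f a) powr p \<le> integral {0..2*pi} (\<lambda>t. cmod (f (a + of_real r * cis t)) powr p)"
proof -
  define g where "g z = f (a + z)" for z
  have g: "g holomorphic_on ball 0 R"
    unfolding g_def by (rule holomorphic_on_compose_fun[OF f]) (auto simp: dist_norm intro!: holomorphic_intros)
  have "cmod (g 0) \<le> 1 / (2 * pi) * circle_integral 1 g r"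
    using Cauchy_circle_bound[OF g, of 0 r] r by simp
  then have "cmod (g 0) powr p \<le> (1 / (2 * pi) * circle_integral 1 g r) powr p"
    using p by (intro powr_mono2) auto
  also have "\<dots> \<le> 1 / (2 * pi) * circle_integral p g r"
    using r p by (intro circle_integral_Jensen[OF g]) auto
  finally show ?thesis by (simp add: g_def circle_integral_def field_simps)
qed

lemma circle_integral_rotate:
  assumes f: "f holomorphic_on ball 0 R" and z: "cmod z < R" and p: "0 < p"
  shows "integral {0..2*pi} (\<lambda>t. cmod (f (z * cis t)) powr p) = circle_integral p f (cmod z)"
proof (cases "z = 0")
  case False
  define a where "a = Arg2pi z"
  have a: "0 \<le> a" "a \<le> 2 * pi"
    using Arg2pi_ge_0[of z] Arg2pi_lt_2pi[of z] by (auto simp: a_def)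
  have za: "z = of_real (cmod z) * cis a"
    using Arg2pi_eq[of z] by (simp add: a_def cis_conv_exp mult.commute)
  define h where "h t = cmod (f (of_real (cmod z) * cis t)) powr p" for t
  have hi: "h integrable_on {x..y}" for x y
    unfolding h_def by (rule circle_integrable[OF f]) (use z p in auto)
  have per: "h (2 * pi + t) = h t" for t
  proof -
    have "cis (2 * pi + t) = cis t" by (simp flip: cis_mult)
    then show ?thesis by (simp add: h_def)
  qed
  have "(\<lambda>t. cmod (f (z * cis t)) powr p) = h \<circ> ((+) a)"
  proof
    fix t
    have "z * cis t = of_real (cmod z) * cis (a + t)" by (subst za) (simp add: cis_mult mult.assoc)
    then show "cmod (f (z * cis t)) powr p = (h \<circ> ((+) a)) t" by (simp add: h_def)
  qed
  then have "integral {0..2*pi} (\<lambda>t. cmod (f (z * cis t)) powr p) = integral {a..2*pi + a} h"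
    using integral_shift_Icc_real[of 0 "2*pi" h a] by simp
  also have "\<dots> = integral {a..2*pi} h + integral {2*pi..2*pi + a} h"
    by (rule Henstock_Kurzweil_Integration.integral_combine[symmetric]) (use a in \<open>auto intro: hi\<close>)
  also have "integral {2*pi..2*pi + a} h = integral {0..a} (h \<circ> ((+) (2*pi)))"
    using integral_shift_Icc_real[of 0 a h "2*pi"] by (simp add: add.commute)
  also have "h \<circ> ((+) (2*pi)) = h" using per by auto
  also have "integral {a..2*pi} h + integral {0..a} h = integral {0..2*pi} h"
    using Henstock_Kurzweil_Integration.integral_combine[OF a hi] by linarith
  finally show ?thesis by (simp add: h_def[abs_def] circle_integral_def)
qed (simp add: circle_integral_def)

text \<open>The function \<open>z \<mapsto> \<integral> \<bar>f (z e\<^sup>i\<^sup>t)\<bar>\<^sup>p dt\<close> is radial and satisfies the submean inequality,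
  so the maximum principle applies to it.\<close>

lemma circle_integral_increasing:
  assumes f: "f holomorphic_on ball 0 R" and r: "0 \<le> s" "s \<le> r" "r < R" and p: "1 \<le> p"
  shows "circle_integral p f s \<le> circle_integral p f r"
proof (cases "r = 0")
  case True
  then show ?thesis using r by simp
next
  case False
  define v where "v z = integral {0..2*pi} (\<lambda>t. cmod (f (z * cis t)) powr p)" for z
  have vrad: "v z = circle_integral p f (cmod z)" if "cmod z < R" for z
    unfolding v_def using that p by (intro circle_integral_rotate[OF f]) auto
  have cf: "continuous_on (ball 0 R) f" using f by (rule holomorphic_on_imp_continuous_on)
  have vc: "continuous_on (ball 0 R) v"
  proof -
    have "continuous_on (ball 0 R \<times> UNIV) (\<lambda>x. f (fst x * cis (snd x)))"
      unfolding cis_conv_exp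
      by (rule continuous_on_compose2[OF cf]) (auto intro!: continuous_intros simp: norm_mult)
    then have "continuous_on (ball 0 R \<times> UNIV) (\<lambda>x. cmod (f (fst x * cis (snd x))) powr p)"
      by (intro continuous_on_powr'[OF continuous_on_norm continuous_on_const]) (use p in auto)
    then have "continuous_on (ball 0 R \<times> cbox 0 (2*pi)) (\<lambda>(z, t). cmod (f (z * cis t)) powr p)"
      unfolding case_prod_beta by (rule continuous_on_subset) auto
    then show ?thesis unfolding v_def
      using integral_continuous_on_param[of "ball 0 R" 0 "2*pi" "\<lambda>z t. cmod (f (z * cis t)) powr p"] by simp
  qed
  \<comment> \<open>The submean inequality for the rotated functions w -> f (w cis t) is integrated
    over t, and the two integrals are exchanged.\<close>
  have sub: "2 * pi * v z \<le> integral {0..2*pi} (\<lambda>s. v (z + of_real d * cis s))"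
    if d: "0 < d" "cmod z + d < R" for z d
  proof -
    define F where "F t s = cmod (f ((z + of_real d * cis s) * cis t)) powr p" for t s
    have inR: "cmod (z + of_real d * cis s) < R" for s
      using norm_triangle_ineq[of z "of_real d * cis s"] d by (simp add: norm_mult)
    have "continuous_on UNIV (\<lambda>x. f ((z + of_real d * cis (snd x)) * cis (fst x)))"
      using inR unfolding cis_conv_exp
      by (intro continuous_on_compose2[OF cf]) (auto intro!: continuous_intros simp: norm_mult)
    then have "continuous_on UNIV (\<lambda>x. cmod (f ((z + of_real d * cis (snd x)) * cis (fst x))) powr p)"
      by (intro continuous_on_powr'[OF continuous_on_norm continuous_on_const]) (use p in auto)
    then have F: "continuous_on A (\<lambda>(t, s). F t s)" for A
      unfolding F_def case_prod_beta by (rule continuous_on_subset) auto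
    have Fi: "(\<lambda>t. integral {0..2*pi} (F t)) integrable_on {0..2*pi}"
      using integral_continuous_on_param[of "{0..2*pi}" 0 "2*pi" F] F
      by (intro integrable_continuous_real) simp
    have vi: "(\<lambda>t. 2 * pi * cmod (f (z * cis t)) powr p) integrable_on {0..2*pi}"
    proof (intro integrable_continuous_real continuous_on_mult_left)
      have "continuous_on {0..2*pi} (\<lambda>t. f (z * cis t))"
        unfolding cis_conv_exp
        by (rule continuous_on_compose2[OF cf]) (use d in \<open>auto intro!: continuous_intros simp: norm_mult\<close>)
      then show "continuous_on {0..2*pi} (\<lambda>t. cmod (f (z * cis t)) powr p)"
        by (intro continuous_on_powr'[OF continuous_on_norm continuous_on_const]) (use p in auto)
    qed
    have "2 * pi * v z = integral {0..2*pi} (\<lambda>t. 2 * pi * cmod (f (z * cis t)) powr p)"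
      by (simp add: v_def)
    also have "\<dots> \<le> integral {0..2*pi} (\<lambda>t. integral {0..2*pi} (F t))"
    proof (rule integral_le[OF vi Fi])
      fix t
      have "(\<lambda>w. f (w * cis t)) holomorphic_on ball z (R - cmod z)"
      proof (rule holomorphic_on_compose_fun[OF f])
        show "w * cis t \<in> ball 0 R" if "w \<in> ball z (R - cmod z)" for w
          using that norm_triangle_ineq2[of w z] by (simp add: norm_mult dist_norm norm_minus_commute)
      qed (intro holomorphic_intros)
      from powr_norm_submean[OF this d(1) _ p]
      show "2 * pi * cmod (f (z * cis t)) powr p \<le> integral {0..2*pi} (F t)"
        using d by (simp add: F_def[abs_def])
    qed
    also have "\<dots> = integral {0..2*pi} (\<lambda>s. integral {0..2*pi} (\<lambda>t. F t s))"
      using integral_swap_continuous[of 0 0 "2*pi" "2*pi" F] F by simp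
    also have "\<dots> = integral {0..2*pi} (\<lambda>s. v (z + of_real d * cis s))"
      by (simp add: v_def F_def)
    finally show ?thesis .
  qed
  have vcr: "continuous_on (cball 0 r) v" by (rule continuous_on_subset[OF vc]) (use r in auto)
  obtain x where x: "x \<in> cball 0 r" "\<And>y. y \<in> cball 0 r \<Longrightarrow> v y \<le> v x"
    using continuous_attains_sup[OF compact_cball _ vcr] r by auto
  \<comment> \<open>Among the maximum points of \<open>v\<close> one farthest from 0 is taken. If it
    lay inside, the circle of radius \<open>d = r - cmod z\<close> about it would consist of maximum
    points, and that circle touches the one of radius \<open>r\<close>.\<close>
  define K where "K = cball 0 r \<inter> v -` {v x}"
  have "closed K" unfolding K_def
    by (rule continuous_closed_preimage[OF vcr]) auto
  then have "compact K" unfolding K_def by (metis compact_Int_closed compact_cball inf.left_idem)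
  moreover have "x \<in> K" using x by (simp add: K_def)
  ultimately obtain z where z: "z \<in> K" "\<And>y. y \<in> K \<Longrightarrow> cmod y \<le> cmod z"
    using continuous_attains_sup[of K cmod] by (metis continuous_on_norm_id empty_iff)
  have "cmod z = r"
  proof (rule ccontr)
    assume "cmod z \<noteq> r"
    then have zr: "cmod z < r" using z(1) by (auto simp: K_def)
    define d where "d = r - cmod z"
    have d: "0 < d" "cmod z + d < R" using zr r by (auto simp: d_def)
    have le: "cmod (z + of_real d * cis s) \<le> r" for s
    proof -
      have "cmod (z + of_real d * cis s) \<le> cmod z + d"
        using norm_triangle_ineq[of z "of_real d * cis s"] d by (simp add: norm_mult)
      then show ?thesis by (simp add: d_def)
    qed
    define w where "w s = v x - v (z + of_real d * cis s)" for s
    have "continuous_on {0..2*pi} (\<lambda>s. v (z + of_real d * cis s))"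
      unfolding cis_conv_exp
      by (rule continuous_on_compose2[OF vcr])
        (use le in \<open>auto intro!: continuous_intros simp: cis_conv_exp\<close>)
    then have wc: "continuous_on {0..2*pi} w" unfolding w_def by (intro continuous_intros)
    have w0: "0 \<le> w s" for s using x(2) le by (simp add: w_def)
    have "integral {0..2*pi} w = 2 * pi * v x - integral {0..2*pi} (\<lambda>s. v (z + of_real d * cis s))"
      unfolding w_def using \<open>continuous_on {0..2*pi} (\<lambda>s. v (z + of_real d * cis s))\<close>
      by (subst integral_diff) (auto intro!: integrable_continuous_real)
    also have "\<dots> \<le> 0" using sub[OF d] z(1) by (simp add: K_def)
    finally have "integral {0..2*pi} w = 0"
      using integral_nonneg[OF integrable_continuous_real[OF wc]] w0 by (metis order_antisym)
    then have all: "\<forall>s\<in>{0..2*pi}. w s = 0"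
      by (subst (asm) integral_eq_0_iff) (use wc w0 in auto)
    define s where "s = Arg2pi z"
    have s: "s \<in> {0..2*pi}" using Arg2pi_ge_0[of z] Arg2pi_lt_2pi[of z] by (auto simp: s_def)
    have "z = of_real (cmod z) * cis s"
      using Arg2pi_eq[of z] by (simp add: s_def cis_conv_exp mult.commute)
    then have "z + of_real d * cis s = of_real (cmod z + d) * cis s"
      by (metis distrib_right of_real_add)
    then have "cmod (z + of_real d * cis s) = r" using r by (simp add: norm_mult d_def)
    moreover from this have "z + of_real d * cis s \<in> K" using all s by (simp add: K_def w_def)
    ultimately show False using z(2) zr by fastforce
  qed
  then have "v x = circle_integral p f r" using z(1) vrad[of z] r by (simp add: K_def)
  moreover have "v (of_real s) = circle_integral p f s" using vrad[of "of_real s"] r by simp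
  moreover have "v (of_real s) \<le> v x" using r by (intro x) auto
  ultimately show ?thesis by simp
qed

lemma circle_integral_tendsto:
  assumes f: "\<And>n. f n holomorphic_on ball 0 R" and r: "0 \<le> r" "r < R" and p: "0 < p"
    and bd: "\<And>n z. cmod z = r \<Longrightarrow> cmod (f n z) \<le> B"
    and lim: "\<And>z. cmod z = r \<Longrightarrow> (\<lambda>n. f n z) \<longlonglongrightarrow> g z"
  shows "(\<lambda>n. circle_integral p (f n) r) \<longlonglongrightarrow> circle_integral p g r"
  unfolding circle_integral_def
proof (rule dominated_convergence(2)[where h = "\<lambda>_. B powr p"])
  show "(\<lambda>t. cmod (f n (of_real r * cis t)) powr p) integrable_on {0..2*pi}" for n
    by (rule circle_integrable[OF f r p])
  show "(\<lambda>n. cmod (f n (of_real r * cis t)) powr p) \<longlonglongrightarrow> cmod (g (of_real r * cis t)) powr p" for t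
  proof (rule tendsto_powr')
    show "(\<lambda>n. cmod (f n (of_real r * cis t))) \<longlonglongrightarrow> cmod (g (of_real r * cis t))"
      using r by (intro tendsto_norm lim) (simp add: norm_mult)
  qed (use p in auto)
  show "norm (cmod (f n (of_real r * cis t)) powr p) \<le> B powr p" for n t
    using bd[of "of_real r * cis t" n] r p by (auto simp: norm_mult intro!: powr_mono2)
qed auto

section \<open>Convergence of dilations\<close>

lemma circle_integral_dilate:
  "circle_integral p (\<lambda>z. f (of_real c * z)) r = circle_integral p f (c * r)"
  by (simp add: circle_integral_def mult.assoc)

lemma powr_superadditive:
  fixes u v s :: real
  assumes "0 \<le> u" "0 \<le> v" "1 \<le> s"
  shows "u powr s + v powr s \<le> (u + v) powr s"
proof -
  have split: "x powr s = x * x powr (s - 1)" if "0 \<le> x" for x :: real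
    using that powr_mult_base[of x "s - 1"] by simp
  have "u powr s + v powr s \<le> u * (u + v) powr (s - 1) + v * (u + v) powr (s - 1)"
    using assms by (auto simp: split intro!: add_mono mult_left_mono powr_mono2)
  also have "\<dots> = (u + v) powr s" using assms by (simp add: split flip: distrib_right)
  finally show ?thesis .
qed

text \<open>The parallelogram law for squares, then the power \<open>q / 2 \<ge> 1\<close>: its
  superadditivity bounds the left side and its convexity the right one.\<close>

lemma Clarkson_inequality:
  fixes a b :: complex
  assumes q: "2 \<le> q"
  shows "cmod ((a - b) / 2) powr q + cmod ((a + b) / 2) powr q \<le> (cmod a powr q + cmod b powr q) / 2"
proof -
  have sq: "x powr q = (x\<^sup>2) powr (q / 2)" if "0 \<le> x" for x :: real
    using that by (simp add: powr_powr flip: powr_numeral)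
  have par: "(cmod ((a - b) / 2))\<^sup>2 + (cmod ((a + b) / 2))\<^sup>2 = 1/2 * (cmod a)\<^sup>2 + 1/2 * (cmod b)\<^sup>2"
    by (simp only: cmod_power2) (simp add: power2_eq_square field_simps)
  have "cmod ((a - b) / 2) powr q + cmod ((a + b) / 2) powr q
      \<le> (1/2 * (cmod a)\<^sup>2 + 1/2 * (cmod b)\<^sup>2) powr (q / 2)"
    unfolding par[symmetric] sq[OF norm_ge_zero] using q by (intro powr_superadditive) auto
  also have "\<dots> \<le> 1/2 * (cmod a)\<^sup>2 powr (q / 2) + 1/2 * (cmod b)\<^sup>2 powr (q / 2)"
    using q by (intro powr_convex_nonneg) auto
  finally show ?thesis unfolding sq[OF norm_ge_zero] by simp
qed

lemma powr_norm_add_le: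
  fixes x y :: "'a::real_normed_vector"
  assumes "0 \<le> p"
  shows "norm (x + y) powr p \<le> 2 powr p * (norm x powr p + norm y powr p)"
proof -
  have "norm (x + y) powr p \<le> (2 * max (norm x) (norm y)) powr p"
    using norm_triangle_ineq[of x y] assms by (intro powr_mono2) auto
  also have "\<dots> = 2 powr p * max (norm x) (norm y) powr p" by (simp add: powr_mult)
  also have "max (norm x) (norm y) powr p \<le> norm x powr p + norm y powr p" by (simp add: max_def)
  finally show ?thesis by simp
qed

lemma circle_integral_add_le:
  assumes "f holomorphic_on ball 0 R" "g holomorphic_on ball 0 R" "0 \<le> r" "r < R" "0 < p"
  shows "circle_integral p (\<lambda>z. f z + g z) r \<le> 2 powr p * (circle_integral p f r + circle_integral p g r)"
proof -
  have J: "((\<lambda>t. 2 powr p * (cmod (f (of_real r * cis t)) powr p + cmod (g (of_real r * cis t)) powr p)) has_integral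
      2 powr p * (circle_integral p f r + circle_integral p g r)) {0..2*pi}"
    unfolding circle_integral_def
    by (intro has_integral_mult_right has_integral_add integrable_integral circle_integrable[OF assms(1)]
        circle_integrable[OF assms(2)] assms)
  have I: "((\<lambda>t. cmod (f (of_real r * cis t) + g (of_real r * cis t)) powr p) has_integral
      circle_integral p (\<lambda>z. f z + g z) r) {0..2*pi}"
    unfolding circle_integral_def
    by (intro integrable_integral circle_integrable[of "\<lambda>z. f z + g z" R] holomorphic_intros assms)
  show ?thesis
    by (rule has_integral_le[OF I J powr_norm_add_le]) (use assms(5) in simp)
qed

text \<open>A weighted arithmetic-geometric mean inequality in place of Cauchy-Schwarz. The free
  weight \<open>s\<close> later balances a small factor against one that is only bounded.\<close>

lemma circle_integral_mult_le:
  assumes "f holomorphic_on ball 0 R" "g holomorphic_on ball 0 R" "0 \<le> r" "r < R" "0 < p" "0 < s"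
  shows "circle_integral p (\<lambda>z. f z * g z) r
    \<le> (s * circle_integral (2 * p) f r + circle_integral (2 * p) g r / s) / 2"
proof -
  have p2: "0 < 2 * p" using assms by simp
  have pw: "cmod (x * y) powr p \<le> (s * cmod x powr (2 * p) + cmod y powr (2 * p) / s) / 2" for x y :: complex
  proof -
    define u v where "u = cmod x powr p" and "v = cmod y powr p"
    have "cmod x powr (2 * p) = u\<^sup>2" "cmod y powr (2 * p) = v\<^sup>2"
      using powr_powr[of "cmod x" p 2] powr_powr[of "cmod y" p 2]
      by (simp_all add: u_def v_def mult.commute)
    moreover have "0 \<le> (s * u - v)\<^sup>2 / s" using assms by simp
    then have "2 * (u * v) \<le> s * u\<^sup>2 + v\<^sup>2 / s"
      using assms by (simp add: power2_eq_square field_simps)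
    ultimately show ?thesis by (simp add: norm_mult powr_mult u_def[symmetric] v_def[symmetric])
  qed
  have J: "((\<lambda>t. (s * cmod (f (of_real r * cis t)) powr (2 * p) + cmod (g (of_real r * cis t)) powr (2 * p) / s) / 2)
      has_integral (s * circle_integral (2 * p) f r + circle_integral (2 * p) g r / s) / 2) {0..2*pi}"
    unfolding circle_integral_def
    by (intro has_integral_mult_right has_integral_add has_integral_divide integrable_integral
        circle_integrable[OF assms(1)] circle_integrable[OF assms(2)] assms p2)
  have I: "((\<lambda>t. cmod (f (of_real r * cis t) * g (of_real r * cis t)) powr p) has_integral
      circle_integral p (\<lambda>z. f z * g z) r) {0..2*pi}"
    unfolding circle_integral_def
    by (intro integrable_integral circle_integrable[of "\<lambda>z. f z * g z" R] holomorphic_intros assms)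
  show ?thesis by (rule has_integral_le[OF I J]) (rule pw)
qed

lemma holomorphic_point_bound:
  assumes f: "f holomorphic_on ball 0 1" and p: "1 \<le> p" and z: "cmod z < 1"
    and C: "\<And>r. 0 < r \<Longrightarrow> r < 1 \<Longrightarrow> circle_integral p f r \<le> 2 * pi * C powr p" and C0: "0 \<le> C"
  shows "cmod (f z) \<le> 2 / (1 - cmod z) * C"
proof -
  define r where "r = (1 + cmod z) / 2"
  have r: "0 < r" "cmod z < r" "r < 1"
    using z by (auto simp: r_def add_pos_nonneg)
  define m where "m = 1 / (2 * pi) * circle_integral 1 f r"
  have m0: "0 \<le> m" by (simp add: m_def circle_integral_nonneg)
  have "m powr p \<le> 1 / (2 * pi) * circle_integral p f r"
    unfolding m_def using r p by (intro circle_integral_Jensen[OF f]) auto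
  also have "\<dots> \<le> 1 / (2 * pi) * (2 * pi * C powr p)" by (intro mult_left_mono C r) simp
  also have "\<dots> = C powr p" by simp
  finally have mC: "m \<le> C" using powr_less_mono2[of p C m] p m0 C0 by linarith
  have "cmod (f z) \<le> r / (r - cmod z) * m"
    unfolding m_def by (rule Cauchy_circle_bound[OF f]) (use r in auto)
  also have "\<dots> \<le> 2 / (1 - cmod z) * C"
  proof (intro mult_mono mC m0)
    have "r - cmod z = (1 - cmod z) / 2" by (simp add: r_def field_simps)
    then have "2 / (1 - cmod z) = 1 / (r - cmod z)" by (simp only:) simp
    moreover have "r / (r - cmod z) \<le> 1 / (r - cmod z)" using r by (intro divide_right_mono) auto
    ultimately show "r / (r - cmod z) \<le> 2 / (1 - cmod z)" by simp
  qed (use z in auto)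
  finally show ?thesis .
qed

lemma holomorphic_on_dilate:
  assumes f: "f holomorphic_on ball 0 1" and r: "0 < r" "r \<le> 1"
  shows "(\<lambda>z. f (of_real r * z)) holomorphic_on ball 0 (1 / r)"
    and "(\<lambda>z. f (of_real r * z)) holomorphic_on ball 0 1"
proof -
  show "(\<lambda>z. f (of_real r * z)) holomorphic_on ball 0 (1 / r)"
    by (rule holomorphic_on_compose_fun[OF f])
      (use r in \<open>auto intro!: holomorphic_intros simp: norm_mult pos_less_divide_eq mult.commute\<close>)
  then show "(\<lambda>z. f (of_real r * z)) holomorphic_on ball 0 1"
    by (rule holomorphic_on_subset[OF _ subset_ball]) (use r in \<open>simp add: pos_le_divide_eq\<close>)
qed

text \<open>The argument is uniform convexity: the mean \<open>(f + f\<^sub>r) / 2\<close> has norm close to that of \<open>f\<close>.\<close>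

lemma dilation_converges_ge2:
  assumes f: "f holomorphic_on ball 0 1" and q: "2 \<le> q"
    and bd: "\<And>r. 0 < r \<Longrightarrow> r < 1 \<Longrightarrow> circle_integral q f r \<le> C"
    and rr: "\<And>n. 0 < rr n" "\<And>n. rr n < 1" "rr \<longlonglongrightarrow> 1" and e: "0 < e"
  shows "\<forall>\<^sub>F n in sequentially. \<forall>s\<in>{0<..<1}. circle_integral q (\<lambda>z. f z - f (of_real (rr n) * z)) s \<le> e"
proof -
  define J where "J = circle_integral q f"
  have bda: "bdd_above (J ` {0<..<1})" using bd by (auto simp: J_def intro!: bdd_aboveI2)
  define V where "V = (SUP r\<in>{0<..<1}. J r)"
  have JV: "J r \<le> V" if "0 < r" "r < 1" for r
    unfolding V_def using that by (intro cSUP_upper bda) auto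
  \<comment> \<open>\<open>h\<close> below is half the difference, so the bound \<open>d\<close> for
    \<open>h\<close> is the bound \<open>e\<close> for the difference.\<close>
  define d where "d = e / 2 powr q"
  have d: "0 < d" using e by (simp add: d_def)
  have "V - d < (SUP r\<in>{0<..<1}. J r)" using d by (simp add: V_def)
  then obtain s0 where s0: "0 < s0" "s0 < 1" "V - d < J s0"
    by (subst (asm) less_cSUP_iff) (use bda in auto)
  define g where "g n z = (f z + f (of_real (rr n) * z)) / 2" for n z
  define h where "h n z = (f z - f (of_real (rr n) * z)) / 2" for n z
  have fr: "(\<lambda>z. f (of_real (rr n) * z)) holomorphic_on ball 0 1" for n
    by (rule holomorphic_on_dilate(2)[OF f]) (use rr(1,2)[of n] in auto)
  have gh: "g n holomorphic_on ball 0 1" "h n holomorphic_on ball 0 1" for n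
    unfolding g_def h_def by (intro holomorphic_intros f fr; simp)+
  have lim: "(\<lambda>n. circle_integral q (g n) s0) \<longlonglongrightarrow> circle_integral q f s0"
  proof -
    obtain B where B: "\<And>z. cmod z \<le> s0 \<Longrightarrow> cmod (f z) \<le> B"
      using holomorphic_bounded_on_cball[OF f s0(2)] by blast
    show ?thesis
    proof (rule circle_integral_tendsto[OF gh(1)])
      fix n z assume z: "cmod z = s0"
      have in0: "cmod (of_real (rr n) * z) \<le> s0" for n
        using z s0 rr(1,2)[of n] by (simp add: norm_mult mult_left_le_one_le)
      have "cmod (f z + f (of_real (rr n) * z)) \<le> B + B"
        using B[of z] B[OF in0[of n]] z by (intro order_trans[OF norm_triangle_ineq] add_mono) auto
      then show "cmod (g n z) \<le> B" by (simp add: g_def norm_divide)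
      have "isCont f z"
        using continuous_on_interior[OF holomorphic_on_imp_continuous_on[OF f], of z] z s0 by simp
      moreover have "(\<lambda>n. of_real (rr n) * z) \<longlonglongrightarrow> of_real 1 * z" by (intro tendsto_intros rr)
      ultimately have "(\<lambda>n. f (of_real (rr n) * z)) \<longlonglongrightarrow> f z" by (simp add: isCont_tendsto_compose[where g = f])
      then have "(\<lambda>n. (f z + f (of_real (rr n) * z)) / 2) \<longlonglongrightarrow> (f z + f z) / 2" by (intro tendsto_intros) auto
      then show "(\<lambda>n. g n z) \<longlonglongrightarrow> f z" by (simp add: g_def)
    qed (use s0 q in auto)
  qed
  have ev: "\<forall>\<^sub>F n in sequentially. V - d < circle_integral q (g n) s0"
    by (rule order_tendstoD(1)[OF lim]) (use s0 in \<open>simp add: J_def\<close>)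
  have main: "circle_integral q (\<lambda>z. f z - f (of_real (rr n) * z)) s \<le> e"
    if n: "V - d < circle_integral q (g n) s0" and s: "s \<in> {0<..<1}" for n s
  proof -
    \<comment> \<open>\<open>t\<close> dominates both radii: monotonicity carries the lower bound
      for \<open>g n\<close> from \<open>s0\<close> up to \<open>t\<close>, and the upper bound for
      \<open>h n\<close> from \<open>t\<close> down to \<open>s\<close>. So a limit at the single
      radius \<open>s0\<close> gives an estimate uniform in \<open>s\<close>.\<close>
    define t where "t = max s s0"
    have t: "0 < t" "t < 1" "s \<le> t" "s0 \<le> t" using s s0 by (auto simp: t_def)
    have rt: "0 < rr n * t" "rr n * t < 1" using t rr(1,2)[of n] mult_strict_mono[of "rr n" 1 t 1] by auto
    have I1: "((\<lambda>u. (cmod (f (of_real t * cis u)) powr q + cmod (f (of_real (rr n) * (of_real t * cis u))) powr q) / 2)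
        has_integral (J t + J (rr n * t)) / 2) {0..2*pi}"
      unfolding J_def circle_integral_dilate[symmetric] unfolding circle_integral_def
      by (intro has_integral_divide has_integral_add integrable_integral circle_integrable[OF f] circle_integrable[OF fr])
        (use t q in auto)
    have I2: "((\<lambda>u. cmod (h n (of_real t * cis u)) powr q + cmod (g n (of_real t * cis u)) powr q) has_integral
        circle_integral q (h n) t + circle_integral q (g n) t) {0..2*pi}"
      unfolding circle_integral_def
      by (intro has_integral_add integrable_integral circle_integrable[OF gh(1)] circle_integrable[OF gh(2)])
        (use t q in auto)
    have "circle_integral q (h n) t + circle_integral q (g n) t \<le> (J t + J (rr n * t)) / 2"
      by (rule has_integral_le[OF I2 I1]) (simp only: h_def g_def Clarkson_inequality[OF q])
    also have "\<dots> \<le> V" using JV[of t] JV[of "rr n * t"] t rt by simp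
    finally have "circle_integral q (h n) t \<le> V - circle_integral q (g n) t" by simp
    moreover have "circle_integral q (g n) s0 \<le> circle_integral q (g n) t"
      by (rule circle_integral_increasing[OF gh(1)]) (use s0 t q in auto)
    moreover have "circle_integral q (h n) s \<le> circle_integral q (h n) t"
      by (rule circle_integral_increasing[OF gh(2)]) (use s t q in auto)
    ultimately have "circle_integral q (h n) s \<le> d" using n by linarith
    moreover have "circle_integral q (\<lambda>z. f z - f (of_real (rr n) * z)) s = 2 powr q * circle_integral q (h n) s"
    proof -
      have "(\<lambda>z. f z - f (of_real (rr n) * z)) = (\<lambda>z. 2 * h n z)" by (simp add: h_def fun_eq_iff)
      then show ?thesis using circle_integral_cmult[of q 2 "h n" s] by simp
    qed
    ultimately show ?thesis by (simp add: d_def field_simps)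
  qed
  show ?thesis by (rule eventually_mono[OF ev]) (use main in blast)
qed

section \<open>Removal of zeros and factorization through a square root\<close>

lemma Blaschke_norm:
  assumes "cmod a < 1" "cmod z \<le> 1"
  shows "cmod (z - a) \<le> cmod (1 - cnj a * z)" "cmod z = 1 \<Longrightarrow> cmod (z - a) = cmod (1 - cnj a * z)"
proof -
  have id: "(cmod (1 - cnj a * z))\<^sup>2 - (cmod (z - a))\<^sup>2 = (1 - (cmod a)\<^sup>2) * (1 - (cmod z)\<^sup>2)"
    by (simp only: cmod_power2) (simp add: power2_eq_square algebra_simps)
  have "0 \<le> (1 - (cmod a)\<^sup>2) * (1 - (cmod z)\<^sup>2)"
    using assms by (intro mult_nonneg_nonneg) (auto simp: power_le_one)
  then have "(cmod (z - a))\<^sup>2 \<le> (cmod (1 - cnj a * z))\<^sup>2" using id by linarith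
  then show "cmod (z - a) \<le> cmod (1 - cnj a * z)" by (rule power2_le_imp_le) simp
  assume "cmod z = 1"
  then have "(cmod (1 - cnj a * z))\<^sup>2 = (cmod (z - a))\<^sup>2" using id by simp
  then show "cmod (z - a) = cmod (1 - cnj a * z)" by (simp add: power2_eq_iff_nonneg)
qed

text \<open>\<open>F\<close> is \<open>f\<close> divided by the Blaschke product of its zeros.\<close>

lemma remove_zeros:
  assumes R: "1 < R" and f: "f holomorphic_on ball 0 R" and b: "b \<in> ball 0 R" "f b \<noteq> 0"
  shows "\<exists>F. F holomorphic_on ball 0 R \<and> (\<forall>z\<in>ball 0 1. F z \<noteq> 0) \<and>
    (\<forall>z\<in>cball 0 1. cmod (f z) \<le> cmod (F z)) \<and> (\<forall>z. cmod z = 1 \<longrightarrow> cmod (F z) = cmod (f z))"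
  using f b
proof (induction "card {z\<in>ball 0 1. f z = 0}" arbitrary: f b rule: less_induct)
  case (less f b)
  show ?case
  proof (cases "\<exists>a\<in>ball 0 1. f a = 0")
    case False
    then show ?thesis using less.prems by (intro exI[of _ f]) auto
  next
    case True
    then obtain a where a: "cmod a < 1" "f a = 0" by auto
    have aR: "a \<in> ball 0 R" using a R by simp
    have nc: "\<not> f constant_on ball 0 R"
      using a(2) aR less.prems by (metis constant_on_def)
    \<comment> \<open>Holomorphy beyond the closed disc makes the number of zeros finite; the
      induction runs on those in the open disc.\<close>
    have "finite {z\<in>cball 0 1. f z = 0}"
      by (rule holomorphic_compact_finite_zeros[OF less.prems(1) _ _ _ _ nc]) (use R in auto)
    then have fin: "finite {z\<in>ball 0 1. f z = 0}" by (rule rev_finite_subset) auto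
    obtain g r n where g: "0 < n" "0 < r" "ball a r \<subseteq> ball 0 R" "g holomorphic_on ball a r"
      "\<And>w. w \<in> ball a r \<Longrightarrow> f w = (w - a) ^ n * g w" "\<And>w. w \<in> ball a r \<Longrightarrow> g w \<noteq> 0"
      using holomorphic_factor_zero_nonconstant[OF less.prems(1) open_ball connected_ball aR a(2) nc] by metis
    define k where "k z = (if z = a then g a else f z / (z - a) ^ n)" for z
    have kg: "k z = g z" if "z \<in> ball a r" for z using g(5)[OF that] by (simp add: k_def)
    have fk: "f z = (z - a) ^ n * k z" for z using g(1) a(2) by (simp add: k_def)
    have "k holomorphic_on (ball 0 R - {a}) \<longleftrightarrow> (\<lambda>z. f z / (z - a) ^ n) holomorphic_on (ball 0 R - {a})"
      by (rule holomorphic_cong) (auto simp: k_def)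
    also have "\<dots>" by (intro holomorphic_intros holomorphic_on_subset[OF less.prems(1)]) auto
    finally have k1: "k holomorphic_on (ball 0 R - {a})" .
    have "k holomorphic_on ball a r" using g(4) kg by (subst holomorphic_cong[OF refl kg])
    then have "isCont k a"
      using continuous_on_interior[OF holomorphic_on_imp_continuous_on, of k "ball a r" a] g(2) by simp
    then have "(k \<longlongrightarrow> k a) (at a within ball 0 R)"
      unfolding isCont_def by (rule tendsto_within_subset) simp
    then have k: "k holomorphic_on ball 0 R"
      using no_isolated_singularity'[of "{a}" k "ball 0 R"] k1 by auto
    \<comment> \<open>The factor (z - a)^n is replaced by one that has the same modulus on the unit
      circle, at least the same modulus inside, and no zero in the closed disc.\<close>
    define F where "F z = k z * (1 - cnj a * z) ^ n" for z
    have F: "F holomorphic_on ball 0 R" unfolding F_def by (intro holomorphic_intros k)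
    have nz: "1 - cnj a * z \<noteq> 0" if "cmod z \<le> 1" for z
    proof
      assume "1 - cnj a * z = 0"
      then have "cmod (cnj a * z) = 1" by (metis eq_iff_diff_eq_0 norm_one)
      then show False using a(1) that mult_left_mono[of "cmod z" 1 "cmod a"] by (simp add: norm_mult)
    qed
    have "k a \<noteq> 0" using g(2,6) by (simp add: k_def)
    then have Fa: "F a \<noteq> 0" using nz[of a] a(1) by (simp add: F_def)
    have "{z\<in>ball 0 1. F z = 0} = {z\<in>ball 0 1. f z = 0} - {a}"
      using \<open>k a \<noteq> 0\<close> nz Fa by (auto simp: F_def fk)
    then have "card {z\<in>ball 0 1. F z = 0} < card {z\<in>ball 0 1. f z = 0}"
      using card_Diff1_less[OF fin, of a] a by simp
    from less.hyps[OF this F aR Fa] obtain G where G: "G holomorphic_on ball 0 R"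
      "\<forall>z\<in>ball 0 1. G z \<noteq> 0" "\<forall>z\<in>cball 0 1. cmod (F z) \<le> cmod (G z)"
      "\<forall>z. cmod z = 1 \<longrightarrow> cmod (G z) = cmod (F z)" by blast
    have fF: "cmod (f z) \<le> cmod (F z)" if "cmod z \<le> 1" for z
      using Blaschke_norm(1)[OF a(1) that]
      by (simp add: fk F_def norm_mult norm_power mult.commute mult_left_mono power_mono)
    moreover have "cmod (f z) = cmod (F z)" if "cmod z = 1" for z
      using Blaschke_norm(2)[OF a(1) _ that] that by (simp add: fk F_def norm_mult norm_power)
    moreover have "cmod (f z) \<le> cmod (G z)" if "cmod z \<le> 1" for z
      using order_trans[OF fF[OF that]] G(3) that by simp
    ultimately show ?thesis using G by (intro exI[of _ G]) simp
  qed
qed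

lemma dilation_radii:
  fixes c :: real
  assumes c: "c < 1"
  obtains rr :: "nat \<Rightarrow> real" where "\<And>n. c < rr n" "\<And>n. rr n < 1" "rr \<longlonglongrightarrow> 1"
proof -
  \<comment> \<open>The denominator starts at 2 so that \<open>c < rr n\<close> is strict already
    for \<open>n = 0\<close>.\<close>
  define rr where "rr n = 1 - (1 - c) / real (n + 2)" for n
  have lt: "(1 - c) / real (n + 2) < (1 - c) / 1" for n
    using c by (intro divide_strict_left_mono) auto
  have "c < rr n" for n unfolding rr_def using lt[of n] by (simp only: less_diff_eq div_by_1 add.commute)
  moreover have "rr n < 1" for n using c by (simp add: rr_def)
  moreover have "(\<lambda>n. (1 - c) / real (n + 2)) \<longlonglongrightarrow> 0"
    by (rule LIMSEQ_ignore_initial_segment[OF lim_const_over_n])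
  from tendsto_diff[OF tendsto_const[of 1] this] have "rr \<longlonglongrightarrow> 1" by (simp add: rr_def[abs_def])
  ultimately show thesis using that by blast
qed

lemma circle_integral_bounded_nonneg:
  assumes "\<And>r. 0 < r \<Longrightarrow> r < 1 \<Longrightarrow> circle_integral p f r \<le> C"
  shows "0 \<le> C"
  using assms[of "1/2"] circle_integral_nonneg[of p f "1/2"] by simp

text \<open>Takes the role of compactness in H^p. The circle bounds control point values locally
  uniformly, so Montel applies; on each fixed circle the functions are uniformly bounded, and
  dominated convergence hands the bound to the limit.\<close>

lemma circle_bounded_subsequence:
  assumes F: "\<And>n. F n holomorphic_on ball 0 1" and p: "1 \<le> p"
    and C: "\<And>n r. 0 < r \<Longrightarrow> r < 1 \<Longrightarrow> circle_integral p (F n) r \<le> C"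
  obtains g s where "g holomorphic_on ball 0 1" "strict_mono (s :: nat \<Rightarrow> nat)"
    "\<And>z. z \<in> ball 0 1 \<Longrightarrow> (\<lambda>n. F (s n) z) \<longlonglongrightarrow> g z"
    "\<And>r. 0 < r \<Longrightarrow> r < 1 \<Longrightarrow> circle_integral p g r \<le> C"
proof -
  define c where "c = (C / (2 * pi)) powr (1 / p)"
  have C0: "0 \<le> C" by (rule circle_integral_bounded_nonneg) (rule C)
  have c: "2 * pi * c powr p = C" using C0 p by (simp add: c_def powr_powr)
  have pb: "cmod (F n z) \<le> 2 / (1 - cmod z) * c" if "cmod z < 1" for n z
    by (rule holomorphic_point_bound[OF F p that]) (use C c in \<open>simp_all add: c_def\<close>)
  have "\<exists>B. \<forall>h\<in>range F. \<forall>z\<in>K. cmod (h z) \<le> B" if K: "compact K" "K \<subseteq> ball 0 1" for K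
  proof (cases "K = {}")
    case False
    then obtain w where w: "w \<in> K" "\<And>z. z \<in> K \<Longrightarrow> cmod z \<le> cmod w"
      using continuous_attains_sup[OF K(1) _ continuous_on_norm_id] by blast
    have "cmod (F n z) \<le> 2 / (1 - cmod w) * c" if "z \<in> K" for n z
    proof -
      have "2 / (1 - cmod z) \<le> 2 / (1 - cmod w)"
        using w(2)[OF that] w(1) K(2) that by (intro divide_left_mono mult_pos_pos) (auto simp: subset_iff)
      then have "2 / (1 - cmod z) * c \<le> 2 / (1 - cmod w) * c" by (rule mult_right_mono) (simp add: c_def)
      moreover have "cmod z < 1" using K(2) that by auto
      ultimately show ?thesis using pb by (meson order_trans)
    qed
    then show ?thesis by blast
  qed auto
  note bounded = this
  obtain g s where g: "g holomorphic_on ball 0 1" "strict_mono (s :: nat \<Rightarrow> nat)"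
    "\<And>z. z \<in> ball 0 1 \<Longrightarrow> (\<lambda>n. F (s n) z) \<longlonglongrightarrow> g z"
    by (rule Montel[of "ball 0 1" "range F" F, OF open_ball _ bounded]) (use F in auto)
  moreover have "circle_integral p g r \<le> C" if r: "0 < r" "r < 1" for r
  proof (rule LIMSEQ_le_const2)
    show "(\<lambda>n. circle_integral p (F (s n)) r) \<longlonglongrightarrow> circle_integral p g r"
    proof (rule circle_integral_tendsto[OF F])
      show "cmod (F (s n) z) \<le> 2 / (1 - r) * c" if "cmod z = r" for n z using pb[of z] that r by simp
    qed (use r p g(3) in auto)
  qed (use C r in blast)
  ultimately show thesis using that by blast
qed

text \<open>With this factorization convergence of dilations in \<open>H\<^sup>p\<close>, also for \<open>p = 1\<close>, reduces to
  \<open>H\<^sup>2\<^sup>p\<close>, where uniform convexity is available.\<close>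

lemma holomorphic_factor_sqrt:
  assumes f: "f holomorphic_on ball 0 1" and p: "1 \<le> p"
    and C: "\<And>r. 0 < r \<Longrightarrow> r < 1 \<Longrightarrow> circle_integral p f r \<le> C"
  obtains k g where "k holomorphic_on ball 0 1" "g holomorphic_on ball 0 1"
    "\<And>z. z \<in> ball 0 1 \<Longrightarrow> f z = k z * g z"
    "\<And>r. 0 < r \<Longrightarrow> r < 1 \<Longrightarrow> circle_integral (2 * p) k r \<le> C"
    "\<And>r. 0 < r \<Longrightarrow> r < 1 \<Longrightarrow> circle_integral (2 * p) g r \<le> C"
proof (cases "\<forall>z\<in>ball 0 1. f z = 0")
  case True
  have "0 \<le> C" by (rule circle_integral_bounded_nonneg) (rule C)
  then show thesis
    using True by (intro that[of "\<lambda>_. 0" "\<lambda>_. 0"]) (auto simp: circle_integral_def)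
next
  case False
  then obtain b where b: "b \<in> ball 0 1" "f b \<noteq> 0" by blast
  \<comment> \<open>\<open>f\<close> may have infinitely many zeros, but a dilate is holomorphic
    past the closed disc and its zeros can be removed. With G^2 = F and k the dilate over G, |k| is
    at most |G|; the means of F increase to the unit circle, where F and the dilate have equal
    modulus.\<close>
  have step: "\<exists>k g. k holomorphic_on ball 0 1 \<and> g holomorphic_on ball 0 1 \<and>
      (\<forall>z\<in>ball 0 1. f (of_real r * z) = k z * g z) \<and>
      (\<forall>s. 0 < s \<longrightarrow> s < 1 \<longrightarrow> circle_integral (2 * p) k s \<le> C \<and> circle_integral (2 * p) g s \<le> C)"
    if r: "0 < r" "r < 1" "cmod b < r" for r :: real
  proof -
    define fr where "fr z = f (of_real r * z)" for z
    have R: "1 < 1 / r" using r by simp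
    have fr: "fr holomorphic_on ball 0 (1 / r)" unfolding fr_def
      using r by (intro holomorphic_on_dilate(1)[OF f]) auto
    have bR: "b / of_real r \<in> ball 0 (1 / r)" "fr (b / of_real r) \<noteq> 0"
      using b r by (auto simp: fr_def norm_divide divide_strict_right_mono)
    obtain F where F: "F holomorphic_on ball 0 (1 / r)" "\<forall>z\<in>ball 0 1. F z \<noteq> 0"
      "\<forall>z\<in>cball 0 1. cmod (fr z) \<le> cmod (F z)" "\<forall>z. cmod z = 1 \<longrightarrow> cmod (F z) = cmod (fr z)"
      using remove_zeros[OF R fr bR] by blast
    have sub: "ball 0 1 \<subseteq> (ball 0 (1 / r) :: complex set)" using R by (intro subset_ball) simp
    have F1: "F holomorphic_on ball 0 1" by (rule holomorphic_on_subset[OF F(1) sub])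
    have fr1: "fr holomorphic_on ball 0 1" by (rule holomorphic_on_subset[OF fr sub])
    obtain G where G: "G holomorphic_on ball 0 1" "\<And>z. z \<in> ball 0 1 \<Longrightarrow> F z = (G z)\<^sup>2"
      using contractible_imp_holomorphic_sqrt[OF F1 convex_imp_contractible[OF convex_ball]] F(2) by metis
    have Gnz: "G z \<noteq> 0" if "z \<in> ball 0 1" for z using F(2) G(2) that by fastforce
    define k where "k z = fr z / G z" for z
    have k: "k holomorphic_on ball 0 1"
      unfolding k_def using Gnz by (intro holomorphic_intros fr1 G) auto
    have kG: "cmod (k z) \<le> cmod (G z)" if "z \<in> ball 0 1" for z
    proof -
      have "cmod (fr z) \<le> cmod (G z) * cmod (G z)"
      proof -
        have "cmod (F z) = cmod (G z) * cmod (G z)"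
          unfolding G(2)[OF that] by (simp add: norm_mult power2_eq_square)
        then show ?thesis using bspec[OF F(3), of z] that by simp
      qed
      then show ?thesis using Gnz[OF that] by (simp add: k_def norm_divide pos_divide_le_eq)
    qed
    have Gs: "circle_integral (2 * p) G s \<le> C" if s: "0 < s" "s < 1" for s
    proof -
      have "circle_integral (2 * p) G s = circle_integral p F s"
        unfolding circle_integral_def
      proof (rule integral_cong)
        fix t
        have "of_real s * cis t \<in> ball 0 1" using s by (simp add: norm_mult)
        from G(2)[OF this] show "cmod (G (of_real s * cis t)) powr (2 * p) = cmod (F (of_real s * cis t)) powr p"
          by (simp add: norm_power powr_powr flip: powr_numeral)
      qed
      also have "\<dots> \<le> circle_integral p F 1"
        by (rule circle_integral_increasing[OF F(1)]) (use s R p in auto)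
      also have "\<dots> = circle_integral p fr 1" using F(4) by (intro circle_integral_cong) auto
      also have "\<dots> = circle_integral p f r" unfolding fr_def circle_integral_dilate by simp
      also have "\<dots> \<le> C" using r by (intro C)
      finally show ?thesis .
    qed
    moreover have "circle_integral (2 * p) k s \<le> C" if s: "0 < s" "s < 1" for s
      using circle_integral_mono[OF k G(1), of s "2 * p"] kG s p Gs[OF s] by fastforce
    moreover have "\<forall>z\<in>ball 0 1. f (of_real r * z) = k z * G z" using Gnz by (auto simp: k_def fr_def)
    ultimately show ?thesis using k G(1) by blast
  qed
  obtain rr :: "nat \<Rightarrow> real" where rrb: "\<And>n. cmod b < rr n" "\<And>n. rr n < 1" and rrlim: "rr \<longlonglongrightarrow> 1"
    using dilation_radii[of "cmod b"] b by auto
  have rr: "0 < rr n" "rr n < 1" "cmod b < rr n" for n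
    using rrb[of n] le_less_trans[OF norm_ge_zero rrb(1)[of n]] by auto
  obtain k g where kg: "\<And>n. k n holomorphic_on ball 0 1" "\<And>n. g n holomorphic_on ball 0 1"
    "\<And>n z. z \<in> ball 0 1 \<Longrightarrow> f (of_real (rr n) * z) = k n z * g n z"
    "\<And>n s. 0 < s \<Longrightarrow> s < 1 \<Longrightarrow> circle_integral (2 * p) (k n) s \<le> C"
    "\<And>n s. 0 < s \<Longrightarrow> s < 1 \<Longrightarrow> circle_integral (2 * p) (g n) s \<le> C"
    using step[OF rr] by metis
  have p2: "1 \<le> 2 * p" using p by simp
  \<comment> \<open>A second subsequence will be extracted from the first, so that both factors
    converge along \<open>s (s' n)\<close> while their product tends to \<open>f\<close>.\<close>
  obtain G s where G: "G holomorphic_on ball 0 1" "strict_mono (s :: nat \<Rightarrow> nat)"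
    "\<And>z. z \<in> ball 0 1 \<Longrightarrow> (\<lambda>n. g (s n) z) \<longlonglongrightarrow> G z"
    "\<And>r. 0 < r \<Longrightarrow> r < 1 \<Longrightarrow> circle_integral (2 * p) G r \<le> C"
    by (rule circle_bounded_subsequence[of g, OF kg(2) p2 kg(5)]) auto
  obtain K s' where K: "K holomorphic_on ball 0 1" "strict_mono (s' :: nat \<Rightarrow> nat)"
    "\<And>z. z \<in> ball 0 1 \<Longrightarrow> (\<lambda>n. k (s (s' n)) z) \<longlonglongrightarrow> K z"
    "\<And>r. 0 < r \<Longrightarrow> r < 1 \<Longrightarrow> circle_integral (2 * p) K r \<le> C"
    by (rule circle_bounded_subsequence[of "\<lambda>n. k (s n)", OF kg(1) p2 kg(4)]) auto
  have "f z = K z * G z" if z: "z \<in> ball 0 1" for z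
  proof (rule LIMSEQ_unique)
    have "isCont f z"
      using continuous_on_interior[OF holomorphic_on_imp_continuous_on[OF f], of z] z by simp
    moreover have "(\<lambda>n. of_real (rr n) * z) \<longlonglongrightarrow> of_real 1 * z" by (intro tendsto_intros rrlim)
    then have "(\<lambda>n. of_real (rr (s (s' n))) * z) \<longlonglongrightarrow> z"
      using LIMSEQ_subseq_LIMSEQ[OF _ strict_mono_o[OF G(2) K(2)]] by (fastforce simp: o_def)
    ultimately show "(\<lambda>n. f (of_real (rr (s (s' n))) * z)) \<longlonglongrightarrow> f z"
      by (rule isCont_tendsto_compose)
    have "(\<lambda>n. k (s (s' n)) z * g (s (s' n)) z) \<longlonglongrightarrow> K z * G z"
      using LIMSEQ_subseq_LIMSEQ[OF G(3)[OF z] K(2)] by (intro tendsto_mult K(3) z) (simp add: o_def)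
    then show "(\<lambda>n. f (of_real (rr (s (s' n))) * z)) \<longlonglongrightarrow> K z * G z"
      using kg(3)[OF z] by simp
  qed
  then show thesis using that[OF K(1) G(1)] K(4) G(4) by blast
qed

lemma dilation_converges:
  assumes f: "f holomorphic_on ball 0 1" and p: "1 \<le> p"
    and bd: "\<And>r. 0 < r \<Longrightarrow> r < 1 \<Longrightarrow> circle_integral p f r \<le> C"
    and rr: "\<And>n. 0 < rr n" "\<And>n. rr n < 1" "rr \<longlonglongrightarrow> 1" and e: "0 < e"
  shows "\<forall>\<^sub>F n in sequentially. \<forall>s\<in>{0<..<1}. circle_integral p (\<lambda>z. f z - f (of_real (rr n) * z)) s \<le> e"
proof -
  obtain k g where kg: "k holomorphic_on ball 0 1" "g holomorphic_on ball 0 1"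
    "\<And>z. z \<in> ball 0 1 \<Longrightarrow> f z = k z * g z"
    "\<And>r. 0 < r \<Longrightarrow> r < 1 \<Longrightarrow> circle_integral (2 * p) k r \<le> C"
    "\<And>r. 0 < r \<Longrightarrow> r < 1 \<Longrightarrow> circle_integral (2 * p) g r \<le> C"
    using holomorphic_factor_sqrt[OF f p bd] by blast
  have C0: "0 \<le> C" by (rule circle_integral_bounded_nonneg) (rule bd)
  \<comment> \<open>\<open>\<eta>\<close> is half of \<open>e\<close> after the factor
    \<open>2 powr p\<close> for a sum. The weight \<open>a\<close> makes
    \<open>C / a \<le> \<eta>\<close>, with \<open>C + 1\<close> keeping it positive when
    \<open>C = 0\<close>, and \<open>d\<close> makes \<open>a * d = \<eta>\<close>.\<close>
  define \<eta> where "\<eta> = e / (2 powr p * 2)"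
  define a where "a = (C + 1) / \<eta>"
  define d where "d = \<eta> / a"
  have \<eta>: "0 < \<eta>" using e by (simp add: \<eta>_def)
  have a: "0 < a" using C0 \<eta> by (simp add: a_def add_nonneg_pos)
  have d: "0 < d" using a \<eta> by (simp add: d_def)
  have "C / a \<le> (C + 1) / a" using a by (intro divide_right_mono) auto
  also have "\<dots> = \<eta>" using C0 \<eta> by (simp add: a_def)
  finally have Ca: "C / a \<le> \<eta>" .
  have ad: "a * d = \<eta>" using a by (simp add: d_def)
  have p2: "2 \<le> 2 * p" using p by simp
  have p0: "0 < p" using p by simp
  have ev: "\<forall>\<^sub>F n in sequentially.
      (\<forall>s\<in>{0<..<1}. circle_integral (2 * p) (\<lambda>z. k z - k (of_real (rr n) * z)) s \<le> d) \<and>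
      (\<forall>s\<in>{0<..<1}. circle_integral (2 * p) (\<lambda>z. g z - g (of_real (rr n) * z)) s \<le> d)"
    by (intro eventually_conj dilation_converges_ge2[OF kg(1) p2 kg(4) rr d]
        dilation_converges_ge2[OF kg(2) p2 kg(5) rr d]) auto
  have "circle_integral p (\<lambda>z. f z - f (of_real (rr n) * z)) s \<le> e"
    if n: "circle_integral (2 * p) (\<lambda>z. k z - k (of_real (rr n) * z)) s \<le> d"
      "circle_integral (2 * p) (\<lambda>z. g z - g (of_real (rr n) * z)) s \<le> d" and s: "0 < s" "s < 1" for n s
  proof -
    define kr gr where "kr z = k (of_real (rr n) * z)" and "gr z = g (of_real (rr n) * z)" for z
    have krh: "kr holomorphic_on ball 0 1" "gr holomorphic_on ball 0 1"
      unfolding kr_def gr_def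
      by (rule holomorphic_on_dilate(2)[OF kg(1)] holomorphic_on_dilate(2)[OF kg(2)], use rr(1,2)[of n] in auto)+
    have rs: "0 < rr n * s" "rr n * s < 1" using s rr(1,2)[of n] mult_strict_mono[of "rr n" 1 s 1] by auto
    have krC: "circle_integral (2 * p) kr s \<le> C"
      unfolding kr_def circle_integral_dilate using rs by (intro kg(4))
    \<comment> \<open>The product rule for differences: f minus its dilate is \<open>A + B\<close>,
      each with one small and one bounded factor.\<close>
    define A B where "A z = (k z - kr z) * g z" and "B z = (g z - gr z) * kr z" for z
    have h: "(\<lambda>z. k z - kr z) holomorphic_on ball 0 1" "(\<lambda>z. g z - gr z) holomorphic_on ball 0 1"
      by (intro holomorphic_intros kg krh)+
    have AB: "A holomorphic_on ball 0 1" "B holomorphic_on ball 0 1"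
      unfolding A_def B_def by (intro holomorphic_intros kg krh)+
    have bnd: "(a * x + y / a) / 2 \<le> \<eta>" if "x \<le> d" "y \<le> C" for x y
    proof -
      have "a * x \<le> a * d" "y / a \<le> C / a" using that a by (auto intro: divide_right_mono)
      then have "a * x + y / a \<le> \<eta> + \<eta>" using Ca ad by (intro add_mono) auto
      then show ?thesis by simp
    qed
    have "circle_integral p A s \<le> \<eta>"
      unfolding A_def
      by (rule order_trans[OF circle_integral_mult_le[OF h(1) kg(2) _ _ p0 a] bnd])
        (use s n(1) kg(5) in \<open>auto simp: kr_def\<close>)
    moreover have "circle_integral p B s \<le> \<eta>"
      unfolding B_def
      by (rule order_trans[OF circle_integral_mult_le[OF h(2) krh(1) _ _ p0 a] bnd])
        (use s n(2) krC in \<open>auto simp: gr_def\<close>)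
    moreover have "circle_integral p (\<lambda>z. A z + B z) s \<le> 2 powr p * (circle_integral p A s + circle_integral p B s)"
      by (rule circle_integral_add_le[OF AB]) (use s p in auto)
    ultimately have "circle_integral p (\<lambda>z. A z + B z) s \<le> 2 powr p * (\<eta> + \<eta>)"
      by (meson add_mono mult_left_mono order_trans powr_ge_zero)
    also have "\<dots> = e" by (simp add: \<eta>_def)
    also have "circle_integral p (\<lambda>z. A z + B z) s = circle_integral p (\<lambda>z. f z - f (of_real (rr n) * z)) s"
    proof (rule circle_integral_cong)
      fix z assume z: "cmod z = s"
      have "cmod (of_real (rr n) * z) < 1" using z rs rr(1)[of n] by (simp add: norm_mult)
      then have "f z - f (of_real (rr n) * z) = A z + B z"
        using z s kg(3) by (simp add: A_def B_def kr_def gr_def algebra_simps)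
      then show "cmod (A z + B z) = cmod (f z - f (of_real (rr n) * z))" by simp
    qed (use s in simp)
    finally show ?thesis .
  qed
  then show ?thesis by (intro eventually_mono[OF ev]) auto
qed

section \<open>Hardy spaces\<close>

definition on_disc :: "(complex \<Rightarrow> complex) \<Rightarrow> complex \<Rightarrow> complex" where
  "on_disc f z = (if z \<in> ball 0 1 then f z else 0)"

lemma on_disc_simps [simp]: "cmod z < 1 \<Longrightarrow> on_disc f z = f z" "\<not> cmod z < 1 \<Longrightarrow> on_disc f z = 0"
  by (auto simp: on_disc_def)

lemma on_disc_holomorphic: "f holomorphic_on ball 0 1 \<Longrightarrow> on_disc f \<in> disc_holomorphic"
  unfolding disc_holomorphic_def by (auto intro: holomorphic_transform[of f] simp: on_disc_def)

lemma disc_holomorphicD: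
  "f \<in> disc_holomorphic \<Longrightarrow> f holomorphic_on ball 0 1" "f \<in> disc_holomorphic \<Longrightarrow> \<not> cmod z < 1 \<Longrightarrow> f z = 0"
  by (auto simp: disc_holomorphic_def)

lemma deriv_on_disc: "deriv (on_disc f) 0 = deriv f 0"
  by (rule deriv_cong_ev) (auto simp: eventually_nhds intro!: exI[of _ "ball 0 1"])

lemma DERIV_deriv_at_0: "f holomorphic_on ball 0 1 \<Longrightarrow> (f has_field_derivative deriv f 0) (at 0)"
  by (rule holomorphic_derivI[of f "ball 0 1"]) auto

section \<open>The Hardy norm: point bounds, bounded multipliers, the constraint at 0\<close>

lemma circle_integral_eq_mean:
  assumes "1 \<le> p"
  shows "circle_integral p f r = 2 * pi * hardy_mean p f r powr p"
  unfolding hardy_mean_def circle_integral_def[symmetric]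
  using assms circle_integral_nonneg[of p f r] by (simp add: powr_powr)

lemma hardy_mean_le:
  assumes "1 \<le> p" "circle_integral p f r \<le> 2 * pi * C powr p" "0 \<le> C"
  shows "hardy_mean p f r \<le> C"
proof -
  have "hardy_mean p f r powr p \<le> C powr p"
    using assms by (simp add: circle_integral_eq_mean)
  then show ?thesis
    using powr_less_mono2[of p C "hardy_mean p f r"] assms by linarith
qed

lemma hardy_spaceI:
  assumes p: "1 \<le> p" and f: "f \<in> disc_holomorphic"
    and C: "\<And>r. 0 < r \<Longrightarrow> r < 1 \<Longrightarrow> circle_integral p f r \<le> C"
  shows "f \<in> hardy_space p"
proof -
  have C0: "0 \<le> C" by (rule circle_integral_bounded_nonneg) (rule C)
  have "hardy_mean p f r \<le> (C / (2 * pi)) powr (1 / p)" if "r \<in> {0<..<1}" for r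
    using C[of r] that C0 p by (intro hardy_mean_le) (auto simp: powr_powr)
  then have "bdd_above (hardy_mean p f ` {0<..<1})" by (rule bdd_aboveI2)
  then show ?thesis using f by (simp add: hardy_space_def)
qed

lemma hardy_norm_leI:
  assumes p: "1 \<le> p" and f: "f \<in> disc_holomorphic" and C0: "0 \<le> C"
    and C: "\<And>r. 0 < r \<Longrightarrow> r < 1 \<Longrightarrow> circle_integral p f r \<le> 2 * pi * C powr p"
  shows "f \<in> hardy_space p" "hardy_norm p f \<le> C"
proof -
  show H: "f \<in> hardy_space p" using p f C by (rule hardy_spaceI)
  show "hardy_norm p f \<le> C"
    unfolding hardy_norm_def using H C C0 p by (auto intro!: cSUP_least hardy_mean_le)
qed

lemma hardy_spaceD: "f \<in> hardy_space p \<Longrightarrow> f \<in> disc_holomorphic"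
  by (simp add: hardy_space_def)

lemma hardy_space_holomorphic: "f \<in> hardy_space p \<Longrightarrow> f holomorphic_on ball 0 1"
  by (simp add: hardy_space_def disc_holomorphic_def)

lemma circle_integral_le_hardy_norm:
  assumes p: "1 \<le> p" and f: "f \<in> hardy_space p" and r: "0 < r" "r < 1"
  shows "circle_integral p f r \<le> 2 * pi * hardy_norm p f powr p"
  using hardy_mean_le_norm[OF f r] hardy_mean_nonneg[of p f r] p
  by (auto simp: circle_integral_eq_mean intro!: powr_mono2)

lemma hardy_point_bound:
  assumes p: "1 \<le> p" and f: "f \<in> hardy_space p" and z: "cmod z < 1"
  shows "cmod (f z) \<le> 2 / (1 - cmod z) * hardy_norm p f"
  by (rule holomorphic_point_bound[OF hardy_space_holomorphic[OF f] p z])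
    (use circle_integral_le_hardy_norm[OF p f] hardy_norm_nonneg in auto)

text \<open>Cauchy's inequality on the circle of radius 1/2, where the point bound has the factor
  4.\<close>

lemma hardy_deriv_bound:
  assumes p: "1 \<le> p" and f: "f \<in> hardy_space p"
  shows "cmod (deriv f 0) \<le> 8 * hardy_norm p f"
proof -
  have h: "f holomorphic_on ball 0 1" using f by (rule hardy_space_holomorphic)
  have "cmod ((deriv ^^ 1) f 0) \<le> fact 1 * (4 * hardy_norm p f) / (1/2) ^ 1"
  proof (rule Cauchy_inequality)
    show "f holomorphic_on ball 0 (1/2)" by (rule holomorphic_on_subset[OF h]) auto
    show "continuous_on (cball 0 (1/2)) f"
      by (rule holomorphic_on_imp_continuous_on[OF holomorphic_on_subset[OF h]]) auto
    show "cmod (f x) \<le> 4 * hardy_norm p f" if "norm (0 - x) = 1/2" for x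
    proof -
      have "1 - cmod x = 1/2" using that by simp
      then show ?thesis using hardy_point_bound[OF p f, of x] that by (simp only:) simp
    qed
  qed simp
  then show ?thesis by simp
qed

lemma hardy_mult_bounded:
  assumes p: "1 \<le> p" and f: "f \<in> hardy_space p" and u: "u holomorphic_on ball 0 1"
    and B: "\<And>z. cmod z < 1 \<Longrightarrow> cmod (u z) \<le> B"
  shows "(\<lambda>z. u z * f z) \<in> hardy_space p" "hardy_norm p (\<lambda>z. u z * f z) \<le> B * hardy_norm p f"
proof -
  have h: "f holomorphic_on ball 0 1" using f by (rule hardy_space_holomorphic)
  have B0: "0 \<le> B" using order_trans[OF norm_ge_zero B[of 0]] by simp
  have uf: "(\<lambda>z. u z * f z) \<in> disc_holomorphic"
    using holomorphic_on_mult[OF u h] disc_holomorphicD(2)[OF hardy_spaceD[OF f]]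
    by (auto simp: disc_holomorphic_def)
  have le: "circle_integral p (\<lambda>z. u z * f z) r \<le> 2 * pi * (B * hardy_norm p f) powr p"
    if r: "0 < r" "r < 1" for r
  proof -
    have "circle_integral p (\<lambda>z. u z * f z) r \<le> circle_integral p (\<lambda>z. of_real B * f z) r"
      using r p B B0
      by (intro circle_integral_mono[OF holomorphic_on_mult[OF u h], of _ r] holomorphic_intros h)
        (auto simp: norm_mult intro!: mult_right_mono)
    also have "\<dots> = B powr p * circle_integral p f r" using B0 by (simp add: circle_integral_cmult)
    also have "\<dots> \<le> B powr p * (2 * pi * hardy_norm p f powr p)"
      by (intro mult_left_mono circle_integral_le_hardy_norm p f r) simp
    also have "\<dots> = 2 * pi * (B * hardy_norm p f) powr p"
      using B0 hardy_norm_nonneg[of p f] by (simp add: powr_mult)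
    finally show ?thesis .
  qed
  have "0 \<le> B * hardy_norm p f" using B0 hardy_norm_nonneg by simp
  from hardy_norm_leI[OF p uf this le]
  show "(\<lambda>z. u z * f z) \<in> hardy_space p" "hardy_norm p (\<lambda>z. u z * f z) \<le> B * hardy_norm p f" by auto
qed

lemma hardy_cmult:
  assumes "1 \<le> p" "f \<in> hardy_space p"
  shows "(\<lambda>z. c * f z) \<in> hardy_space p" "hardy_norm p (\<lambda>z. c * f z) \<le> cmod c * hardy_norm p f"
  using hardy_mult_bounded[OF assms, of "\<lambda>_. c" "cmod c"] by auto

lemma hardy_add:
  assumes p: "1 \<le> p" and f: "f \<in> hardy_space p" and g: "g \<in> hardy_space p"
  shows "(\<lambda>z. f z + g z) \<in> hardy_space p"
  using hardy_space_diff(1)[OF f hardy_cmult(1)[OF p g, of "-1"] p] by simp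

lemma hardy_bounded:
  assumes p: "1 \<le> p" and u: "u holomorphic_on ball 0 1" and B: "\<And>z. cmod z < 1 \<Longrightarrow> cmod (u z) \<le> B"
  shows "on_disc u \<in> hardy_space p" "hardy_norm p (on_disc u) \<le> B"
proof -
  have B0: "0 \<le> B" using order_trans[OF norm_ge_zero B[of 0]] by simp
  have h: "on_disc u \<in> disc_holomorphic" by (rule on_disc_holomorphic[OF u])
  have "circle_integral p (on_disc u) r \<le> 2 * pi * B powr p" if "0 < r" "r < 1" for r
    using that B p by (intro circle_integral_le_sup[OF disc_holomorphicD(1)[OF h]]) auto
  from hardy_norm_leI[OF p h B0 this]
  show "on_disc u \<in> hardy_space p" "hardy_norm p (on_disc u) \<le> B" by auto
qed

lemma holomorphic_double_zero:
  assumes f: "f holomorphic_on ball 0 R" and R: "0 < R" and 0: "f 0 = 0" "deriv f 0 = 0"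
  obtains g where "g holomorphic_on ball 0 R" "\<And>z. f z = z\<^sup>2 * g z"
proof -
  obtain v where v: "v holomorphic_on ball 0 R" "\<And>z. f z - f 0 = (z - 0) * v z"
    using quotient_at_point_holomorphic[OF f] by blast
  have fv: "f = (\<lambda>z. z * v z)" using v(2) 0 by (simp add: fun_eq_iff)
  have "((\<lambda>z. z * v z) has_field_derivative 1 * v 0 + deriv v 0 * 0) (at 0)"
    by (rule DERIV_mult[OF DERIV_ident holomorphic_derivI[OF v(1) open_ball]]) (use R in simp)
  then have v0: "v 0 = 0" using DERIV_imp_deriv 0(2) by (fastforce simp: fv)
  obtain g where g: "g holomorphic_on ball 0 R" "\<And>z. v z - v 0 = (z - 0) * g z"
    using quotient_at_point_holomorphic[OF v(1)] by blast
  have "f z = z\<^sup>2 * g z" for z using g(2)[of z] v0 by (simp add: fv power2_eq_square)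
  then show thesis using that g(1) by blast
qed

lemma hardy_divide_square:
  assumes p: "1 \<le> p" and f: "f \<in> hardy_space p" and g: "g holomorphic_on ball 0 1"
    and fg: "\<And>z. z \<in> ball 0 1 \<Longrightarrow> f z = z\<^sup>2 * g z"
  shows "on_disc g \<in> hardy_space p"
proof (rule hardy_spaceI[OF p on_disc_holomorphic[OF g]])
  have f4: "(\<lambda>z. 4 * f z) holomorphic_on ball 0 1"
    by (intro holomorphic_intros hardy_space_holomorphic[OF f])
  fix r :: real assume r: "0 < r" "r < 1"
  \<comment> \<open>Division by z^2 is harmless away from 0. The means of \<open>g\<close> increase
    with the radius, so they are compared at a radius of at least 1/2, where it costs a factor of at
    most 4.\<close>
  define t where "t = max r (1/2)"
  have t: "1/2 \<le> t" "r \<le> t" "t < 1" using r by (auto simp: t_def)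
  have "circle_integral p (on_disc g) r = circle_integral p g r"
    using r by (intro circle_integral_cong) auto
  also have "\<dots> \<le> circle_integral p g t"
    by (rule circle_integral_increasing[OF g]) (use r t p in auto)
  also have "\<dots> \<le> circle_integral p (\<lambda>z. 4 * f z) t"
  proof (rule circle_integral_mono[OF g f4])
    fix z assume z: "cmod z = t"
    have "(1/2)\<^sup>2 \<le> t\<^sup>2" using t by (intro power_mono) auto
    then have "1 * cmod (g z) \<le> 4 * t\<^sup>2 * cmod (g z)" by (intro mult_right_mono) (auto simp: power2_eq_square)
    then show "cmod (g z) \<le> cmod (4 * f z)" using fg[of z] z t by (simp add: norm_mult norm_power)
  qed (use t p in auto)
  also have "\<dots> = 4 powr p * circle_integral p f t" by (simp add: circle_integral_cmult)
  also have "\<dots> \<le> 4 powr p * (2 * pi * hardy_norm p f powr p)"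
    using t by (intro mult_left_mono circle_integral_le_hardy_norm p f) auto
  finally show "circle_integral p (on_disc g) r \<le> 4 powr p * (2 * pi * hardy_norm p f powr p)" .
qed

lemma hardy_affine:
  assumes p: "1 \<le> p"
  shows "on_disc (\<lambda>z. c * (\<alpha> + \<beta> * z)) \<in> hardy_space p"
proof (rule hardy_bounded(1)[OF p])
  fix z :: complex assume "cmod z < 1"
  then have "cmod \<beta> * cmod z \<le> cmod \<beta> * 1" by (intro mult_left_mono) auto
  then have "cmod (\<alpha> + \<beta> * z) \<le> cmod \<alpha> + cmod \<beta>"
    using norm_triangle_ineq[of \<alpha> "\<beta> * z"] by (simp add: norm_mult)
  then show "cmod (c * (\<alpha> + \<beta> * z)) \<le> cmod c * (cmod \<alpha> + cmod \<beta>)"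
    by (simp add: norm_mult mult_left_mono)
qed (intro holomorphic_intros)

text \<open>In this form \<open>hardy_ab\<close> is visibly closed: \<open>f 0\<close> and \<open>f' 0\<close> depend continuously on \<open>f \<in> H\<^sup>p\<close>.\<close>

lemma hardy_ab_iff:
  assumes p: "1 \<le> p" and \<alpha>: "\<alpha> \<noteq> 0"
  shows "f \<in> hardy_ab p \<alpha> \<beta> \<longleftrightarrow> f \<in> hardy_space p \<and> \<alpha> * deriv f 0 = \<beta> * f 0"
proof
  assume "f \<in> hardy_ab p \<alpha> \<beta>"
  then obtain c g where f: "f \<in> disc_holomorphic" and g: "g \<in> hardy_space p"
    and fg: "\<forall>z\<in>ball 0 1. f z = c * (\<alpha> + \<beta> * z) + z\<^sup>2 * g z" by (auto simp: hardy_ab_def)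
  have "on_disc (\<lambda>z. c * (\<alpha> + \<beta> * z)) \<in> hardy_space p"
    by (rule hardy_affine[OF p])
  moreover have "(\<lambda>z. z\<^sup>2 * g z) \<in> hardy_space p"
    by (rule hardy_mult_bounded(1)[OF p g, of _ 1]) (auto intro!: holomorphic_intros simp: norm_power power_le_one)
  ultimately have "(\<lambda>z. on_disc (\<lambda>z. c * (\<alpha> + \<beta> * z)) z + z\<^sup>2 * g z) \<in> hardy_space p"
    by (rule hardy_add[OF p])
  also have "(\<lambda>z. on_disc (\<lambda>z. c * (\<alpha> + \<beta> * z)) z + z\<^sup>2 * g z) = f"
    using fg disc_holomorphicD(2)[OF f] disc_holomorphicD(2)[OF hardy_spaceD[OF g]]
    by (auto simp: fun_eq_iff on_disc_def)
  finally have fh: "f \<in> hardy_space p" .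
  have "((\<lambda>z. c * (\<alpha> + \<beta> * z) + z\<^sup>2 * g z) has_field_derivative c * \<beta>) (at 0)"
    by (auto intro!: derivative_eq_intros DERIV_deriv_at_0[OF hardy_space_holomorphic[OF g]])
  then have "deriv (\<lambda>z. c * (\<alpha> + \<beta> * z) + z\<^sup>2 * g z) 0 = c * \<beta>" by (rule DERIV_imp_deriv)
  moreover have "deriv f 0 = deriv (\<lambda>z. c * (\<alpha> + \<beta> * z) + z\<^sup>2 * g z) 0"
    by (rule deriv_cong_ev) (use fg in \<open>auto simp: eventually_nhds intro!: exI[of _ "ball 0 1"]\<close>)
  moreover have "f 0 = c * \<alpha>" using fg by simp
  ultimately show "f \<in> hardy_space p \<and> \<alpha> * deriv f 0 = \<beta> * f 0" using fh by simp
next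
  assume *: "f \<in> hardy_space p \<and> \<alpha> * deriv f 0 = \<beta> * f 0"
  then have f: "f \<in> hardy_space p" by simp
  have fh: "f holomorphic_on ball 0 1" using f by (rule hardy_space_holomorphic)
  \<comment> \<open>The value at 0 forces this coefficient; the derivative condition then gives
    \<open>h\<close> a double zero.\<close>
  define c where "c = f 0 / \<alpha>"
  define h where "h z = f z - c * (\<alpha> + \<beta> * z)" for z
  have hh: "h holomorphic_on ball 0 1" unfolding h_def by (intro holomorphic_intros fh)
  have "(h has_field_derivative deriv f 0 - c * \<beta>) (at 0)"
    unfolding h_def by (auto intro!: derivative_eq_intros DERIV_deriv_at_0[OF fh])
  then have "deriv h 0 = deriv f 0 - c * \<beta>" by (rule DERIV_imp_deriv)
  also have "\<dots> = 0" using * \<alpha> by (simp add: c_def field_simps)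
  finally have h': "deriv h 0 = 0" .
  obtain g where g: "g holomorphic_on ball 0 1" "\<And>z. z \<in> ball 0 1 \<Longrightarrow> h z = z\<^sup>2 * g z"
  proof -
    have "h 0 = 0" using \<alpha> by (simp add: h_def c_def)
    then show thesis using holomorphic_double_zero[OF hh zero_less_one _ h'] that by metis
  qed
  have pb: "on_disc (\<lambda>z. c * (\<alpha> + \<beta> * z)) \<in> hardy_space p"
    by (rule hardy_affine[OF p])
  have "on_disc g \<in> hardy_space p"
    by (rule hardy_divide_square[OF p hardy_space_diff(1)[OF f pb p] g(1)]) (use g(2) in \<open>auto simp: h_def\<close>)
  then show "f \<in> hardy_ab p \<alpha> \<beta>"
    unfolding hardy_ab_def using hardy_spaceD[OF f] g(2)
    by (auto intro!: exI[of _ c] bexI[of _ "on_disc g"] simp: h_def algebra_simps)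
qed

lemma bounded_image_ball_iff:
  fixes f :: "complex \<Rightarrow> complex"
  shows "bounded (f ` ball 0 R) \<longleftrightarrow> (\<exists>B. \<forall>z. cmod z < R \<longrightarrow> cmod (f z) \<le> B)"
  by (simp only: bounded_iff ball_simps Ball_def[of "ball 0 R"] mem_ball_0)

lemma H_infinity_on_disc:
  assumes "u holomorphic_on ball 0 1" "\<And>z. cmod z < 1 \<Longrightarrow> cmod (u z) \<le> B"
  shows "on_disc u \<in> H_infinity"
  using assms on_disc_holomorphic[OF assms(1)]
  unfolding H_infinity_def bounded_image_ball_iff by auto

lemma dilate_bounded:
  assumes f: "f holomorphic_on ball 0 1" and r: "0 < r" "r < 1"
  shows "\<exists>B. \<forall>z. cmod z < 1 \<longrightarrow> cmod (f (of_real r * z)) \<le> B"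
proof -
  obtain B where B: "\<And>z. cmod z \<le> r \<Longrightarrow> cmod (f z) \<le> B"
    using holomorphic_bounded_on_cball[OF f r(2)] by blast
  have "cmod (f (of_real r * z)) \<le> B" if "cmod z < 1" for z
    using that r by (intro B) (simp add: norm_mult mult_left_le)
  then show ?thesis by blast
qed

lemma hardy_dilate:
  assumes p: "1 \<le> p" and f: "f \<in> hardy_space p" and r: "0 < r" "r < 1"
  shows "on_disc (\<lambda>z. f (of_real r * z)) \<in> hardy_space p"
  using dilate_bounded[OF hardy_space_holomorphic[OF f] r]
    hardy_bounded(1)[OF p holomorphic_on_dilate(2)[OF hardy_space_holomorphic[OF f] r(1) less_imp_le[OF r(2)]]]
  by blast

lemma hardy_dilate_tendsto:
  assumes p: "1 \<le> p" and f: "f \<in> hardy_space p"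
    and rr: "\<And>n. 0 < rr n" "\<And>n. rr n < 1" "rr \<longlonglongrightarrow> 1"
  shows "(\<lambda>n. hardy_norm p (\<lambda>z. f z - on_disc (\<lambda>z. f (of_real (rr n) * z)) z)) \<longlonglongrightarrow> 0"
proof (rule tendstoI)
  fix e :: real assume e: "0 < e"
  define d where "d = 2 * pi * (e / 2) powr p"
  have d: "0 < d" using e by (simp add: d_def)
  have "\<forall>\<^sub>F n in sequentially. \<forall>s\<in>{0<..<1}. circle_integral p (\<lambda>z. f z - f (of_real (rr n) * z)) s \<le> d"
    by (rule dilation_converges[OF hardy_space_holomorphic[OF f] p circle_integral_le_hardy_norm[OF p f] rr d])
  then show "\<forall>\<^sub>F n in sequentially. dist (hardy_norm p (\<lambda>z. f z - on_disc (\<lambda>z. f (of_real (rr n) * z)) z)) 0 < e"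
  proof (rule eventually_mono)
    fix n assume n: "\<forall>s\<in>{0<..<1}. circle_integral p (\<lambda>z. f z - f (of_real (rr n) * z)) s \<le> d"
    define h where "h z = f z - on_disc (\<lambda>z. f (of_real (rr n) * z)) z" for z
    have h: "h \<in> disc_holomorphic" unfolding h_def
      by (rule hardy_spaceD[OF hardy_space_diff(1)[OF f hardy_dilate[OF p f rr(1,2)] p]])
    have "hardy_norm p h \<le> e / 2"
    proof (rule hardy_norm_leI(2)[OF p h])
      fix r :: real assume r: "0 < r" "r < 1"
      have "circle_integral p h r = circle_integral p (\<lambda>z. f z - f (of_real (rr n) * z)) r"
        using r by (intro circle_integral_cong) (auto simp: h_def)
      then show "circle_integral p h r \<le> 2 * pi * (e / 2) powr p" using n r by (simp add: d_def)
    qed (use e in simp)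
    then show "dist (hardy_norm p (\<lambda>z. f z - on_disc (\<lambda>z. f (of_real (rr n) * z)) z)) 0 < e"
      using e hardy_norm_nonneg[of p h] by (simp add: h_def[abs_def] dist_real_def)
  qed
qed

text \<open>The elements of \<^const>\<open>H_infinity_1\<close>, without the requirement that they vanish off the disc.\<close>

definition alg1 :: "(complex \<Rightarrow> complex) \<Rightarrow> bool" where
  "alg1 u \<longleftrightarrow> u holomorphic_on ball 0 1 \<and> (\<exists>B. \<forall>z. cmod z < 1 \<longrightarrow> cmod (u z) \<le> B) \<and> deriv u 0 = 0"

section \<open>The algebra of bounded functions with derivative 0 at 0\<close>

lemma alg1I:
  assumes "u holomorphic_on ball 0 1" "\<And>z. cmod z < 1 \<Longrightarrow> cmod (u z) \<le> B" "(u has_field_derivative 0) (at 0)"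
  shows "alg1 u"
  using assms DERIV_imp_deriv unfolding alg1_def by blast

lemma alg1E:
  assumes "alg1 u"
  obtains B where "0 \<le> B" "u holomorphic_on ball 0 1" "\<And>z. cmod z < 1 \<Longrightarrow> cmod (u z) \<le> B"
    "(u has_field_derivative 0) (at 0)"
proof -
  obtain B where B: "\<And>z. cmod z < 1 \<Longrightarrow> cmod (u z) \<le> B" using assms by (auto simp: alg1_def)
  have "0 \<le> B" using order_trans[OF norm_ge_zero B[of 0]] by simp
  then show thesis using that B assms DERIV_deriv_at_0[of u] by (simp add: alg1_def)
qed

lemma alg1_const: "alg1 (\<lambda>_. c)"
  by (rule alg1I[of _ "cmod c"]) auto

lemma alg1_add:
  assumes "alg1 u" "alg1 v"
  shows "alg1 (\<lambda>z. u z + v z)"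
proof -
  obtain B C where "u holomorphic_on ball 0 1" "\<And>z. cmod z < 1 \<Longrightarrow> cmod (u z) \<le> B" "(u has_field_derivative 0) (at 0)"
    "v holomorphic_on ball 0 1" "\<And>z. cmod z < 1 \<Longrightarrow> cmod (v z) \<le> C" "(v has_field_derivative 0) (at 0)"
    using assms by (metis alg1E)
  then show ?thesis
    by (intro alg1I[of _ "B + C"] holomorphic_intros norm_triangle_mono) (auto intro!: derivative_eq_intros)
qed

lemma alg1_mult:
  assumes "alg1 u" "alg1 v"
  shows "alg1 (\<lambda>z. u z * v z)"
proof -
  obtain B C where "0 \<le> B" "u holomorphic_on ball 0 1" "\<And>z. cmod z < 1 \<Longrightarrow> cmod (u z) \<le> B" "(u has_field_derivative 0) (at 0)"
    "v holomorphic_on ball 0 1" "\<And>z. cmod z < 1 \<Longrightarrow> cmod (v z) \<le> C" "(v has_field_derivative 0) (at 0)"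
    using assms by (metis alg1E)
  then show ?thesis
    by (intro alg1I[of _ "B * C"] holomorphic_intros)
      (auto intro!: derivative_eq_intros mult_mono simp: norm_mult)
qed

lemma alg1_cmult: "alg1 u \<Longrightarrow> alg1 (\<lambda>z. c * u z)"
  by (rule alg1_mult[OF alg1_const])

lemma norm_exp_le: "cmod w \<le> C \<Longrightarrow> cmod (exp w) \<le> exp C"
  using complex_Re_le_cmod[of w] by simp

lemma alg1_exp:
  assumes "alg1 u"
  shows "alg1 (\<lambda>z. exp (u z))"
proof -
  obtain B where "u holomorphic_on ball 0 1" "\<And>z. cmod z < 1 \<Longrightarrow> cmod (u z) \<le> B" "(u has_field_derivative 0) (at 0)"
    using assms by (metis alg1E)
  then show ?thesis
    by (intro alg1I[of _ "exp B"] holomorphic_intros)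
      (auto intro!: derivative_eq_intros norm_exp_le simp del: norm_exp_eq_Re)
qed

text \<open>This is how functions outside the algebra enter an argument about it: a factor z^2
  cancels their derivative at 0.\<close>

lemma alg1_square_mult:
  assumes v: "v holomorphic_on ball 0 1" and B: "\<And>z. cmod z < 1 \<Longrightarrow> cmod (v z) \<le> B"
  shows "alg1 (\<lambda>z. z\<^sup>2 * v z)"
proof (rule alg1I[of _ B])
  show "cmod (z\<^sup>2 * v z) \<le> B" if "cmod z < 1" for z
  proof -
    have "(cmod z)\<^sup>2 * cmod (v z) \<le> 1 * B"
      using that B[OF that] by (intro mult_mono) (auto simp: power_le_one)
    then show ?thesis by (simp add: norm_mult norm_power)
  qed
  show "((\<lambda>z. z\<^sup>2 * v z) has_field_derivative 0) (at 0)"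
    by (auto intro!: derivative_eq_intros DERIV_deriv_at_0[OF v])
qed (intro holomorphic_intros v)

lemma alg1_power:
  assumes "2 \<le> n"
  shows "alg1 (\<lambda>z. z ^ n)"
proof -
  obtain k where n: "n = 2 + k" using assms le_Suc_ex by blast
  have "alg1 (\<lambda>z. z\<^sup>2 * z ^ k)"
    by (rule alg1_square_mult[of _ 1]) (auto simp: norm_power power_le_one intro!: holomorphic_intros)
  then show ?thesis by (simp only: n power_add)
qed

lemma bounded_on_disc_of_larger_ball:
  assumes u: "u holomorphic_on ball 0 R" and R: "1 < R"
  shows "\<exists>B. \<forall>z. cmod z < 1 \<longrightarrow> cmod (u z) \<le> B" "u holomorphic_on ball 0 1"
proof -
  show "\<exists>B. \<forall>z. cmod z < 1 \<longrightarrow> cmod (u z) \<le> B"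
    using holomorphic_bounded_on_cball[OF u R] by (meson less_imp_le)
  show "u holomorphic_on ball 0 1" by (rule holomorphic_on_subset[OF u]) (use R in auto)
qed

lemma alg1_dilate:
  assumes h: "h holomorphic_on ball 0 1" "deriv h 0 = 0" and r: "0 < r" "r < 1"
  shows "deriv (\<lambda>z. h (of_real r * z)) 0 = 0" "alg1 (\<lambda>z. h (of_real r * z))"
proof -
  have "((\<lambda>z. h (of_real r * z)) has_field_derivative deriv h 0 * of_real r) (at 0)"
    using DERIV_chain2[of h "deriv h 0" "\<lambda>z. of_real r * z" 0 "of_real r" UNIV]
      DERIV_deriv_at_0[OF h(1)] by (auto intro!: derivative_eq_intros)
  then show d: "deriv (\<lambda>z. h (of_real r * z)) 0 = 0" using h(2) DERIV_imp_deriv by fastforce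
  show "alg1 (\<lambda>z. h (of_real r * z))"
    using dilate_bounded[OF h(1) r] holomorphic_on_dilate(2)[OF h(1)] r d by (auto simp: alg1_def)
qed

lemma alg1_H_infinity_1: "alg1 u \<Longrightarrow> on_disc u \<in> H_infinity_1"
  using H_infinity_on_disc[of u] by (auto simp: alg1_def H_infinity_1_def deriv_on_disc)

lemma H_infinity_1_alg1:
  assumes "h \<in> H_infinity_1"
  shows "alg1 h"
  using assms unfolding H_infinity_1_def H_infinity_def bounded_image_ball_iff
  by (auto simp: alg1_def disc_holomorphic_def)

text \<open>If f lies in the space, the quotient rule and the two constraints give h = f / F
  derivative 0 at 0. The dilates of h belong to \<open>H_infinity_1\<close> and tend to h in H^p, so
  F times them tends to f. Conversely the closure stays in the space because f ->
  \<open>\<alpha> * deriv f 0 - \<beta> * f 0\<close> is continuous.\<close>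

lemma bounded_below_cyclic:
  assumes p: "1 \<le> p" and \<alpha>: "\<alpha> \<noteq> 0" and F: "F holomorphic_on ball 0 1"
    and B: "\<And>z. cmod z < 1 \<Longrightarrow> cmod (F z) \<le> B"
    and m: "0 < m" "\<And>z. cmod z < 1 \<Longrightarrow> m \<le> cmod (F z)"
    and ab: "\<alpha> * deriv F 0 = \<beta> * F 0"
  shows "cyclic_ab p \<alpha> \<beta> (on_disc F)"
proof -
  interpret M: Metric_space "hardy_space p" "\<lambda>f g. hardy_norm p (\<lambda>z. f z - g z)"
    by (rule Metric_space_hardy[OF p])
  have Fin: "on_disc F \<in> hardy_ab p \<alpha> \<beta>"
    using hardy_bounded(1)[OF p F B] ab by (simp add: hardy_ab_iff[OF p \<alpha>] deriv_on_disc)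
  define S where "S = (\<lambda>h z. on_disc F z * h z) ` H_infinity_1"
  have Fnz: "F z \<noteq> 0" if "cmod z < 1" for z using m(2)[OF that] m(1) by auto
  have B0: "0 < B" using B[of 0] m(1) m(2)[of 0] by simp
  have Sab: "y \<in> hardy_ab p \<alpha> \<beta>" if yS: "y \<in> S" for y
  proof -
    obtain h where h: "h \<in> H_infinity_1" "y = (\<lambda>z. on_disc F z * h z)" using yS by (auto simp: S_def)
    then obtain C where hh: "h holomorphic_on ball 0 1" "(h has_field_derivative 0) (at 0)"
      and C: "\<And>z. cmod z < 1 \<Longrightarrow> cmod (h z) \<le> C"
      using alg1E[OF H_infinity_1_alg1] by metis
    have y: "y = (\<lambda>z. h z * on_disc F z)" by (simp add: h mult.commute)
    have "y \<in> hardy_space p" unfolding y by (rule hardy_mult_bounded(1)[OF p hardy_bounded(1)[OF p F B] hh(1) C])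
    moreover have "(y has_field_derivative deriv (on_disc F) 0 * h 0 + 0 * on_disc F 0) (at 0)"
      unfolding h(2)
      by (intro DERIV_mult DERIV_deriv_at_0 hh disc_holomorphicD on_disc_holomorphic F)
    then have "deriv y 0 = deriv F 0 * h 0" using DERIV_imp_deriv by (fastforce simp: deriv_on_disc)
    then have "\<alpha> * deriv y 0 = \<beta> * y 0" using ab by (simp add: h(2))
    ultimately show ?thesis by (simp add: hardy_ab_iff[OF p \<alpha>])
  qed
  have "f \<in> hardy_ab p \<alpha> \<beta>" if f: "f \<in> M.mtopology closure_of S" for f
  proof -
    have fh: "f \<in> hardy_space p" and ap: "\<And>r. 0 < r \<Longrightarrow> \<exists>y\<in>S. y \<in> M.mball f r"
      using f by (auto simp: M.metric_closure_of)
    \<comment> \<open>A bound for the norm of that functional: 8 from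
      \<open>hardy_deriv_bound\<close>, 2 from the point bound at 0.\<close>
    define K where "K = 8 * cmod \<alpha> + 2 * cmod \<beta>"
    have "cmod (\<alpha> * deriv f 0 - \<beta> * f 0) \<le> 0"
    proof (rule field_le_epsilon)
      fix e :: real assume e: "0 < e"
      have K: "0 < K" using \<alpha> by (simp add: K_def add_pos_nonneg)
      obtain y where y: "y \<in> S" "y \<in> M.mball f (e / K)" using ap[of "e / K"] e K by auto
      define g where "g z = f z - y z" for z
      have yh: "y \<in> hardy_space p" using Sab[OF y(1)] by (simp add: hardy_ab_iff[OF p \<alpha>])
      have g: "g \<in> hardy_space p" unfolding g_def by (rule hardy_space_diff(1)[OF fh yh p])
      have gn: "hardy_norm p g \<le> e / K" using y(2) by (simp add: M.in_mball g_def[abs_def])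
      have dg: "deriv g 0 = deriv f 0 - deriv y 0" unfolding g_def
        by (intro DERIV_imp_deriv DERIV_diff DERIV_deriv_at_0 hardy_space_holomorphic[OF fh]
            hardy_space_holomorphic[OF yh])
      have "\<alpha> * deriv y 0 = \<beta> * y 0" using Sab[OF y(1)] by (simp add: hardy_ab_iff[OF p \<alpha>])
      then have "\<alpha> * deriv f 0 - \<beta> * f 0 = \<alpha> * deriv g 0 - \<beta> * g 0"
        unfolding dg g_def by (simp add: algebra_simps)
      also have "cmod \<dots> \<le> cmod \<alpha> * cmod (deriv g 0) + cmod \<beta> * cmod (g 0)"
        using norm_triangle_ineq4[of "\<alpha> * deriv g 0" "\<beta> * g 0"] by (simp add: norm_mult)
      also have "\<dots> \<le> cmod \<alpha> * (8 * hardy_norm p g) + cmod \<beta> * (2 * hardy_norm p g)"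
        using hardy_deriv_bound[OF p g] hardy_point_bound[OF p g, of 0]
        by (intro add_mono mult_left_mono) auto
      also have "\<dots> = K * hardy_norm p g" by (simp add: K_def algebra_simps)
      also have "\<dots> \<le> K * (e / K)" using gn K by (intro mult_left_mono) auto
      also have "\<dots> = e" using K by simp
      finally show "cmod (\<alpha> * deriv f 0 - \<beta> * f 0) \<le> 0 + e" by simp
    qed
    then show ?thesis using fh by (simp add: hardy_ab_iff[OF p \<alpha>])
  qed
  moreover have "f \<in> M.mtopology closure_of S" if f: "f \<in> hardy_ab p \<alpha> \<beta>" for f
  proof -
    have fh: "f \<in> hardy_space p" and fab: "\<alpha> * deriv f 0 = \<beta> * f 0" using f by (auto simp: hardy_ab_iff[OF p \<alpha>])
    have iF: "(\<lambda>z. 1 / F z) holomorphic_on ball 0 1" using Fnz by (intro holomorphic_intros F) auto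
    have iB: "cmod (1 / F z) \<le> 1 / m" if "cmod z < 1" for z
      using m(2)[OF that] m(1) by (simp add: norm_divide frac_le)
    define h where "h z = 1 / F z * f z" for z
    have h: "h \<in> hardy_space p" unfolding h_def by (rule hardy_mult_bounded(1)[OF p fh iF iB])
    have hh: "h holomorphic_on ball 0 1" by (rule hardy_space_holomorphic[OF h])
    have F0: "F 0 \<noteq> 0" using Fnz[of 0] by simp
    have "((\<lambda>z. f z / F z) has_field_derivative (deriv f 0 * F 0 - f 0 * deriv F 0) / (F 0 * F 0)) (at 0)"
      by (intro DERIV_divide DERIV_deriv_at_0 hardy_space_holomorphic[OF fh] F F0)
    then have "deriv h 0 = (deriv f 0 * F 0 - f 0 * deriv F 0) / (F 0 * F 0)"
      by (intro DERIV_imp_deriv) (simp add: h_def[abs_def])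
    moreover have "\<alpha> * (deriv f 0 * F 0 - f 0 * deriv F 0) = 0"
    proof -
      have "\<alpha> * (deriv f 0 * F 0 - f 0 * deriv F 0) = (\<alpha> * deriv f 0) * F 0 - f 0 * (\<alpha> * deriv F 0)"
        by (simp add: algebra_simps)
      then show ?thesis unfolding fab ab by simp
    qed
    ultimately have h0: "deriv h 0 = 0" using \<alpha> by simp
    obtain rr :: "nat \<Rightarrow> real" where rr: "\<And>n. 0 < rr n" "\<And>n. rr n < 1" and rrlim: "rr \<longlonglongrightarrow> 1"
      using dilation_radii[OF zero_less_one] by blast
    define hn where "hn n = on_disc (\<lambda>z. h (of_real (rr n) * z))" for n
    have hn1: "hn n \<in> H_infinity_1" for n
      unfolding hn_def by (intro alg1_H_infinity_1 alg1_dilate(2) hh h0 rr)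
    have hnS: "(\<lambda>z. on_disc F z * hn n z) \<in> S" for n unfolding S_def using hn1 by blast
    have lim: "(\<lambda>n. hardy_norm p (\<lambda>z. h z - hn n z)) \<longlonglongrightarrow> 0"
      unfolding hn_def by (rule hardy_dilate_tendsto[OF p h rr rrlim])
    have "\<exists>y\<in>S. y \<in> M.mball f e" if e: "0 < e" for e
    proof -
      have "\<forall>\<^sub>F n in sequentially. hardy_norm p (\<lambda>z. h z - hn n z) < e / B"
        by (rule order_tendstoD(2)[OF lim]) (use e B0 in simp)
      then obtain n where n: "hardy_norm p (\<lambda>z. h z - hn n z) < e / B"
        by (auto simp: eventually_sequentially)
      have hm: "(\<lambda>z. h z - hn n z) \<in> hardy_space p"
        unfolding hn_def by (rule hardy_space_diff(1)[OF h hardy_dilate[OF p h rr] p])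
      define y where "y z = on_disc F z * hn n z" for z
      have yS: "y \<in> S" unfolding y_def by (rule hnS)
      have yh: "y \<in> hardy_space p" using Sab[OF yS] by (simp add: hardy_ab_iff[OF p \<alpha>])
      have "(\<lambda>z. f z - y z) = (\<lambda>z. F z * (h z - hn n z))"
        using Fnz disc_holomorphicD(2)[OF hardy_spaceD[OF fh]]
        by (auto simp: fun_eq_iff y_def on_disc_def h_def hn_def algebra_simps)
      then have "hardy_norm p (\<lambda>z. f z - y z) \<le> B * hardy_norm p (\<lambda>z. h z - hn n z)"
        using hardy_mult_bounded(2)[OF p hm F B] by simp
      also have "\<dots> < e" using n B0 by (simp add: field_simps)
      finally show ?thesis using yS yh fh by (auto simp: M.in_mball)
    qed
    then show ?thesis using fh by (auto simp: M.metric_closure_of)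
  qed
  ultimately have "M.mtopology closure_of S = hardy_ab p \<alpha> \<beta>" by blast
  then show ?thesis using Fin by (simp add: cyclic_ab_def S_def hardy_topology_def)
qed

section \<open>Functionals that do not vanish on exponentials\<close>

text \<open>The argument of Gleason, Kahane and Zelazko: \<open>\<lambda> \<mapsto> X (exp (\<lambda> u))\<close> is entire, without zeros
  and of exponential type, hence an exponential; compare second derivatives at \<open>0\<close>.\<close>

lemma exp_nonvanishing_square:
  assumes add: "\<And>u v. alg1 u \<Longrightarrow> alg1 v \<Longrightarrow> X (\<lambda>z. u z + v z) = X u + X v"
    and cmult: "\<And>c u. alg1 u \<Longrightarrow> X (\<lambda>z. c * u z) = c * X u"
    and bd: "\<And>u B. alg1 u \<Longrightarrow> (\<And>z. cmod z < 1 \<Longrightarrow> cmod (u z) \<le> B) \<Longrightarrow> cmod (X u) \<le> K * B"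
    and nz: "\<And>u. alg1 u \<Longrightarrow> X (\<lambda>z. exp (u z)) \<noteq> (0 :: complex)"
    and u: "alg1 u"
  shows "X (\<lambda>z. u z * u z) * X (\<lambda>_. 1) = X u * X u"
proof -
  obtain B where B: "0 \<le> B" "\<And>z. cmod z < 1 \<Longrightarrow> cmod (u z) \<le> B" using alg1E[OF u] by metis
  have K0: "0 \<le> K" using order_trans[OF norm_ge_zero bd[OF alg1_const[of 1], of 1]] by simp
  \<comment> \<open>Stated for a general \<open>v\<close> so that \<open>v = 1\<close> gives the
    first derivative of \<open>E\<close> and \<open>v = u\<close> the second.\<close>
  have deriv: "((\<lambda>l. X (\<lambda>z. v z * exp (l * u z))) has_field_derivative X (\<lambda>z. (u z * v z) * exp (l * u z))) (at l)"
    if v: "alg1 v" for v l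
  proof -
    obtain V where V: "0 \<le> V" "\<And>z. cmod z < 1 \<Longrightarrow> cmod (v z) \<le> V" using alg1E[OF v] by metis
    define E where "E l = X (\<lambda>z. v z * exp (l * u z))" for l
    define D where "D = X (\<lambda>z. (u z * v z) * exp (l * u z))"
    define C where "C = K * (V * exp (cmod l * B) * (exp B * B\<^sup>2))"
    have a1: "alg1 (\<lambda>z. v z * exp (k * u z))" for k by (intro alg1_mult v alg1_exp alg1_cmult u)
    have a2: "alg1 (\<lambda>z. (u z * v z) * exp (k * u z))" for k by (intro alg1_mult v alg1_exp alg1_cmult u)
    have est: "cmod ((E (l + h) - E l) / h - D) \<le> C * cmod h" if h: "h \<noteq> 0" "cmod h < 1" for h
    proof -
      \<comment> \<open>Spelled as a linear combination within the algebra so that \<open>X\<close>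
        splits over it. Its closed form contains the Taylor remainder of exp (h u), which is of
        second order in h.\<close>
      define w where "w z = v z * exp ((l + h) * u z) + ((-1) * (v z * exp (l * u z)) + (-h) * ((u z * v z) * exp (l * u z)))" for z
      have w: "w z = v z * exp (l * u z) * (exp (h * u z) - (1 + h * u z))" for z
        by (simp add: w_def distrib_right exp_add algebra_simps)
      have aw: "alg1 w" unfolding w_def by (intro alg1_add alg1_cmult a1 a2)
      have "X w = E (l + h) - E l - h * D"
        unfolding w_def E_def D_def
        by (simp only: add cmult a1 a2 alg1_add alg1_cmult) simp
      moreover have "cmod (X w) \<le> K * (V * exp (cmod l * B) * (exp B * B\<^sup>2) * (cmod h)\<^sup>2)"
      proof (rule bd[OF aw])
        fix z :: complex assume z: "cmod z < 1"
        have hu: "cmod (h * u z) \<le> cmod h * B" using B(2)[OF z] by (simp add: norm_mult mult_left_mono)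
        have "cmod h * B \<le> 1 * B" using h B(1) by (intro mult_right_mono) auto
        then have hB: "cmod (h * u z) \<le> B" using hu by simp
        have "cmod (exp (h * u z) - (1 + h * u z)) \<le> exp (cmod (h * u z)) * (cmod (h * u z))\<^sup>2"
          using Taylor_exp_field[of "h * u z" 1] by (simp add: power2_eq_square)
        also have "\<dots> \<le> exp B * (cmod h * B)\<^sup>2"
          using hB hu by (intro mult_mono power_mono) auto
        finally have 1: "cmod (exp (h * u z) - (1 + h * u z)) \<le> exp B * (cmod h * B)\<^sup>2" .
        have "cmod (l * u z) \<le> cmod l * B" using B(2)[OF z] by (simp add: norm_mult mult_left_mono)
        then have 2: "cmod (exp (l * u z)) \<le> exp (cmod l * B)" by (rule norm_exp_le)
        have "cmod (w z) = cmod (v z) * cmod (exp (l * u z)) * cmod (exp (h * u z) - (1 + h * u z))"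
          unfolding w by (simp only: norm_mult)
        also have "\<dots> \<le> V * exp (cmod l * B) * (exp B * (cmod h * B)\<^sup>2)"
          using V z by (intro mult_mono 1 2) auto
        finally show "cmod (w z) \<le> V * exp (cmod l * B) * (exp B * B\<^sup>2) * (cmod h)\<^sup>2"
          by (simp add: power_mult_distrib mult_ac)
      qed
      ultimately have "cmod (E (l + h) - E l - h * D) \<le> C * (cmod h)\<^sup>2" by (simp add: C_def mult_ac)
      moreover have "(E (l + h) - E l) / h - D = (E (l + h) - E l - h * D) / h"
        using h by (simp add: diff_divide_distrib)
      ultimately have "cmod ((E (l + h) - E l) / h - D) \<le> C * (cmod h)\<^sup>2 / cmod h"
        by (simp add: norm_divide divide_right_mono)
      then show ?thesis using h by (simp add: power2_eq_square)
    qed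
    have "(\<lambda>h. C * cmod h) \<midarrow>0\<rightarrow> C * cmod 0" by (intro tendsto_intros)
    then have "(\<lambda>h. C * cmod h) \<midarrow>0\<rightarrow> 0" by simp
    then have "(\<lambda>h. (E (l + h) - E l) / h - D) \<midarrow>0\<rightarrow> 0"
      by (rule Lim_null_comparison[where g = "\<lambda>h. C * cmod h", rotated])
        (use est in \<open>auto simp: eventually_at dist_norm intro!: exI[of _ 1]\<close>)
    then have "(\<lambda>h. (E (l + h) - E l) / h) \<midarrow>0\<rightarrow> D" by (rule LIM_zero_cancel)
    then show ?thesis unfolding E_def[symmetric] D_def[symmetric] by (simp add: DERIV_def)
  qed
  define E where "E l = X (\<lambda>z. exp (l * u z))" for l
  have dE: "(E has_field_derivative X (\<lambda>z. u z * exp (l * u z))) (at l)" for l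
    using deriv[OF alg1_const[of 1], of l] by (simp add: E_def[abs_def])
  have hol: "E holomorphic_on UNIV"
    using dE by (auto simp: holomorphic_on_def field_differentiable_def)
  have "cmod (E l) \<le> K * exp (B * cmod l)" for l
    unfolding E_def
  proof (rule bd)
    show "cmod (exp (l * u z)) \<le> exp (B * cmod l)" if "cmod z < 1" for z
      using B(2)[OF that] by (intro norm_exp_le) (simp add: norm_mult mult.commute[of B] mult_left_mono)
  qed (intro alg1_exp alg1_cmult u)
  moreover have "E l \<noteq> 0" for l unfolding E_def by (intro nz alg1_cmult u)
  ultimately obtain c where c: "\<And>l. E l = E 0 * exp (c * l)"
    using entire_nonvanishing_exponential_type[OF hol _ B(1)] by metis
  have E1: "X (\<lambda>z. u z * exp (l * u z)) = E 0 * (c * exp (c * l))" for l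
  proof (rule DERIV_unique[OF dE])
    have "((\<lambda>l. E 0 * exp (c * l)) has_field_derivative E 0 * (c * exp (c * l))) (at l)"
      by (auto intro!: derivative_eq_intros)
    moreover have "E = (\<lambda>l. E 0 * exp (c * l))" using c by blast
    ultimately show "(E has_field_derivative E 0 * (c * exp (c * l))) (at l)" by simp
  qed
  have "((\<lambda>l. E 0 * (c * exp (c * l))) has_field_derivative X (\<lambda>z. (u z * u z) * exp (0 * u z))) (at 0)"
    using deriv[OF u, of 0] by (simp add: E1)
  moreover have "((\<lambda>l. E 0 * (c * exp (c * l))) has_field_derivative E 0 * (c * c)) (at 0)"
    by (auto intro!: derivative_eq_intros)
  ultimately have "X (\<lambda>z. (u z * u z) * exp (0 * u z)) = E 0 * (c * c)" by (rule DERIV_unique)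
  then have "X (\<lambda>z. u z * u z) = E 0 * (c * c)" by simp
  moreover have "X u = E 0 * c" using E1[of 0] by simp
  moreover have "X (\<lambda>_. 1) = E 0" by (simp add: E_def)
  ultimately show ?thesis by simp
qed

text \<open>Polarization of the previous lemma at u + v.\<close>

lemma exp_nonvanishing_mult:
  assumes add: "\<And>u v. alg1 u \<Longrightarrow> alg1 v \<Longrightarrow> X (\<lambda>z. u z + v z) = X u + X v"
    and cmult: "\<And>c u. alg1 u \<Longrightarrow> X (\<lambda>z. c * u z) = c * X u"
    and bd: "\<And>u B. alg1 u \<Longrightarrow> (\<And>z. cmod z < 1 \<Longrightarrow> cmod (u z) \<le> B) \<Longrightarrow> cmod (X u) \<le> K * B"
    and nz: "\<And>u. alg1 u \<Longrightarrow> X (\<lambda>z. exp (u z)) \<noteq> (0 :: complex)"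
    and u: "alg1 u" and v: "alg1 v"
  shows "X (\<lambda>z. u z * v z) * X (\<lambda>_. 1) = X u * X v"
proof -
  have sq: "X (\<lambda>z. w z * w z) * X (\<lambda>_. 1) = X w * X w" if "alg1 w" for w
    by (rule exp_nonvanishing_square[where X = X and K = K]) (assumption | rule add cmult bd nz that)+
  define a where "a = X (\<lambda>_. 1)"
  have "X (\<lambda>z. (u z + v z) * (u z + v z)) = X (\<lambda>z. u z * u z + (2 * (u z * v z) + v z * v z))"
    by (rule arg_cong[of _ _ X]) (simp add: fun_eq_iff algebra_simps)
  also have "\<dots> = X (\<lambda>z. u z * u z) + (2 * X (\<lambda>z. u z * v z) + X (\<lambda>z. v z * v z))"
    by (simp only: add cmult alg1_add alg1_mult alg1_cmult u v)
  finally have "(X (\<lambda>z. u z * u z) + (2 * X (\<lambda>z. u z * v z) + X (\<lambda>z. v z * v z))) * a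
      = X (\<lambda>z. u z + v z) * X (\<lambda>z. u z + v z)"
    using sq[OF alg1_add[OF u v]] by (simp add: a_def)
  also have "X (\<lambda>z. u z + v z) = X u + X v" by (rule add[OF u v])
  finally have "X (\<lambda>z. u z * u z) * a + 2 * (X (\<lambda>z. u z * v z) * a) + X (\<lambda>z. v z * v z) * a
      = X u * X u + 2 * (X u * X v) + X v * X v" by (simp add: algebra_simps)
  then show ?thesis using sq[OF u] sq[OF v] by (simp add: a_def)
qed

section \<open>Operators that do not vanish on cyclic functions\<close>

locale nonvanishing_operator =
  fixes p :: real and \<alpha> \<beta> :: complex and T :: "(complex \<Rightarrow> complex) \<Rightarrow> (complex \<Rightarrow> complex)"
  assumes p: "1 \<le> p" and \<alpha>: "\<alpha> \<noteq> 0"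
    and op: "hardy_ab_operator p \<alpha> \<beta> T"
    and surj: "T ` hardy_ab p \<alpha> \<beta> = hardy_ab p \<alpha> \<beta>"
    and nonvanishing: "\<And>g z. cyclic_ab p \<alpha> \<beta> g \<Longrightarrow> z \<in> ball 0 1 \<Longrightarrow> T g z \<noteq> 0"
begin

abbreviation "ab \<equiv> hardy_ab p \<alpha> \<beta>"

text \<open>A cyclic function that generates \<open>ab\<close>: its elements are \<open>E0 h\<close> with \<open>h \<in> H\<^sup>p\<close> and \<open>h' 0 = 0\<close>.\<close>

definition E0 :: "complex \<Rightarrow> complex" where "E0 z = exp (\<beta> / \<alpha> * z)"

text \<open>Multiplication by \<open>E0\<close>; through it, functionals on \<open>ab\<close> can be
  tested on the algebra.\<close>

definition N :: "(complex \<Rightarrow> complex) \<Rightarrow> complex \<Rightarrow> complex" where "N u = on_disc (\<lambda>z. E0 z * u z)"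

definition M0 :: real where "M0 = exp (cmod (\<beta> / \<alpha>))"

lemma M0_pos: "0 < M0" by (simp add: M0_def)

lemma E0_holomorphic [holomorphic_intros]: "E0 holomorphic_on A"
  unfolding E0_def by (intro holomorphic_intros)

lemma E0_nonzero [simp]: "E0 z \<noteq> 0" by (simp add: E0_def)

lemma E0_0 [simp]: "E0 0 = 1" by (simp add: E0_def)

lemma E0_DERIV: "(E0 has_field_derivative \<beta> / \<alpha>) (at 0)"
  unfolding E0_def using \<alpha> by (auto intro!: derivative_eq_intros)

lemma E0_bound:
  assumes "cmod z < 1"
  shows "cmod (E0 z) \<le> M0" "cmod (1 / E0 z) \<le> M0"
proof -
  have "cmod (\<beta> / \<alpha> * z) \<le> cmod (\<beta> / \<alpha>) * 1"
    unfolding norm_mult using assms by (intro mult_left_mono) auto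
  then have le: "cmod (\<beta> / \<alpha> * z) \<le> cmod (\<beta> / \<alpha>)" by simp
  show "cmod (E0 z) \<le> M0" unfolding E0_def M0_def by (rule norm_exp_le[OF le])
  have "1 / E0 z = exp (- (\<beta> / \<alpha> * z))" by (simp add: E0_def exp_minus inverse_eq_divide)
  moreover have "cmod (exp (- (\<beta> / \<alpha> * z))) \<le> exp (cmod (\<beta> / \<alpha>))"
    by (rule norm_exp_le) (use le in simp)
  ultimately show "cmod (1 / E0 z) \<le> M0" by (simp only: M0_def)
qed

lemma ab_iff: "f \<in> ab \<longleftrightarrow> f \<in> hardy_space p \<and> \<alpha> * deriv f 0 = \<beta> * f 0"
  by (rule hardy_ab_iff[OF p \<alpha>])

lemma ab_hardy: "f \<in> ab \<Longrightarrow> f \<in> hardy_space p" by (simp add: ab_iff)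

lemma ab_holomorphic: "f \<in> ab \<Longrightarrow> f holomorphic_on ball 0 1"
  using ab_hardy hardy_space_holomorphic by blast

lemma ab_outside: "f \<in> ab \<Longrightarrow> \<not> cmod z < 1 \<Longrightarrow> f z = 0"
  using ab_hardy hardy_spaceD disc_holomorphicD(2) by blast

lemma ab_mult:
  assumes f: "f \<in> ab" and u: "alg1 u"
  shows "(\<lambda>z. u z * f z) \<in> ab"
proof -
  obtain B where B: "u holomorphic_on ball 0 1" "\<And>z. cmod z < 1 \<Longrightarrow> cmod (u z) \<le> B"
    "(u has_field_derivative 0) (at 0)" using alg1E[OF u] by metis
  have "((\<lambda>z. u z * f z) has_field_derivative 0 * f 0 + deriv f 0 * u 0) (at 0)"
    by (intro DERIV_mult B DERIV_deriv_at_0 ab_holomorphic f)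
  then have "deriv (\<lambda>z. u z * f z) 0 = deriv f 0 * u 0" using DERIV_imp_deriv by fastforce
  then show ?thesis
    using hardy_mult_bounded(1)[OF p ab_hardy[OF f] B(1,2)] f by (simp add: ab_iff)
qed

lemma N_one: "N (\<lambda>_. 1) \<in> ab"
proof -
  have "on_disc E0 \<in> hardy_space p"
    by (rule hardy_bounded(1)[OF p _ E0_bound(1)]) (intro holomorphic_intros)
  then show ?thesis
    using DERIV_imp_deriv[OF E0_DERIV] \<alpha> by (simp add: ab_iff N_def deriv_on_disc)
qed

lemma N_mult: "N u = (\<lambda>z. u z * N (\<lambda>_. 1) z)"
  by (auto simp: N_def on_disc_def)

lemma N_in_ab: "alg1 u \<Longrightarrow> N u \<in> ab"
  unfolding N_mult[of u] by (rule ab_mult[OF N_one])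

text \<open>Division by \<open>E0\<close> undoes \<open>N\<close>. Since \<open>E0\<close> has value
  1 and derivative \<open>\<beta> / \<alpha>\<close> at 0, the quotient rule turns the constraint on
  \<open>f\<close> into derivative 0.\<close>

lemma quotient_E0:
  assumes f: "f \<in> ab"
  defines "h \<equiv> \<lambda>z. 1 / E0 z * f z"
  shows "h \<in> hardy_space p" "h holomorphic_on ball 0 1" "deriv h 0 = 0"
proof -
  show h: "h \<in> hardy_space p" unfolding h_def
    by (rule hardy_mult_bounded(1)[OF p ab_hardy[OF f] _ E0_bound(2)]) (intro holomorphic_intros, simp)
  show "h holomorphic_on ball 0 1" by (rule hardy_space_holomorphic[OF h])
  have "((\<lambda>z. f z / E0 z) has_field_derivative (deriv f 0 * E0 0 - f 0 * (\<beta> / \<alpha>)) / (E0 0 * E0 0)) (at 0)"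
    by (intro DERIV_divide DERIV_deriv_at_0 ab_holomorphic f E0_DERIV) simp
  moreover have "\<alpha> * deriv f 0 = \<beta> * f 0" using f by (simp add: ab_iff)
  then have "deriv f 0 = f 0 * (\<beta> / \<alpha>)" using \<alpha> by (simp add: field_simps)
  ultimately show "deriv h 0 = 0"
    by (intro DERIV_imp_deriv) (simp add: h_def)
qed

section \<open>Linearity and boundedness of \<open>T\<close>\<close>

lemma T_in: "f \<in> ab \<Longrightarrow> T f \<in> ab"
  using op by (auto simp: hardy_ab_operator_def)

lemma T_add: "f \<in> ab \<Longrightarrow> g \<in> ab \<Longrightarrow> T (\<lambda>z. f z + g z) = (\<lambda>z. T f z + T g z)"
  using op by (simp add: hardy_ab_operator_def)

lemma T_cmult: "f \<in> ab \<Longrightarrow> T (\<lambda>z. c * f z) = (\<lambda>z. c * T f z)"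
  using op by (simp add: hardy_ab_operator_def)

lemma ab_cmult: "f \<in> ab \<Longrightarrow> (\<lambda>z. c * f z) \<in> ab"
  by (rule ab_mult[OF _ alg1_const])

lemma ab_diff:
  assumes f: "f \<in> ab" and g: "g \<in> ab"
  shows "(\<lambda>z. f z - g z) \<in> ab"
proof -
  have d: "deriv (\<lambda>z. f z - g z) 0 = deriv f 0 - deriv g 0"
    by (intro DERIV_imp_deriv DERIV_diff DERIV_deriv_at_0 ab_holomorphic f g)
  have "\<alpha> * deriv f 0 = \<beta> * f 0" "\<alpha> * deriv g 0 = \<beta> * g 0" using f g by (simp_all add: ab_iff)
  then have "\<alpha> * (deriv f 0 - deriv g 0) = \<beta> * (f 0 - g 0)" by (simp only: right_diff_distrib)
  then show ?thesis
    using hardy_space_diff(1)[OF ab_hardy[OF f] ab_hardy[OF g] p] by (simp add: ab_iff d)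
qed

lemma T_diff: "f \<in> ab \<Longrightarrow> g \<in> ab \<Longrightarrow> T (\<lambda>z. f z - g z) = (\<lambda>z. T f z - T g z)"
  using T_add[of f "\<lambda>z. (-1) * g z"] T_cmult[of g "-1"] ab_cmult[of g "-1"] by simp

lemma T_bounded:
  obtains K where "0 \<le> K" "\<And>f. f \<in> ab \<Longrightarrow> hardy_norm p (T f) \<le> K * hardy_norm p f"
proof -
  interpret M: Metric_space "hardy_space p" "\<lambda>f g. hardy_norm p (\<lambda>z. f z - g z)"
    by (rule Metric_space_hardy[OF p])
  define Z where "Z = (\<lambda>z::complex. 0 :: complex)"
  have Z: "Z \<in> ab" using ab_cmult[OF N_one, of 0] by (simp add: Z_def)
  have TZ: "T Z = Z" using T_cmult[OF Z, of 0] by (simp add: Z_def)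
  have nZ: "hardy_norm p (\<lambda>z. Z z - f z) = hardy_norm p f" for f
    using hardy_norm_minus_commute[of p Z f] by (simp add: Z_def)
  have top: "topspace (subtopology M.mtopology ab) = ab"
    using ab_hardy by (auto simp: topspace_subtopology)
  have cont: "continuous_map (subtopology M.mtopology ab) (subtopology M.mtopology ab) T"
    using op by (simp add: hardy_ab_operator_def hardy_ab_topology_def hardy_topology_def)
  have "openin (subtopology M.mtopology ab) (M.mball Z 1 \<inter> ab)"
    by (auto simp: openin_subtopology)
  from openin_continuous_map_preimage[OF cont this]
  obtain V where V: "openin M.mtopology V" "{f \<in> ab. T f \<in> M.mball Z 1 \<inter> ab} = V \<inter> ab"
    unfolding top by (auto simp: openin_subtopology)
  have "Z \<in> M.mball Z 1" unfolding M.centre_in_mball_iff using ab_hardy[OF Z] by simp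
  then have "Z \<in> {f \<in> ab. T f \<in> M.mball Z 1 \<inter> ab}" using Z by (simp only: mem_Collect_eq TZ Int_iff)
  then have "Z \<in> V" unfolding V(2) by simp
  then obtain d where d: "0 < d" "M.mball Z d \<subseteq> V" using V(1) by (auto simp: M.openin_mtopology)
  have small: "hardy_norm p (T f) < 1" if f: "f \<in> ab" "hardy_norm p f < d" for f
  proof -
    have "f \<in> M.mball Z d" using f ab_hardy[OF f(1)] ab_hardy[OF Z] by (simp add: M.in_mball nZ)
    then have "f \<in> V \<inter> ab" using d(2) f(1) by blast
    then have "f \<in> {f \<in> ab. T f \<in> M.mball Z 1 \<inter> ab}" unfolding V(2) .
    then show ?thesis by (simp add: M.in_mball nZ)
  qed
  have "hardy_norm p (T f) \<le> 2 / d * hardy_norm p f" if f: "f \<in> ab" for f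
  proof (cases "hardy_norm p f = 0")
    case True
    then have "f = Z" using hardy_norm_eq_0[OF ab_hardy[OF f] p] by (simp add: Z_def)
    then show ?thesis using True TZ by simp
  next
    case False
    then have n: "0 < hardy_norm p f" using hardy_norm_nonneg[of p f] by simp
    \<comment> \<open>Scales \<open>f\<close> to norm \<open>d / 2\<close>, inside the ball that
      \<open>T\<close> maps into the unit ball; hence the constant \<open>2 / d\<close>.\<close>
    define c where "c = d / (2 * hardy_norm p f)"
    have c: "0 < c" using n d by (simp add: c_def)
    have "hardy_norm p (\<lambda>z. of_real c * f z) \<le> c * hardy_norm p f"
      using hardy_cmult(2)[OF p ab_hardy[OF f], of "of_real c"] c by simp
    also have "\<dots> < d" using n d by (simp add: c_def)
    finally have s: "hardy_norm p (T (\<lambda>z. of_real c * f z)) < 1" by (intro small ab_cmult f)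
    have "T f = (\<lambda>z. of_real (1 / c) * T (\<lambda>z. of_real c * f z) z)"
      using c by (simp add: T_cmult[OF f])
    then have "hardy_norm p (T f) \<le> 1 / c * hardy_norm p (T (\<lambda>z. of_real c * f z))"
      using hardy_cmult(2)[OF p ab_hardy[OF T_in[OF ab_cmult[OF f]]], of "of_real (1 / c)" "of_real c"] c by (simp add: norm_divide)
    also have "\<dots> \<le> 1 / c * 1" using s c by (intro mult_left_mono) auto
    also have "\<dots> = 2 / d * hardy_norm p f" by (simp add: c_def)
    finally show ?thesis .
  qed
  then show thesis using that[of "2 / d"] d by simp
qed

section \<open>The functionals \<open>X w\<close>: multiplicativity and the point they evaluate
  at\<close>

definition X :: "complex \<Rightarrow> (complex \<Rightarrow> complex) \<Rightarrow> complex" where "X w u = T (N u) w"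

lemma X_add: "alg1 u \<Longrightarrow> alg1 v \<Longrightarrow> X w (\<lambda>z. u z + v z) = X w u + X w v"
proof -
  assume "alg1 u" "alg1 v"
  moreover have "N (\<lambda>z. u z + v z) = (\<lambda>z. N u z + N v z)" by (auto simp: N_def on_disc_def distrib_left)
  ultimately show ?thesis by (simp add: X_def T_add N_in_ab)
qed

lemma X_cmult: "alg1 u \<Longrightarrow> X w (\<lambda>z. c * u z) = c * X w u"
proof -
  assume "alg1 u"
  moreover have "N (\<lambda>z. c * u z) = (\<lambda>z. c * N u z)" by (auto simp: N_def on_disc_def)
  ultimately show ?thesis by (simp add: X_def T_cmult N_in_ab)
qed

lemma X_bounded:
  assumes w: "cmod w < 1"
  obtains K where "\<And>u B. alg1 u \<Longrightarrow> (\<And>z. cmod z < 1 \<Longrightarrow> cmod (u z) \<le> B) \<Longrightarrow> cmod (X w u) \<le> K * B"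
proof -
  obtain K where K: "0 \<le> K" "\<And>f. f \<in> ab \<Longrightarrow> hardy_norm p (T f) \<le> K * hardy_norm p f"
    using T_bounded by blast
  have "cmod (X w u) \<le> (2 / (1 - cmod w) * K * M0) * B"
    if u: "alg1 u" "\<And>z. cmod z < 1 \<Longrightarrow> cmod (u z) \<le> B" for u B
  proof -
    have "hardy_norm p (N u) \<le> M0 * B"
      unfolding N_def
    proof (rule hardy_bounded(2)[OF p])
      show "(\<lambda>z. E0 z * u z) holomorphic_on ball 0 1"
        using u by (intro holomorphic_intros) (simp add: alg1_def)
      show "cmod (E0 z * u z) \<le> M0 * B" if "cmod z < 1" for z
        unfolding norm_mult using that M0_pos by (intro mult_mono E0_bound u) auto
    qed
    then have "K * hardy_norm p (N u) \<le> K * (M0 * B)" using K(1) by (rule mult_left_mono)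
    then have "hardy_norm p (T (N u)) \<le> K * (M0 * B)" using K(2)[OF N_in_ab[OF u(1)]] by simp
    then have "2 / (1 - cmod w) * hardy_norm p (T (N u)) \<le> 2 / (1 - cmod w) * (K * (M0 * B))"
      using w by (intro mult_left_mono) auto
    then show ?thesis
      using hardy_point_bound[OF p ab_hardy[OF T_in[OF N_in_ab[OF u(1)]]] w] by (simp add: X_def mult_ac)
  qed
  then show thesis by (rule that)
qed

text \<open>\<open>E0\<close> times exp u is bounded above and below by \<open>M0 * exp B\<close>
  and its reciprocal, and the factor exp u, having derivative 0 at 0, preserves the constraint; so
  it is cyclic.\<close>

lemma X_exp_nonzero:
  assumes w: "cmod w < 1" and u: "alg1 u"
  shows "X w (\<lambda>z. exp (u z)) \<noteq> 0"
proof -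
  obtain B where B: "0 \<le> B" "u holomorphic_on ball 0 1" "\<And>z. cmod z < 1 \<Longrightarrow> cmod (u z) \<le> B"
    "(u has_field_derivative 0) (at 0)" using alg1E[OF u] by metis
  have "cyclic_ab p \<alpha> \<beta> (on_disc (\<lambda>z. E0 z * exp (u z)))"
  proof (rule bounded_below_cyclic[OF p \<alpha>])
    show "(\<lambda>z. E0 z * exp (u z)) holomorphic_on ball 0 1" by (intro holomorphic_intros B)
    show "cmod (E0 z * exp (u z)) \<le> M0 * exp B" if "cmod z < 1" for z
      unfolding norm_mult using that M0_pos by (intro mult_mono E0_bound norm_exp_le B) auto
    show "0 < 1 / (M0 * exp B)" using M0_pos by simp
    show "1 / (M0 * exp B) \<le> cmod (E0 z * exp (u z))" if z: "cmod z < 1" for z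
    proof -
      have "cmod (1 / E0 z * exp (- u z)) \<le> M0 * exp B"
        unfolding norm_mult using z M0_pos by (intro mult_mono E0_bound norm_exp_le) (auto simp: B)
      moreover have "1 / E0 z * exp (- u z) = 1 / (E0 z * exp (u z))" by (simp add: exp_minus field_simps)
      ultimately have "cmod (1 / (E0 z * exp (u z))) \<le> M0 * exp B" by (simp only:)
      then have "1 / cmod (E0 z * exp (u z)) \<le> M0 * exp B" unfolding norm_divide norm_one .
      moreover have "0 < cmod (E0 z * exp (u z))" unfolding zero_less_norm_iff by simp
      ultimately show ?thesis using M0_pos by (metis divide_le_eq exp_gt_zero mult.commute mult_pos_pos)
    qed
    have "((\<lambda>z. E0 z * exp (u z)) has_field_derivative \<beta> / \<alpha> * exp (u 0)) (at 0)"
      by (auto intro!: derivative_eq_intros E0_DERIV B(4))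
    then have "deriv (\<lambda>z. E0 z * exp (u z)) 0 = \<beta> / \<alpha> * exp (u 0)" by (rule DERIV_imp_deriv)
    then show "\<alpha> * deriv (\<lambda>z. E0 z * exp (u z)) 0 = \<beta> * (E0 0 * exp (u 0))" using \<alpha> by simp
  qed
  then show ?thesis using nonvanishing w by (simp add: X_def N_def)
qed

definition a where "a w = X w (\<lambda>_. 1)"

lemma a_nonzero: "cmod w < 1 \<Longrightarrow> a w \<noteq> 0"
  using X_exp_nonzero[of w "\<lambda>_. 0"] alg1_const[of 0] by (simp add: a_def)

text \<open>\<open>X w\<close> is not normalized to 1 at the unit, hence the factor
  \<open>a w\<close>; the character is the quotient by \<open>a w\<close>.\<close>

lemma X_mult:
  assumes w: "cmod w < 1" and u: "alg1 u" and v: "alg1 v"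
  shows "X w (\<lambda>z. u z * v z) * a w = X w u * X w v"
proof -
  obtain K where K: "\<And>u B. alg1 u \<Longrightarrow> (\<And>z. cmod z < 1 \<Longrightarrow> cmod (u z) \<le> B) \<Longrightarrow> cmod (X w u) \<le> K * B"
    using X_bounded[OF w] by blast
  show ?thesis unfolding a_def
    by (rule exp_nonvanishing_mult[where X = "X w" and K = K])
      (assumption | rule X_add X_cmult K X_exp_nonzero w u v)+
qed

lemma X_holomorphic:
  assumes "alg1 u"
  shows "(\<lambda>w. X w u) holomorphic_on ball 0 1"
  unfolding X_def using ab_holomorphic[OF T_in[OF N_in_ab[OF assms]]] by simp

lemma X_power_step:
  assumes w: "cmod w < 1" and mn: "2 \<le> m" "2 \<le> n"
  shows "X w (\<lambda>z. z ^ (m + n)) * a w = X w (\<lambda>z. z ^ m) * X w (\<lambda>z. z ^ n)"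
  using X_mult[OF w alg1_power[OF mn(1)] alg1_power[OF mn(2)]] by (simp only: power_add)

lemma evaluation_point:
  obtains \<phi> where "\<phi> holomorphic_on ball 0 1"
    "\<And>w. cmod w < 1 \<Longrightarrow> X w (\<lambda>z. z ^ 2) = a w * \<phi> w ^ 2"
    "\<And>w. cmod w < 1 \<Longrightarrow> X w (\<lambda>z. z ^ 3) = a w * \<phi> w ^ 3"
    "\<And>w. cmod w < 1 \<Longrightarrow> cmod (\<phi> w) \<le> 1"
proof -
  define S where "S w = X w (\<lambda>z. z ^ 2) / a w" for w
  define R where "R w = X w (\<lambda>z. z ^ 3) / a w" for w
  have ah: "a holomorphic_on ball 0 1"
    using X_holomorphic[OF alg1_const[of 1]] by (simp add: a_def[abs_def])
  have SR: "S holomorphic_on ball 0 1" "R holomorphic_on ball 0 1"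
    unfolding S_def R_def
    by (intro holomorphic_intros ah X_holomorphic alg1_power; use a_nonzero in force)+
  \<comment> \<open>z^6 is the cube of z^2 and the square of z^3. The steps go through z^4 because
    every intermediate power must lie in the algebra.\<close>
  have eq: "S w ^ 3 = R w ^ 2" if "w \<in> ball 0 1" for w
  proof -
    have w: "cmod w < 1" using that by simp
    have "X w (\<lambda>z. z ^ 4) * a w = X w (\<lambda>z. z ^ 2) * X w (\<lambda>z. z ^ 2)"
      using X_power_step[OF w, of 2 2] by simp
    then have X4: "X w (\<lambda>z. z ^ 4) = a w * S w ^ 2"
      using a_nonzero[OF w] by (simp add: S_def field_simps power2_eq_square)
    have "X w (\<lambda>z. z ^ 6) * a w = X w (\<lambda>z. z ^ 2) * X w (\<lambda>z. z ^ 4)"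
      using X_power_step[OF w, of 2 4] by simp
    then have X6: "X w (\<lambda>z. z ^ 6) = a w * S w ^ 3"
      using a_nonzero[OF w] by (simp add: X4 S_def field_simps power2_eq_square power3_eq_cube)
    have "X w (\<lambda>z. z ^ 6) * a w = X w (\<lambda>z. z ^ 3) * X w (\<lambda>z. z ^ 3)"
      using X_power_step[OF w, of 3 3] by simp
    then have "X w (\<lambda>z. z ^ 6) = a w * R w ^ 2"
      using a_nonzero[OF w] by (simp add: R_def field_simps power2_eq_square)
    then show ?thesis using X6 a_nonzero[OF w] by simp
  qed
  obtain \<phi> where \<phi>: "\<phi> holomorphic_on ball 0 1" "\<And>z. z \<in> ball 0 1 \<Longrightarrow> \<phi> z ^ 2 = S z" "\<And>z. z \<in> ball 0 1 \<Longrightarrow> \<phi> z ^ 3 = R z"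
    using cusp_parametrization[OF open_ball connected_ball SR eq] by blast
  have "cmod (\<phi> w) \<le> 1" if w: "cmod w < 1" for w
  proof (rule ccontr)
    assume "\<not> cmod (\<phi> w) \<le> 1"
    then have g: "1 < cmod (S w)" using \<phi>(2)[of w] w by (simp flip: \<phi>(2) add: norm_power one_less_power)
    obtain K where K: "\<And>u B. alg1 u \<Longrightarrow> (\<And>z. cmod z < 1 \<Longrightarrow> cmod (u z) \<le> B) \<Longrightarrow> cmod (X w u) \<le> K * B"
      using X_bounded[OF w] by blast
    \<comment> \<open>The even powers of z are bounded by 1 on the disc, whereas their values
      \<open>a w * S w ^ Suc n\<close> would grow geometrically.\<close>
    have pw: "X w (\<lambda>z. z ^ (2 * Suc n)) = a w * S w ^ Suc n" for n
    proof (induction n)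
      case 0
      show ?case using a_nonzero[OF w] by (simp add: S_def)
    next
      case (Suc n)
      have "X w (\<lambda>z. z ^ (2 + 2 * Suc n)) * a w = X w (\<lambda>z. z ^ 2) * X w (\<lambda>z. z ^ (2 * Suc n))"
        by (rule X_power_step[OF w]) auto
      also have "\<dots> = (S w * a w) * (a w * S w ^ Suc n)"
        unfolding Suc.IH using a_nonzero[OF w] by (simp add: S_def)
      finally have "X w (\<lambda>z. z ^ (2 + 2 * Suc n)) = a w * S w ^ Suc (Suc n)"
        using a_nonzero[OF w] by simp
      then show ?case by (simp only: mult_Suc_right)
    qed
    obtain n where n: "K / cmod (a w) < cmod (S w) ^ n" using real_arch_pow[OF g] by blast
    have "cmod (X w (\<lambda>z. z ^ (2 * Suc n))) \<le> K * 1"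
      by (rule K[OF alg1_power]) (auto simp: norm_mult norm_power intro!: mult_le_one power_le_one)
    then have "cmod (a w) * cmod (S w) ^ Suc n \<le> K" unfolding pw by (simp add: norm_mult norm_power)
    then have "cmod (S w) ^ Suc n \<le> K / cmod (a w)"
      using a_nonzero[OF w] by (simp add: field_simps)
    moreover have "cmod (S w) ^ n \<le> cmod (S w) ^ Suc n" using g by (intro power_increasing) auto
    ultimately show False using n by linarith
  qed
  then show thesis using that[of \<phi>] \<phi> a_nonzero by (simp add: S_def R_def)
qed

text \<open>Neither \<open>z - c\<close> nor \<open>(u - u c) / (z - c)\<close> need have derivative \<open>0\<close> at \<open>0\<close>, so the
  factorization of \<open>u - u c\<close> is used after multiplication by \<open>z\<^sup>4\<close>:
  \<open>z\<^sup>4 (u - u c) = (z\<^sup>3 - c z\<^sup>2) (z\<^sup>2 v)\<close>. The case \<open>\<bar>c\<bar> = 1\<close> is not yet excluded, hence the larger ball.\<close>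

lemma X_evaluation:
  assumes w: "cmod w < 1" and c: "X w (\<lambda>z. z ^ 2) = a w * c ^ 2" "X w (\<lambda>z. z ^ 3) = a w * c ^ 3"
    "cmod c \<le> 1"
    and u: "u holomorphic_on ball 0 R" and R: "1 < R" and u0: "deriv u 0 = 0"
  shows "X w u = a w * u c"
proof -
  have au: "alg1 u" using bounded_on_disc_of_larger_ball[OF u R] u0 by (auto simp: alg1_def)
  define d where "d z = u z + (- u c) * 1" for z
  have ad: "alg1 d" unfolding d_def by (intro alg1_add au alg1_cmult alg1_const)
  have Xd: "X w d = X w u - u c * a w"
    unfolding d_def a_def by (simp only: X_add X_cmult au alg1_const alg1_cmult) simp
  have "X w d = 0"
  proof (cases "c = 0")
    case False
    obtain v where v: "v holomorphic_on ball 0 R" "\<And>z. u z - u c = (z - c) * v z"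
      using quotient_at_point_holomorphic[OF u] by blast
    obtain B where B: "\<And>z. cmod z < 1 \<Longrightarrow> cmod (v z) \<le> B" using bounded_on_disc_of_larger_ball[OF v(1) R] by blast
    have av: "alg1 (\<lambda>z. z\<^sup>2 * v z)" by (rule alg1_square_mult[OF bounded_on_disc_of_larger_ball(2)[OF v(1) R] B])
    define k where "k z = z ^ 3 + (- c) * z ^ 2" for z
    have ak: "alg1 k" unfolding k_def by (intro alg1_add alg1_cmult alg1_power) auto
    have "X w k = a w * c ^ 3 + (- c) * (a w * c ^ 2)"
      unfolding k_def c(1,2)[symmetric]
      using X_add[OF alg1_power[of 3] alg1_cmult[OF alg1_power[of 2], of "- c"], of w]
        X_cmult[OF alg1_power[of 2], of w "- c"] by simp
    then have "X w k = 0" by (simp add: power2_eq_square power3_eq_cube)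
    then have "X w (\<lambda>z. k z * (z\<^sup>2 * v z)) * a w = 0" using X_mult[OF w ak av] by simp
    moreover have "(\<lambda>z. k z * (z\<^sup>2 * v z)) = (\<lambda>z. z ^ 4 * d z)"
    proof
      fix z
      have "k z * (z\<^sup>2 * v z) = z ^ 4 * ((z - c) * v z)"
        by (simp add: k_def power2_eq_square power3_eq_cube power4_eq_xxxx algebra_simps)
      also have "(z - c) * v z = d z" using v(2)[of z] by (simp add: d_def)
      finally show "k z * (z\<^sup>2 * v z) = z ^ 4 * d z" .
    qed
    ultimately have "X w (\<lambda>z. z ^ 4 * d z) * a w = 0" by simp
    then have "X w (\<lambda>z. z ^ 4) * X w d = 0" using X_mult[OF w alg1_power[of 4] ad] by simp
    moreover have "X w (\<lambda>z. z ^ 4) * a w = (a w * c ^ 2) * (a w * c ^ 2)"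
      using X_power_step[OF w, of 2 2] by (simp add: c)
    then have "X w (\<lambda>z. z ^ 4) \<noteq> 0" using False a_nonzero[OF w] by auto
    ultimately show ?thesis by simp
  next
    \<comment> \<open>For \<open>c = 0\<close> the value at z^4 is 0 and cannot be cancelled.
      Instead \<open>d\<close> has a double zero, so d^2 = z^2 (z^2 v^2) is a product in the algebra
      whose first factor has value 0.\<close>
    case True
    have "deriv d 0 = 0" using ad by (simp add: alg1_def)
    moreover have dh: "d holomorphic_on ball 0 R" unfolding d_def by (intro holomorphic_intros u)
    ultimately obtain v where v: "v holomorphic_on ball 0 R" "\<And>z. d z = z\<^sup>2 * v z"
      using holomorphic_double_zero[OF dh] R True by (auto simp: d_def)
    have vv: "(\<lambda>z. v z * v z) holomorphic_on ball 0 R" by (intro holomorphic_intros v)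
    obtain B where B: "\<And>z. cmod z < 1 \<Longrightarrow> cmod (v z * v z) \<le> B" using bounded_on_disc_of_larger_ball[OF vv R] by blast
    have av: "alg1 (\<lambda>z. z\<^sup>2 * (v z * v z))" by (rule alg1_square_mult[OF bounded_on_disc_of_larger_ball(2)[OF vv R] B])
    have 0: "X w (\<lambda>z. z\<^sup>2 * (z\<^sup>2 * (v z * v z))) * a w = 0"
      using X_mult[OF w alg1_power[of 2] av] c(1) True by simp
    have "(\<lambda>z. z\<^sup>2 * (z\<^sup>2 * (v z * v z))) = (\<lambda>z. d z * d z)" by (simp only: v(2) mult_ac)
    with 0 have "X w (\<lambda>z. d z * d z) * a w = 0" by (simp only:)
    then have "X w d * X w d = 0" using X_mult[OF w ad ad] by (simp only:)
    then show ?thesis by simp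
  qed
  then show ?thesis using Xd by (simp add: mult.commute)
qed

text \<open>\<open>X w\<close> only sees bounded functions. The dilates of f / E0 are bounded, and
  E0 times them tends to f in H^p, so boundedness of \<open>T\<close> and of point evaluation
  carries the values over to all of \<open>ab\<close>.\<close>

lemma T_dilate_tendsto:
  assumes w: "cmod w < 1" and f: "f \<in> ab"
    and rr: "\<And>n. 0 < rr n" "\<And>n. rr n < 1" "rr \<longlonglongrightarrow> 1"
  shows "(\<lambda>n. X w (\<lambda>z. 1 / E0 (of_real (rr n) * z) * f (of_real (rr n) * z))) \<longlonglongrightarrow> T f w"
proof -
  define h where "h z = 1 / E0 z * f z" for z
  have h: "h \<in> hardy_space p" "h holomorphic_on ball 0 1" "deriv h 0 = 0"
    using quotient_E0[OF f] by (simp_all add: h_def[abs_def])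
  define u where "u n z = h (of_real (rr n) * z)" for n z
  have au: "alg1 (u n)" for n unfolding u_def by (rule alg1_dilate(2)[OF h(2,3) rr(1,2)])
  obtain K where K: "0 \<le> K" "\<And>f. f \<in> ab \<Longrightarrow> hardy_norm p (T f) \<le> K * hardy_norm p f"
    using T_bounded by blast
  define C where "C = 2 / (1 - cmod w) * (K * M0)"
  have est: "cmod (T f w - X w (u n)) \<le> C * hardy_norm p (\<lambda>z. h z - on_disc (u n) z)" for n
  proof -
    have un: "on_disc (u n) \<in> hardy_space p"
      unfolding u_def by (rule hardy_dilate[OF p h(1) rr(1,2)])
    define g where "g z = f z - N (u n) z" for z
    have g: "g \<in> ab" unfolding g_def by (intro ab_diff f N_in_ab au)
    have "g = (\<lambda>z. E0 z * (h z - on_disc (u n) z))"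
      using ab_outside[OF f] by (auto simp: g_def h_def N_def on_disc_def fun_eq_iff algebra_simps)
    then have "hardy_norm p g \<le> M0 * hardy_norm p (\<lambda>z. h z - on_disc (u n) z)"
      using hardy_mult_bounded(2)[OF p hardy_space_diff(1)[OF h(1) un p] E0_holomorphic E0_bound(1)] by simp
    then have "hardy_norm p (T g) \<le> K * (M0 * hardy_norm p (\<lambda>z. h z - on_disc (u n) z))"
      using K(2)[OF g] K(1) by (meson mult_left_mono order_trans)
    then have "2 / (1 - cmod w) * hardy_norm p (T g)
        \<le> 2 / (1 - cmod w) * (K * (M0 * hardy_norm p (\<lambda>z. h z - on_disc (u n) z)))"
      using w by (intro mult_left_mono) auto
    moreover have "cmod (T g w) \<le> 2 / (1 - cmod w) * hardy_norm p (T g)"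
      by (rule hardy_point_bound[OF p ab_hardy[OF T_in[OF g]] w])
    moreover have "T g w = T f w - X w (u n)"
      unfolding g_def by (simp add: T_diff f N_in_ab au X_def)
    ultimately show ?thesis by (simp add: C_def mult_ac)
  qed
  have "(\<lambda>n. C * hardy_norm p (\<lambda>z. h z - on_disc (u n) z)) \<longlonglongrightarrow> C * 0"
    unfolding u_def by (intro tendsto_mult_left hardy_dilate_tendsto[OF p h(1) rr])
  then have "(\<lambda>n. C * hardy_norm p (\<lambda>z. h z - on_disc (u n) z)) \<longlonglongrightarrow> 0" by simp
  then have "(\<lambda>n. T f w - X w (u n)) \<longlonglongrightarrow> 0"
    by (rule Lim_null_comparison[rotated]) (use est in simp)
  then have "(\<lambda>n. T f w - (T f w - X w (u n))) \<longlonglongrightarrow> T f w - 0" by (intro tendsto_diff tendsto_const)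
  then show ?thesis by (simp add: u_def[abs_def] h_def)
qed

theorem composition_form:
  obtains \<phi> where "\<phi> holomorphic_on ball 0 1" "\<And>w. cmod w < 1 \<Longrightarrow> cmod (\<phi> w) < 1"
    "\<And>f w. f \<in> ab \<Longrightarrow> cmod w < 1 \<Longrightarrow> T f w = a w * (f (\<phi> w) / E0 (\<phi> w))"
proof -
  obtain \<phi> where \<phi>: "\<phi> holomorphic_on ball 0 1"
    "\<And>w. cmod w < 1 \<Longrightarrow> X w (\<lambda>z. z ^ 2) = a w * \<phi> w ^ 2"
    "\<And>w. cmod w < 1 \<Longrightarrow> X w (\<lambda>z. z ^ 3) = a w * \<phi> w ^ 3"
    "\<And>w. cmod w < 1 \<Longrightarrow> cmod (\<phi> w) \<le> 1"
    using evaluation_point by blast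
  obtain rr :: "nat \<Rightarrow> real" where rr: "\<And>n. 0 < rr n" "\<And>n. rr n < 1" and rrlim: "rr \<longlonglongrightarrow> 1"
    using dilation_radii[OF zero_less_one] by blast
  have lim: "(\<lambda>n. a w * (1 / E0 (of_real (rr n) * \<phi> w) * f (of_real (rr n) * \<phi> w))) \<longlonglongrightarrow> T f w"
    if f: "f \<in> ab" and w: "cmod w < 1" for f w
  proof -
    define h where "h z = 1 / E0 z * f z" for z
    have h: "h holomorphic_on ball 0 1" "deriv h 0 = 0"
      using quotient_E0[OF f] by (simp_all add: h_def[abs_def])
    have "X w (\<lambda>z. h (of_real (rr n) * z)) = a w * h (of_real (rr n) * \<phi> w)" for n
      by (rule X_evaluation[OF w \<phi>(2-4)[OF w] holomorphic_on_dilate(1)[OF h(1)] _ alg1_dilate(1)[OF h]])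
        (use rr[of n] in auto)
    then show ?thesis using T_dilate_tendsto[OF w f rr rrlim] by (simp add: h_def)
  qed
  have lt: "cmod (\<phi> w) < 1" if w: "cmod w < 1" for w
  proof (rule ccontr)
    assume "\<not> cmod (\<phi> w) < 1"
    then have "cmod (\<phi> w) = 1" using \<phi>(4)[OF w] by simp
    then have "\<phi> constant_on ball 0 1"
      using maximum_modulus_principle[OF \<phi>(1) open_ball connected_ball open_ball order_refl, of w] \<phi>(4) w by simp
    then obtain c where c: "\<And>z. cmod z < 1 \<Longrightarrow> \<phi> z = c" by (auto simp: constant_on_def)
    \<comment> \<open>\<open>f\<close> has no meaningful value at the boundary point
      \<open>c\<close>, but the limits show that every \<open>T f\<close> is a multiple of
      \<open>a\<close>. Surjectivity contradicts this: the function E0 z^2 vanishes at 0 but not at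
      1/2.\<close>
    have proportional: "T f z * a 0 = T f 0 * a z" if f: "f \<in> ab" and z: "cmod z < 1" for f z
    proof (rule LIMSEQ_unique)
      show "(\<lambda>n. a z * (1 / E0 (of_real (rr n) * c) * f (of_real (rr n) * c)) * a 0) \<longlonglongrightarrow> T f z * a 0"
        using lim[OF f z] by (intro tendsto_mult_right) (simp add: c z)
      have "(\<lambda>n. a 0 * (1 / E0 (of_real (rr n) * c) * f (of_real (rr n) * c)) * a z) \<longlonglongrightarrow> T f 0 * a z"
        using lim[OF f, of 0] by (intro tendsto_mult_right) (simp add: c)
      then show "(\<lambda>n. a z * (1 / E0 (of_real (rr n) * c) * f (of_real (rr n) * c)) * a 0) \<longlonglongrightarrow> T f 0 * a z"
        by (simp add: mult_ac)
    qed
    obtain f where f: "f \<in> ab" "T f = N (\<lambda>z. z ^ 2)"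
      using surj N_in_ab[OF alg1_power[of 2]] by (metis imageE order_refl)
    have "T f (1/2) * a 0 = T f 0 * a (1/2)" by (rule proportional[OF f(1)]) simp
    then show False using a_nonzero[of 0] by (simp add: f(2) N_def)
  qed
  have "T f w = a w * (f (\<phi> w) / E0 (\<phi> w))" if f: "f \<in> ab" and w: "cmod w < 1" for f w
  proof (rule LIMSEQ_unique[OF lim[OF f w]])
    have "isCont (\<lambda>z. 1 / E0 z * f z) (\<phi> w)"
      using continuous_on_interior[OF holomorphic_on_imp_continuous_on[OF quotient_E0(2)[OF f]], of "\<phi> w"] lt[OF w]
      by simp
    moreover have "(\<lambda>n. of_real (rr n) * \<phi> w) \<longlonglongrightarrow> of_real 1 * \<phi> w" by (intro tendsto_intros rrlim)
    then have "(\<lambda>n. of_real (rr n) * \<phi> w) \<longlonglongrightarrow> \<phi> w" by simp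
    ultimately have "(\<lambda>n. 1 / E0 (of_real (rr n) * \<phi> w) * f (of_real (rr n) * \<phi> w)) \<longlonglongrightarrow> 1 / E0 (\<phi> w) * f (\<phi> w)"
      by (rule isCont_tendsto_compose)
    then show "(\<lambda>n. a w * (1 / E0 (of_real (rr n) * \<phi> w) * f (of_real (rr n) * \<phi> w))) \<longlonglongrightarrow> a w * (f (\<phi> w) / E0 (\<phi> w))"
      by (intro tendsto_mult_left) simp
  qed
  then show thesis using that[of \<phi>] \<phi>(1) lt by blast
qed

end

section \<open>The symbol is a rotation\<close>

text \<open>If \<open>F\<close> vanishes at \<open>b\<close> to order m, a root of order m + 1 also
  vanishes there, and its power then vanishes to order at least m + 1.\<close>

lemma no_roots_of_all_orders:
  assumes F: "F holomorphic_on S" and S: "open S" "connected S" and b: "b \<in> S" "F b = 0"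
    and nc: "\<not> F constant_on S"
    and root: "\<And>n. 0 < n \<Longrightarrow> \<exists>s. s holomorphic_on S \<and> (\<forall>z\<in>S. s z ^ n = F z)"
  shows False
proof -
  obtain g r m where g: "0 < m" "0 < r" "ball b r \<subseteq> S" "g holomorphic_on ball b r"
    "\<And>w. w \<in> ball b r \<Longrightarrow> F w = (w - b) ^ m * g w" "\<And>w. w \<in> ball b r \<Longrightarrow> g w \<noteq> 0"
    using holomorphic_factor_zero_nonconstant[OF F S b nc] by metis
  obtain s where s: "s holomorphic_on S" "\<And>z. z \<in> S \<Longrightarrow> s z ^ Suc m = F z"
    using root[of "Suc m"] by auto
  have "s b = 0" using s(2)[OF b(1)] b(2) by (simp del: power_Suc)
  then obtain k where k: "k holomorphic_on S" "\<And>z. s z = (z - b) * k z"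
    using quotient_at_point_holomorphic[OF s(1) S(1), of b] by auto
  \<comment> \<open>Off \<open>b\<close> the factor (z - b)^m can be cancelled; continuation carries
    the identity to \<open>b\<close>, where the right side is 0 and \<open>g\<close> is not.\<close>
  have "g b = (b - b) * k b ^ Suc m"
  proof (rule analytic_continuation_open[of "ball b r - {b}" "ball b r" g "\<lambda>z. (z - b) * k z ^ Suc m"])
    show "ball b r - {b} \<noteq> {}"
    proof -
      have "b + of_real (r / 2) \<in> ball b r - {b}" using g(2) by (simp add: dist_norm norm_divide)
      then show ?thesis by blast
    qed
    show "(\<lambda>z. (z - b) * k z ^ Suc m) holomorphic_on ball b r"
      by (intro holomorphic_intros holomorphic_on_subset[OF k(1) g(3)])
    fix z assume z: "z \<in> ball b r - {b}"
    have "(z - b) ^ m * g z = s z ^ Suc m" using z g(3,5) s(2) by (metis DiffD1 subsetD)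
    also have "\<dots> = (z - b) ^ m * ((z - b) * k z ^ Suc m)" by (simp add: k(2) power_mult_distrib mult_ac)
    finally show "g z = (z - b) * k z ^ Suc m" using z by simp
  qed (use g in auto)
  then show False using g(6)[of b] g(2) by simp
qed

context nonvanishing_operator
begin

section \<open>Inverting the symbol by pulling back along the surjection \<open>T\<close>\<close>

lemma a_eq: "T (N (\<lambda>_. 1)) w = a w"
  by (simp add: a_def X_def)

lemma a_holomorphic: "a holomorphic_on ball 0 1"
  using X_holomorphic[OF alg1_const[of 1]] by (simp add: a_def[abs_def])

text \<open>\<open>ab\<close> is closed under multiplication by the algebra, so surjectivity writes
  u times \<open>T (N 1)\<close> as some \<open>T f\<close>. Cancelling the zero-free
  \<open>a\<close> leaves u as f / E0 composed with \<open>\<phi>\<close>.\<close>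

lemma pull_back:
  assumes u: "alg1 u"
    and T: "\<And>f w. f \<in> ab \<Longrightarrow> cmod w < 1 \<Longrightarrow> T f w = a w * (f (\<phi> w) / E0 (\<phi> w))"
  obtains q where "q holomorphic_on ball 0 1" "\<And>w. cmod w < 1 \<Longrightarrow> q (\<phi> w) = u w"
proof -
  have "(\<lambda>z. u z * T (N (\<lambda>_. 1)) z) \<in> T ` ab"
    unfolding surj by (intro ab_mult T_in N_one u)
  then obtain f where f: "f \<in> ab" "T f = (\<lambda>z. u z * T (N (\<lambda>_. 1)) z)" by auto
  have "1 / E0 (\<phi> w) * f (\<phi> w) = u w" if w: "cmod w < 1" for w
  proof -
    have "a w * (f (\<phi> w) / E0 (\<phi> w)) = a w * u w" using T[OF f(1) w, symmetric] unfolding f(2) a_eq by (simp only: mult.commute)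
    then have "f (\<phi> w) / E0 (\<phi> w) = u w" using a_nonzero[OF w] by (simp only: mult_cancel_left) simp
    then show ?thesis by simp
  qed
  then show thesis using that[OF quotient_E0(2)[OF f(1)]] by simp
qed

text \<open>\<open>\<zeta> - z\<^sup>2\<close> has no zero in the disc, so it has a logarithm, which
  inherits derivative 0 at 0. The root is bounded because a modulus above 1 is at most its n-th
  power. The square stands in for z, which is not in the algebra.\<close>

lemma root_of_translated_square:
  fixes \<zeta> :: complex
  assumes \<zeta>: "1 \<le> cmod \<zeta>" and n: "0 < n"
  obtains H where "alg1 H" "\<And>z. cmod z < 1 \<Longrightarrow> H z ^ n = \<zeta> - z\<^sup>2"
proof -
  have nz: "\<zeta> - z\<^sup>2 \<noteq> 0" if "z \<in> ball 0 1" for z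
  proof
    assume "\<zeta> - z\<^sup>2 = 0"
    then have "cmod \<zeta> = (cmod z)\<^sup>2" by (simp add: norm_power)
    moreover have "(cmod z)\<^sup>2 < 1" using that by (simp add: power_less_one_iff)
    ultimately show False using \<zeta> by simp
  qed
  have "(\<lambda>z. \<zeta> - z\<^sup>2) holomorphic_on ball 0 1" by (intro holomorphic_intros)
  from contractible_imp_holomorphic_log[OF this convex_imp_contractible[OF convex_ball] nz]
  obtain L where L: "L holomorphic_on ball 0 1" "\<And>z. z \<in> ball 0 1 \<Longrightarrow> \<zeta> - z\<^sup>2 = exp (L z)" by metis
  define H where "H z = exp (L z / of_nat n)" for z
  have pw: "H z ^ n = \<zeta> - z\<^sup>2" if "cmod z < 1" for z
    using L(2)[of z] that n by (simp add: H_def flip: exp_of_nat_mult)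
  have "((\<lambda>z. exp (L z)) has_field_derivative exp (L 0) * deriv L 0) (at 0)"
    by (auto intro!: derivative_eq_intros DERIV_deriv_at_0[OF L(1)])
  moreover have "((\<lambda>z. exp (L z)) has_field_derivative 0) (at 0)"
  proof (rule has_field_derivative_transform_within_open[of "\<lambda>z. \<zeta> - z\<^sup>2" 0 0 "ball 0 1"])
    show "((\<lambda>z. \<zeta> - z\<^sup>2) has_field_derivative 0) (at 0)" by (auto intro!: derivative_eq_intros)
  qed (use L(2) in auto)
  ultimately have "exp (L 0) * deriv L 0 = 0" by (rule DERIV_unique)
  then have L0: "(L has_field_derivative 0) (at 0)" using DERIV_deriv_at_0[OF L(1)] by simp
  have "alg1 H"
  proof (rule alg1I)
    show "H holomorphic_on ball 0 1" unfolding H_def by (intro holomorphic_intros L) (use n in auto)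
    show "(H has_field_derivative 0) (at 0)"
      unfolding H_def using n by (auto intro!: derivative_eq_intros L0)
    show "cmod (H z) \<le> cmod \<zeta> + 1" if z: "cmod z < 1" for z
    proof (rule ccontr)
      assume "\<not> cmod (H z) \<le> cmod \<zeta> + 1"
      then have g: "cmod \<zeta> + 1 < cmod (H z)" by simp
      have "cmod (H z) ^ 1 \<le> cmod (H z) ^ n" using g \<zeta> n by (intro power_increasing) auto
      also have "\<dots> = cmod (\<zeta> - z\<^sup>2)" by (simp add: pw[OF z] flip: norm_power)
      also have "\<dots> \<le> cmod \<zeta> + (cmod z)\<^sup>2" using norm_triangle_ineq4[of \<zeta> "z\<^sup>2"] by (simp add: norm_power)
      also have "(cmod z)\<^sup>2 \<le> 1" using z by (simp add: power_le_one)
      finally show False using g by simp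
    qed
  qed
  then show thesis using that pw by blast
qed

theorem rotation_form:
  obtains \<mu> where "cmod \<mu> = 1"
    "\<And>f w. f \<in> ab \<Longrightarrow> cmod w < 1 \<Longrightarrow> T f w = a w * (f (\<mu> * w) / E0 (\<mu> * w))"
proof -
  obtain \<phi> where \<phi>: "\<phi> holomorphic_on ball 0 1" "\<And>w. cmod w < 1 \<Longrightarrow> cmod (\<phi> w) < 1"
    and T: "\<And>f w. f \<in> ab \<Longrightarrow> cmod w < 1 \<Longrightarrow> T f w = a w * (f (\<phi> w) / E0 (\<phi> w))"
    using composition_form by blast
  obtain q2 where q2: "q2 holomorphic_on ball 0 1" "\<And>w. cmod w < 1 \<Longrightarrow> q2 (\<phi> w) = w ^ 2"
    using pull_back[OF alg1_power[of 2] T] by auto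
  obtain q3 where q3: "q3 holomorphic_on ball 0 1" "\<And>w. cmod w < 1 \<Longrightarrow> q3 (\<phi> w) = w ^ 3"
    using pull_back[OF alg1_power[of 3] T] by auto
  have nc: "\<not> \<phi> constant_on ball 0 1"
  proof
    assume "\<phi> constant_on ball 0 1"
    then have "\<phi> 0 = \<phi> (1/2)" by (auto simp: constant_on_def)
    then show False using q2(2)[of 0] q2(2)[of "1/2"] by (simp add: power2_eq_square)
  qed
  have op: "open (\<phi> ` ball 0 1)"
    by (rule open_mapping_thm[OF \<phi>(1) open_ball connected_ball open_ball order_refl nc])
  \<comment> \<open>Pulled-back identities are known only on the image of \<open>\<phi>\<close>. The
    image is open, so the identity theorem extends them to the disc.\<close>
  have ident: "g z = h z" if "g holomorphic_on ball 0 1" "h holomorphic_on ball 0 1"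
    "\<And>w. cmod w < 1 \<Longrightarrow> g (\<phi> w) = h (\<phi> w)" "z \<in> ball 0 1" for g h z
    by (rule analytic_continuation_open[OF op open_ball _ connected_ball _ that(1,2) _ that(4)])
      (use that(3) \<phi>(2) in auto)
  have "q2 z ^ 3 = q3 z ^ 2" if "z \<in> ball 0 1" for z
    by (rule ident[OF _ _ _ that]) (auto intro!: holomorphic_intros q2(1) q3(1) simp: q2(2) q3(2) simp flip: power_mult)
  from cusp_parametrization[OF open_ball connected_ball q2(1) q3(1) this]
  obtain \<kappa> where \<kappa>: "\<kappa> holomorphic_on ball 0 1" "\<And>z. z \<in> ball 0 1 \<Longrightarrow> \<kappa> z ^ 2 = q2 z"
    "\<And>z. z \<in> ball 0 1 \<Longrightarrow> \<kappa> z ^ 3 = q3 z" by metis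
  \<comment> \<open>Square and cube together determine a complex number.\<close>
  have \<kappa>\<phi>: "\<kappa> (\<phi> w) = w" if w: "cmod w < 1" for w
  proof -
    have 2: "\<kappa> (\<phi> w) ^ 2 = w ^ 2" and 3: "\<kappa> (\<phi> w) ^ 3 = w ^ 3"
      using \<kappa>(2,3)[of "\<phi> w"] q2(2) q3(2) \<phi>(2) w by auto
    show ?thesis
    proof (cases "w = 0")
      case False
      have "\<kappa> (\<phi> w) * w ^ 2 = w * w ^ 2" using 3 unfolding 2[symmetric] by (metis 2 power2_eq_square power3_eq_cube mult.assoc)
      then show ?thesis using False by simp
    qed (use 2 in simp)
  qed
  \<comment> \<open>For \<open>\<zeta> = q2 b\<close> off the disc, every root of \<open>\<zeta> - z\<^sup>2\<close> is bounded and hence pulls back to a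
      holomorphic root of \<open>\<zeta> - q2\<close>, which vanishes at \<open>b\<close>.\<close>
  have q2lt: "cmod (q2 b) < 1" if b: "cmod b < 1" for b
  proof (rule ccontr)
    assume "\<not> cmod (q2 b) < 1"
    then have \<zeta>: "1 \<le> cmod (q2 b)" by simp
    define F where "F z = q2 b - q2 z" for z
    show False
    proof (rule no_roots_of_all_orders[of F "ball 0 1" b])
      show F: "F holomorphic_on ball 0 1" unfolding F_def by (intro holomorphic_intros q2)
      show "\<not> F constant_on ball 0 1"
      proof
        assume "F constant_on ball 0 1"
        then have "F (\<phi> 0) = F (\<phi> (1/2))" using \<phi>(2)[of 0] \<phi>(2)[of "1/2"] by (auto simp: constant_on_def)
        then show False using q2(2)[of 0] q2(2)[of "1/2"] by (simp add: F_def power2_eq_square)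
      qed
      fix n :: nat assume n: "0 < n"
      obtain H where H: "alg1 H" "\<And>z. cmod z < 1 \<Longrightarrow> H z ^ n = q2 b - z\<^sup>2"
        using root_of_translated_square[OF \<zeta> n] by blast
      obtain s where s: "s holomorphic_on ball 0 1" "\<And>w. cmod w < 1 \<Longrightarrow> s (\<phi> w) = H w"
        using pull_back[OF H(1) T] by blast
      have "s z ^ n = F z" if "z \<in> ball 0 1" for z
        by (rule ident[OF _ F _ that]) (auto intro!: holomorphic_intros s(1) simp: s(2) H(2) F_def q2(2))
      then show "\<exists>s. s holomorphic_on ball 0 1 \<and> (\<forall>z\<in>ball 0 1. s z ^ n = F z)" using s(1) by blast
    qed (use b in \<open>auto simp: F_def\<close>)
  qed
  have \<kappa>lt: "cmod (\<kappa> z) < 1" if z: "cmod z < 1" for z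
  proof -
    have "(cmod (\<kappa> z))\<^sup>2 < 1" using q2lt[OF z] \<kappa>(2)[of z] z by (simp flip: norm_power)
    then show ?thesis using power_less_imp_less_base[of "cmod (\<kappa> z)" 2 1] by simp
  qed
  have \<phi>0: "\<phi> 0 = 0"
  proof (rule ccontr)
    assume w0: "\<phi> 0 \<noteq> 0"
    define c where "c = \<phi> 0"
    \<comment> \<open>An element of the algebra with a simple zero at \<open>c = \<phi> 0\<close>.
      Its image under \<open>T\<close> vanishes at 0, so by the constraint its derivative does too;
      that forces \<open>deriv \<phi> 0 = 0\<close>, which the left inverse \<open>\<kappa>\<close>
      forbids.\<close>
    define u where "u z = z\<^sup>2 * (z - c)" for z
    have c1: "cmod c < 1" using \<phi>(2)[of 0] by (simp add: c_def)
    have au: "alg1 u" unfolding u_def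
    proof (rule alg1_square_mult)
      show "cmod (z - c) \<le> 2" if "cmod z < 1" for z
        using norm_triangle_ineq4[of z c] that c1 by simp
    qed (intro holomorphic_intros)
    define F where "F = T (N u)"
    have Fab: "F \<in> ab" unfolding F_def by (intro T_in N_in_ab au)
    have F: "F w = a w * u (\<phi> w)" if "cmod w < 1" for w
      using T[OF N_in_ab[OF au] that] \<phi>(2)[OF that] by (simp add: F_def N_def)
    have "F 0 = 0" using F[of 0] by (simp add: u_def c_def)
    then have F': "deriv F 0 = 0" using Fab \<alpha> by (simp add: ab_iff)
    have d\<phi>: "(\<phi> has_field_derivative deriv \<phi> 0) (at 0)" by (rule DERIV_deriv_at_0[OF \<phi>(1)])
    have du: "(u has_field_derivative c\<^sup>2) (at (\<phi> 0))"
      unfolding u_def c_def[symmetric] by (auto intro!: derivative_eq_intros)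
    have "((\<lambda>w. u (\<phi> w)) has_field_derivative c\<^sup>2 * deriv \<phi> 0) (at 0)" by (rule DERIV_chain2[OF du d\<phi>])
    then have "((\<lambda>w. a w * u (\<phi> w)) has_field_derivative deriv a 0 * u (\<phi> 0) + c\<^sup>2 * deriv \<phi> 0 * a 0) (at 0)"
      by (intro DERIV_mult DERIV_deriv_at_0 a_holomorphic)
    moreover have "u (\<phi> 0) = 0" by (simp add: u_def c_def)
    ultimately have "((\<lambda>w. a w * u (\<phi> w)) has_field_derivative c\<^sup>2 * deriv \<phi> 0 * a 0) (at 0)" by simp
    then have "(F has_field_derivative c\<^sup>2 * deriv \<phi> 0 * a 0) (at 0)"
      by (rule has_field_derivative_transform_within_open[of _ _ 0 "ball 0 1"]) (use F in auto)
    then have "c\<^sup>2 * deriv \<phi> 0 * a 0 = 0" using F' DERIV_imp_deriv by fastforce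
    then have "deriv \<phi> 0 = 0" using w0 a_nonzero[of 0] by (simp add: c_def)
    moreover have "((\<lambda>w. \<kappa> (\<phi> w)) has_field_derivative deriv \<kappa> (\<phi> 0) * deriv \<phi> 0) (at 0)"
      by (rule DERIV_chain2[OF _ d\<phi>]) (rule holomorphic_derivI[OF \<kappa>(1) open_ball], use c1 c_def in simp)
    moreover have "((\<lambda>w. \<kappa> (\<phi> w)) has_field_derivative 1) (at 0)"
      by (rule has_field_derivative_transform_within_open[of "\<lambda>w. w" _ 0 "ball 0 1"]) (use \<kappa>\<phi> in auto)
    ultimately show False using DERIV_unique by fastforce
  qed
  have \<kappa>0: "\<kappa> 0 = 0" using \<kappa>\<phi>[of 0] \<phi>0 by simp
  \<comment> \<open>The Schwarz lemma for \<open>\<phi>\<close> gives one inequality and for its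
    left inverse \<open>\<kappa>\<close> the other; equality at one point makes
    \<open>\<phi>\<close> a rotation.\<close>
  have eq: "cmod (\<phi> (1/2)) = cmod (1/2)"
  proof (rule antisym)
    show "cmod (\<phi> (1/2)) \<le> cmod (1/2)" by (rule Schwarz_Lemma(1)[OF \<phi>(1) \<phi>0 \<phi>(2)]) auto
    have "cmod (\<kappa> (\<phi> (1/2))) \<le> cmod (\<phi> (1/2))"
      by (rule Schwarz_Lemma(1)[OF \<kappa>(1) \<kappa>0 \<kappa>lt]) (use \<phi>(2)[of "1/2"] in auto)
    then show "cmod (1/2) \<le> cmod (\<phi> (1/2))" using \<kappa>\<phi>[of "1/2"] by simp
  qed
  have "\<exists>\<mu>. (\<forall>z. cmod z < 1 \<longrightarrow> \<phi> z = \<mu> * z) \<and> cmod \<mu> = 1"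
    by (rule Schwarz_Lemma(3)[OF \<phi>(1) \<phi>0 \<phi>(2), of 0]) (use eq in \<open>auto intro!: exI[of _ "1/2"]\<close>)
  then obtain \<mu> where "cmod \<mu> = 1" "\<And>z. cmod z < 1 \<Longrightarrow> \<phi> z = \<mu> * z" by blast
  then show thesis using that[of \<mu>] T by simp
qed

end

section \<open>Multipliers of Hardy spaces are bounded\<close>

lemma hardy_norm_add:
  assumes "1 \<le> p" "f \<in> hardy_space p" "g \<in> hardy_space p"
  shows "hardy_norm p (\<lambda>z. f z + g z) \<le> hardy_norm p f + hardy_norm p g"
  using hardy_space_diff(2)[OF assms(2) hardy_cmult(1)[OF assms(1,3), of "-1"] assms(1)]
    hardy_cmult(2)[OF assms(1,3), of "-1"] by simp

text \<open>The norm of the functional F -> F z on H^p.\<close>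

definition evaluation_norm :: "real \<Rightarrow> complex \<Rightarrow> real" where
  "evaluation_norm p z = (SUP F\<in>{F \<in> hardy_space p. hardy_norm p F \<le> 1}. cmod (F z))"

lemma evaluation_norm_bdd:
  assumes p: "1 \<le> p" and z: "cmod z < 1"
  shows "bdd_above ((\<lambda>F. cmod (F z)) ` {F \<in> hardy_space p. hardy_norm p F \<le> 1})"
proof (rule bdd_aboveI2)
  fix F assume F: "F \<in> {F \<in> hardy_space p. hardy_norm p F \<le> 1}"
  have "cmod (F z) \<le> 2 / (1 - cmod z) * hardy_norm p F" using F by (intro hardy_point_bound[OF p _ z]) auto
  also have "\<dots> \<le> 2 / (1 - cmod z) * 1" using F z by (intro mult_left_mono) auto
  finally show "cmod (F z) \<le> 2 / (1 - cmod z) * 1" .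
qed

lemma evaluation_norm_pos:
  assumes p: "1 \<le> p" and z: "cmod z < 1"
  shows "0 < evaluation_norm p z"
proof -
  have "cmod (on_disc (\<lambda>_. 1) z) \<le> evaluation_norm p z"
    unfolding evaluation_norm_def
    by (rule cSUP_upper[OF _ evaluation_norm_bdd[OF p z]])
      (use hardy_bounded[OF p, of "\<lambda>_. 1" 1] in auto)
  then show ?thesis using z by simp
qed

lemma evaluation_le_norm:
  assumes p: "1 \<le> p" and z: "cmod z < 1" and F: "F \<in> hardy_space p"
  shows "cmod (F z) \<le> evaluation_norm p z * hardy_norm p F"
proof (cases "hardy_norm p F = 0")
  case True
  then show ?thesis using hardy_norm_eq_0[OF F p] by simp
next
  case False
  then have n: "0 < hardy_norm p F" using hardy_norm_nonneg[of p F] by simp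
  define c where "c = 1 / hardy_norm p F"
  have c: "0 < c" "c * hardy_norm p F = 1" using n by (auto simp: c_def)
  have "hardy_norm p (\<lambda>z. of_real c * F z) \<le> 1" using hardy_cmult(2)[OF p F, of "of_real c"] c by simp
  then have "cmod (of_real c * F z) \<le> evaluation_norm p z"
    unfolding evaluation_norm_def
    by (intro cSUP_upper2[OF evaluation_norm_bdd[OF p z], of "\<lambda>z. of_real c * F z"])
      (use hardy_cmult(1)[OF p F] in auto)
  then have "c * cmod (F z) \<le> evaluation_norm p z" using c by (simp add: norm_mult)
  then show ?thesis using n by (simp add: c_def field_simps)
qed

lemma evaluation_norm_attained:
  assumes p: "1 \<le> p" and z: "cmod z < 1"
  obtains F where "F \<in> hardy_space p" "hardy_norm p F \<le> 1" "3/4 * evaluation_norm p z \<le> cmod (F z)"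
proof -
  have ne: "{F \<in> hardy_space p. hardy_norm p F \<le> 1} \<noteq> {}"
    using hardy_bounded[OF p, of "\<lambda>_. 1" 1] by auto
  have "3/4 * evaluation_norm p z < (SUP F\<in>{F \<in> hardy_space p. hardy_norm p F \<le> 1}. cmod (F z))"
    using evaluation_norm_pos[OF p z] by (simp add: evaluation_norm_def[symmetric])
  then obtain F where "F \<in> {F \<in> hardy_space p. hardy_norm p F \<le> 1}" "3/4 * evaluation_norm p z < cmod (F z)"
    using less_cSUP_iff[OF ne evaluation_norm_bdd[OF p z]] by blast
  then show thesis using that[of F] by simp
qed

lemma larger_of_sum_and_difference:
  fixes a b :: complex
  shows "cmod b \<le> cmod (a + b) \<or> cmod b \<le> cmod (a + (-1) * b)"
proof (rule ccontr)
  assume "\<not> (cmod b \<le> cmod (a + b) \<or> cmod b \<le> cmod (a + (-1) * b))"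
  then have "cmod (a + b) + cmod (a - b) < 2 * cmod b" by simp
  moreover have "(a + b) - (a - b) = 2 * b" by simp
  then have "2 * cmod b = cmod ((a + b) - (a - b))" by (simp only: norm_mult norm_numeral)
  ultimately show False using norm_triangle_ineq4[of "a + b" "a - b"] by linarith
qed

text \<open>A gliding hump. The signs in \<open>\<Sum> \<plusminus>3\<^sup>-\<^sup>n g n\<close> are chosen so that the \<open>n\<close>-th partial sum is
  large at \<open>\<zeta> n\<close>; the remaining terms are too small to cancel it.\<close>

lemma gliding_hump:
  assumes p: "1 \<le> p" and \<zeta>: "\<And>n. cmod (\<zeta> n) < 1"
  obtains F where "F \<in> hardy_space p"
    "\<And>n. (1/3) ^ n * evaluation_norm p (\<zeta> n) / 4 \<le> cmod (F (\<zeta> n))"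
proof -
  define e where "e = evaluation_norm p"
  have e0: "0 < e z" if "cmod z < 1" for z using evaluation_norm_pos[OF p that] by (simp add: e_def)
  have "\<exists>g. \<forall>n. g n \<in> hardy_space p \<and> hardy_norm p (g n) \<le> 1 \<and> 3/4 * e (\<zeta> n) \<le> cmod (g n (\<zeta> n))"
    by (rule choice) (use evaluation_norm_attained[OF p \<zeta>] e_def in metis)
  then obtain g where g: "\<And>n. g n \<in> hardy_space p" "\<And>n. hardy_norm p (g n) \<le> 1"
    "\<And>n. 3/4 * e (\<zeta> n) \<le> cmod (g n (\<zeta> n))" by blast
  \<comment> \<open>With ratio 1/3 all later weights sum to half of the n-th one, less than the 3/4
    that the n-th hump guarantees.\<close>
  define t :: "nat \<Rightarrow> complex" where "t n = of_real ((1/3) ^ n)" for n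
  have t: "cmod (t n) = (1/3) ^ n" for n unfolding t_def norm_of_real by simp
  \<comment> \<open>The signs are found recursively: one of the two choices makes the next partial
    sum at \<open>\<zeta> n\<close> at least as large as the new term alone, whatever the earlier
    terms contribute.\<close>
  have "\<exists>f. \<forall>n. f n \<in> hardy_space p \<and>
    ((\<exists>s. cmod s = 1 \<and> f (Suc n) = (\<lambda>z. f n z + (s * t n) * g n z)) \<and>
      cmod (t n * g n (\<zeta> n)) \<le> cmod (f (Suc n) (\<zeta> n)))"
  proof (rule dependent_nat_choice)
    show "\<exists>x. x \<in> hardy_space p" using g(1) by blast
    fix x n assume x: "x \<in> hardy_space p"
    have H: "(\<lambda>z. x z + (s * t n) * g n z) \<in> hardy_space p" for s
      by (intro hardy_add hardy_cmult(1) p x g)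
    have "\<exists>s. cmod s = 1 \<and> cmod (t n * g n (\<zeta> n)) \<le> cmod (x (\<zeta> n) + (s * t n) * g n (\<zeta> n))"
      using larger_of_sum_and_difference[of "t n * g n (\<zeta> n)" "x (\<zeta> n)"]
    proof
      assume "cmod (t n * g n (\<zeta> n)) \<le> cmod (x (\<zeta> n) + t n * g n (\<zeta> n))"
      then show ?thesis by (intro exI[of _ 1]) simp
    next
      assume "cmod (t n * g n (\<zeta> n)) \<le> cmod (x (\<zeta> n) + (-1) * (t n * g n (\<zeta> n)))"
      then show ?thesis by (intro exI[of _ "-1"]) simp
    qed
    then show "\<exists>y. y \<in> hardy_space p \<and> ((\<exists>s. cmod s = 1 \<and> y = (\<lambda>z. x z + (s * t n) * g n z)) \<and>
        cmod (t n * g n (\<zeta> n)) \<le> cmod (y (\<zeta> n)))" using H by blast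
  qed
  then obtain x where x: "\<And>n. x n \<in> hardy_space p"
    "\<And>n. \<exists>s. cmod s = 1 \<and> x (Suc n) = (\<lambda>z. x n z + (s * t n) * g n z)"
    "\<And>n. cmod (t n * g n (\<zeta> n)) \<le> cmod (x (Suc n) (\<zeta> n))" by metis
  have step: "\<exists>h. h \<in> hardy_space p \<and> hardy_norm p h \<le> (1/3) ^ n \<and> x (Suc n) = (\<lambda>z. x n z + h z)" for n
  proof -
    obtain s where s: "cmod s = 1" "x (Suc n) = (\<lambda>z. x n z + (s * t n) * g n z)" using x(2) by blast
    have "hardy_norm p (\<lambda>z. (s * t n) * g n z) \<le> (1/3) ^ n * hardy_norm p (g n)"
      using hardy_cmult(2)[OF p g(1), of "s * t n" n] s(1) t by (simp add: norm_mult)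
    also have "\<dots> \<le> (1/3) ^ n * 1" by (intro mult_left_mono g) simp
    finally show ?thesis using hardy_cmult(1)[OF p g(1)] s(2) by fastforce
  qed
  have nx: "hardy_norm p (x n) \<le> hardy_norm p (x 0) + 3/2 * (1 - (1/3) ^ n)" for n
  proof (induction n)
    case (Suc n)
    obtain h where h: "h \<in> hardy_space p" "hardy_norm p h \<le> (1/3) ^ n" "x (Suc n) = (\<lambda>z. x n z + h z)"
      using step by blast
    have "hardy_norm p (x (Suc n)) \<le> hardy_norm p (x n) + hardy_norm p h"
      unfolding h(3) by (rule hardy_norm_add[OF p x(1) h(1)])
    then show ?case using Suc.IH h(2) by (simp add: algebra_simps)
  qed simp
  \<comment> \<open>3/2 is the sum of all weights (1/3)^n.\<close>
  define C where "C = hardy_norm p (x 0) + 3/2"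
  have nC: "hardy_norm p (x n) \<le> C" for n
  proof -
    have "3/2 * (1 - (1/3::real) ^ n) \<le> 3/2" by simp
    then show ?thesis using nx[of n] unfolding C_def by linarith
  qed
  have ci: "circle_integral p (x n) r \<le> 2 * pi * C powr p" if "0 < r" "r < 1" for n r
  proof -
    have "circle_integral p (x n) r \<le> 2 * pi * hardy_norm p (x n) powr p"
      by (rule circle_integral_le_hardy_norm[OF p x(1) that])
    also have "\<dots> \<le> 2 * pi * C powr p"
      using p by (intro mult_left_mono powr_mono2 nC hardy_norm_nonneg) auto
    finally show ?thesis .
  qed
  \<comment> \<open>The partial sums are bounded in norm, so a locally convergent subsequence
    supplies the limit, together with its membership in H^p.\<close>
  obtain F s where F: "F holomorphic_on ball 0 1" "strict_mono (s :: nat \<Rightarrow> nat)"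
    "\<And>z. z \<in> ball 0 1 \<Longrightarrow> (\<lambda>n. x (s n) z) \<longlonglongrightarrow> F z"
    "\<And>r. 0 < r \<Longrightarrow> r < 1 \<Longrightarrow> circle_integral p F r \<le> 2 * pi * C powr p"
    by (rule circle_bounded_subsequence[of x, OF hardy_space_holomorphic[OF x(1)] p ci]) auto
  have "circle_integral p (on_disc F) r \<le> 2 * pi * C powr p" if "0 < r" "r < 1" for r
  proof -
    have "circle_integral p (on_disc F) r = circle_integral p F r"
      using that by (intro circle_integral_cong) auto
    then show ?thesis using F(4)[OF that] by simp
  qed
  then have "on_disc F \<in> hardy_space p" by (rule hardy_spaceI[OF p on_disc_holomorphic[OF F(1)]])
  moreover have "(1/3) ^ n * evaluation_norm p (\<zeta> n) / 4 \<le> cmod (on_disc F (\<zeta> n))" for n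
  proof -
    define w where "w = \<zeta> n"
    have w: "cmod w < 1" using \<zeta> by (simp add: w_def)
    \<comment> \<open>The terms after the n-th change the value at \<open>w\<close> by at most 1/2
      of (1/3)^n \<open>e w\<close>. Against the 3/4 of the hump this leaves the 1/4 of the
      statement.\<close>
    have tail: "cmod (x (Suc n + j) w - x (Suc n) w) \<le> (1 - (1/3) ^ j) / 2 * (1/3) ^ n * e w" for j
    proof (induction j)
      case (Suc j)
      obtain h where h: "h \<in> hardy_space p" "hardy_norm p h \<le> (1/3) ^ (Suc n + j)"
        "x (Suc (Suc n + j)) = (\<lambda>z. x (Suc n + j) z + h z)" using step by blast
      have "cmod (h w) \<le> e w * hardy_norm p h"
        unfolding e_def by (rule evaluation_le_norm[OF p w h(1)])
      also have "\<dots> \<le> e w * (1/3) ^ (Suc n + j)" using h(2) e0[OF w] by (intro mult_left_mono) auto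
      finally have hw: "cmod (h w) \<le> e w * (1/3) ^ (Suc n + j)" .
      have "x (Suc n + Suc j) w - x (Suc n) w = (x (Suc n + j) w - x (Suc n) w) + h w"
        using h(3) by simp
      also have "cmod \<dots> \<le> (1 - (1/3) ^ j) / 2 * (1/3) ^ n * e w + e w * (1/3) ^ (Suc n + j)"
        by (rule norm_triangle_mono[OF Suc.IH hw])
      also have "\<dots> = (1 - (1/3) ^ Suc j) / 2 * (1/3) ^ n * e w"
        by (simp add: power_add field_simps)
      finally show ?case .
    qed simp
    have "(1/3) ^ n * (3/4 * e w) \<le> (1/3) ^ n * cmod (g n w)"
      unfolding w_def by (intro mult_left_mono g) simp
    also have "\<dots> \<le> cmod (x (Suc n) w)" using x(3)[of n] by (simp add: norm_mult t w_def)
    finally have big: "(1/3) ^ n * (3/4 * e w) \<le> cmod (x (Suc n) w)" .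
    have "(1/3) ^ n * e w / 4 \<le> cmod (x m w)" if m: "Suc n \<le> m" for m
    proof -
      obtain j where j: "m = Suc n + j" using m le_Suc_ex by blast
      have half: "(1 - (1/3::real) ^ j) / 2 * ((1/3) ^ n * e w) \<le> 1/2 * ((1/3) ^ n * e w)"
        using e0[OF w] by (intro mult_right_mono) auto
      have "cmod (x m w - x (Suc n) w) \<le> 1/2 * ((1/3) ^ n * e w)"
        unfolding j by (rule order_trans[OF tail[of j, unfolded mult.assoc] half])
      then show ?thesis
        using big norm_triangle_ineq2[of "x (Suc n) w" "x m w"] by (simp add: norm_minus_commute)
    qed
    moreover have "filterlim s at_top sequentially" by (rule filterlim_subseq[OF F(2)])
    then have "\<forall>\<^sub>F k in sequentially. Suc n \<le> s k" by (rule filterlim_at_top[THEN iffD1, rule_format])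
    ultimately have ev: "\<forall>\<^sub>F k in sequentially. (1/3) ^ n * e w / 4 \<le> cmod (x (s k) w)"
      by (auto elim: eventually_mono)
    have "(\<lambda>k. cmod (x (s k) w)) \<longlonglongrightarrow> cmod (F w)" using F(3)[of w] w by (intro tendsto_norm) simp
    then have "(1/3) ^ n * e w / 4 \<le> cmod (F w)" by (rule tendsto_lowerbound[OF _ ev]) simp
    then show ?thesis using w by (simp add: w_def e_def)
  qed
  ultimately show thesis using that by blast
qed

text \<open>If m is unbounded, it exceeds \<open>4 * 3 ^ n * real n\<close> at some
  \<open>\<zeta> n\<close>. The factor \<open>4 * 3 ^ n\<close> offsets the loss in the gliding hump
  F, so at \<open>\<zeta> n\<close> the product m F is at least n times the evaluation norm and its
  Hardy norm exceeds every n.\<close>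

lemma hardy_multiplier_bounded:
  assumes p: "1 \<le> p" and m: "\<And>F. F \<in> hardy_space p \<Longrightarrow> (\<lambda>z. m z * F z) \<in> hardy_space p"
  shows "\<exists>B. \<forall>z. cmod z < 1 \<longrightarrow> cmod (m z) \<le> B"
proof (rule ccontr)
  assume "\<nexists>B. \<forall>z. cmod z < 1 \<longrightarrow> cmod (m z) \<le> B"
  then have "\<forall>n::nat. \<exists>z. cmod z < 1 \<and> 4 * 3 ^ n * real n < cmod (m z)" by (meson not_le)
  then obtain \<zeta> where \<zeta>: "\<And>n. cmod (\<zeta> n) < 1" "\<And>n. 4 * 3 ^ n * real n < cmod (m (\<zeta> n))" by metis
  obtain F where F: "F \<in> hardy_space p" "\<And>n. (1/3) ^ n * evaluation_norm p (\<zeta> n) / 4 \<le> cmod (F (\<zeta> n))"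
    using gliding_hump[of p \<zeta>, OF p \<zeta>(1)] by blast
  have "real n \<le> hardy_norm p (\<lambda>z. m z * F z)" for n
  proof -
    define e where "e = evaluation_norm p (\<zeta> n)"
    have e: "0 < e" unfolding e_def by (rule evaluation_norm_pos[OF p \<zeta>(1)])
    have "real n * e = (4 * 3 ^ n * real n) * ((1/3) ^ n * e / 4)" by (simp add: power_divide)
    also have "\<dots> \<le> cmod (m (\<zeta> n)) * cmod (F (\<zeta> n))"
      using \<zeta>(2)[of n] F(2)[of n] e by (intro mult_mono) (auto simp: e_def)
    also have "\<dots> \<le> e * hardy_norm p (\<lambda>z. m z * F z)"
      using evaluation_le_norm[OF p \<zeta>(1) m[OF F(1)], of n] by (simp add: norm_mult e_def)
    finally show ?thesis using e by (simp add: mult.commute)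
  qed
  then show False using reals_Archimedean2[of "hardy_norm p (\<lambda>z. m z * F z)"] by (meson not_le)
qed

lemma hardy_rotate:
  assumes p: "1 \<le> p" and F: "F \<in> hardy_space p" and \<mu>: "cmod \<mu> = 1"
  shows "(\<lambda>z. F (\<mu> * z)) \<in> hardy_space p" "hardy_norm p (\<lambda>z. F (\<mu> * z)) \<le> hardy_norm p F"
proof -
  have h: "F holomorphic_on ball 0 1" by (rule hardy_space_holomorphic[OF F])
  have "(\<lambda>z. F (\<mu> * z)) holomorphic_on ball 0 1"
    by (rule holomorphic_on_compose_fun[OF h]) (use \<mu> in \<open>auto intro!: holomorphic_intros simp: norm_mult\<close>)
  then have D: "(\<lambda>z. F (\<mu> * z)) \<in> disc_holomorphic"
    using disc_holomorphicD(2)[OF hardy_spaceD[OF F]] \<mu> by (auto simp: disc_holomorphic_def norm_mult)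
  have "circle_integral p (\<lambda>z. F (\<mu> * z)) r \<le> 2 * pi * hardy_norm p F powr p" if r: "0 < r" "r < 1" for r
  proof -
    have "circle_integral p (\<lambda>z. F (\<mu> * z)) r = circle_integral p F (cmod (\<mu> * of_real r))"
      unfolding circle_integral_def[of p "\<lambda>z. F (\<mu> * z)"]
      using circle_integral_rotate[OF h, of "\<mu> * of_real r" p] \<mu> r p by (simp add: norm_mult mult.assoc)
    also have "cmod (\<mu> * of_real r) = r" using \<mu> r by (simp add: norm_mult)
    finally show ?thesis using circle_integral_le_hardy_norm[OF p F r] by simp
  qed
  from hardy_norm_leI[OF p D hardy_norm_nonneg this]
  show "(\<lambda>z. F (\<mu> * z)) \<in> hardy_space p" "hardy_norm p (\<lambda>z. F (\<mu> * z)) \<le> hardy_norm p F" by auto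
qed

lemma bounded_of_square_mult:
  assumes h: "h holomorphic_on ball 0 1" and B: "\<And>z. cmod z < 1 \<Longrightarrow> cmod (z\<^sup>2 * h z) \<le> B"
  shows "\<exists>C. \<forall>z. cmod z < 1 \<longrightarrow> cmod (h z) \<le> C"
proof -
  obtain C where C: "\<And>z. cmod z \<le> 1/2 \<Longrightarrow> cmod (h z) \<le> C"
    using holomorphic_bounded_on_cball[OF h, of "1/2"] by auto
  have "cmod (h z) \<le> max C (4 * B)" if z: "cmod z < 1" for z
  proof (cases "cmod z \<le> 1/2")
    case False
    then have "(1/2)\<^sup>2 \<le> (cmod z)\<^sup>2" by (intro power_mono) auto
    then have "1/4 * cmod (h z) \<le> (cmod z)\<^sup>2 * cmod (h z)"
      by (intro mult_right_mono) (auto simp: power2_eq_square)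
    also have "\<dots> \<le> B" using B[OF z] by (simp add: norm_mult norm_power)
    finally show ?thesis by simp
  qed (use C in \<open>auto intro: max.coboundedI1\<close>)
  then show ?thesis by blast
qed

lemma H_infinity_invertibleI:
  assumes h: "h holomorphic_on ball 0 1" and nz: "\<And>z. cmod z < 1 \<Longrightarrow> h z \<noteq> 0"
    and B: "\<And>z. cmod z < 1 \<Longrightarrow> cmod (h z) \<le> B" and C: "\<And>z. cmod z < 1 \<Longrightarrow> cmod (1 / h z) \<le> C"
  shows "H_infinity_invertible (on_disc h)"
proof -
  have "(\<lambda>z. 1 / h z) holomorphic_on ball 0 1" by (intro holomorphic_intros h) (use nz in auto)
  then have "on_disc (\<lambda>z. 1 / h z) \<in> H_infinity" by (rule H_infinity_on_disc[OF _ C])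
  moreover have "on_disc h \<in> H_infinity" by (rule H_infinity_on_disc[OF h B])
  ultimately show ?thesis
    unfolding H_infinity_invertible_def using nz by (intro conjI bexI[of _ "on_disc (\<lambda>z. 1 / h z)"]) auto
qed

section \<open>Boundedness of the symbol and continuity of the inverse operator\<close>

context nonvanishing_operator
begin

lemma square_mult_ab:
  assumes F: "F \<in> hardy_space p"
  shows "(\<lambda>z. z\<^sup>2 * F z) \<in> ab"
proof -
  have "(\<lambda>z. z\<^sup>2 * F z) \<in> hardy_space p"
    by (rule hardy_mult_bounded(1)[OF p F, of _ 1]) (auto intro!: holomorphic_intros simp: norm_power power_le_one)
  moreover have "((\<lambda>z. z\<^sup>2 * F z) has_field_derivative 0) (at 0)"
    by (auto intro!: derivative_eq_intros DERIV_deriv_at_0[OF hardy_space_holomorphic[OF F]])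
  ultimately show ?thesis using DERIV_imp_deriv by (fastforce simp: ab_iff)
qed

text \<open>Both \<open>z\<^sup>2 \<psi>\<close> and \<open>z\<^sup>2 / \<psi>\<close> multiply \<open>H\<^sup>p\<close> into itself, the latter because \<open>T\<close> is surjective.\<close>

lemma symbol_invertible:
  assumes \<mu>: "cmod \<mu> = 1" and \<psi>: "\<psi> holomorphic_on ball 0 1" "\<And>z. cmod z < 1 \<Longrightarrow> \<psi> z \<noteq> 0"
    and T: "\<And>f w. f \<in> ab \<Longrightarrow> cmod w < 1 \<Longrightarrow> T f w = \<psi> w * f (\<mu> * w)"
  obtains B C where "\<And>z. cmod z < 1 \<Longrightarrow> cmod (\<psi> z) \<le> B" "\<And>z. cmod z < 1 \<Longrightarrow> cmod (1 / \<psi> z) \<le> C"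
proof -
  have \<mu>0: "\<mu> \<noteq> 0" "cmod (1 / \<mu>) = 1" using \<mu> by (auto simp: norm_divide)
  have "(\<lambda>z. (z\<^sup>2 * \<psi> z) * F z) \<in> hardy_space p" if F: "F \<in> hardy_space p" for F
  proof -
    \<comment> \<open>The rotation is undone in advance, so that on the disc \<open>T f\<close> is
      \<open>\<mu>\<^sup>2 * z\<^sup>2 * \<psi> z * F z\<close>.\<close>
    define f where "f z = z\<^sup>2 * F (1 / \<mu> * z)" for z
    have f: "f \<in> ab" unfolding f_def by (rule square_mult_ab[OF hardy_rotate(1)[OF p F \<mu>0(2)]])
    have "(\<lambda>z. (1 / \<mu>\<^sup>2) * T f z) \<in> hardy_space p" by (rule hardy_cmult(1)[OF p ab_hardy[OF T_in[OF f]]])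
    also have "(\<lambda>z. (1 / \<mu>\<^sup>2) * T f z) = (\<lambda>z. (z\<^sup>2 * \<psi> z) * F z)"
    proof
      fix z
      show "(1 / \<mu>\<^sup>2) * T f z = (z\<^sup>2 * \<psi> z) * F z"
      proof (cases "cmod z < 1")
        case True
        then show ?thesis using \<mu>0 by (simp add: T[OF f] f_def power_mult_distrib)
      next
        case False
        then show ?thesis
          using ab_outside[OF T_in[OF f]] disc_holomorphicD(2)[OF hardy_spaceD[OF F]] by simp
      qed
    qed
    finally show ?thesis .
  qed
  then obtain B where "\<And>z. cmod z < 1 \<Longrightarrow> cmod (z\<^sup>2 * \<psi> z) \<le> B"
    using hardy_multiplier_bounded[OF p, of "\<lambda>z. z\<^sup>2 * \<psi> z"] by blast
  then obtain B' where B': "\<And>z. cmod z < 1 \<Longrightarrow> cmod (\<psi> z) \<le> B'"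
    using bounded_of_square_mult[OF \<psi>(1)] by blast
  have i\<psi>: "(\<lambda>z. 1 / \<psi> z) holomorphic_on ball 0 1" by (intro holomorphic_intros \<psi>(1)) (use \<psi>(2) in auto)
  have "(\<lambda>z. (z\<^sup>2 * (1 / \<psi> z)) * F z) \<in> hardy_space p" if F: "F \<in> hardy_space p" for F
  proof -
    have "(\<lambda>z. z\<^sup>2 * F z) \<in> T ` ab" unfolding surj by (rule square_mult_ab[OF F])
    then obtain g where g: "g \<in> ab" "T g = (\<lambda>z. z\<^sup>2 * F z)" by auto
    have "(\<lambda>z. g (\<mu> * z)) \<in> hardy_space p" by (rule hardy_rotate(1)[OF p ab_hardy[OF g(1)] \<mu>])
    also have "(\<lambda>z. g (\<mu> * z)) = (\<lambda>z. (z\<^sup>2 * (1 / \<psi> z)) * F z)"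
    proof
      fix z
      show "g (\<mu> * z) = (z\<^sup>2 * (1 / \<psi> z)) * F z"
      proof (cases "cmod z < 1")
        case True
        have "\<psi> z * g (\<mu> * z) = z\<^sup>2 * F z" using T[OF g(1) True] by (simp add: g(2))
        then show ?thesis using \<psi>(2)[OF True] by (simp add: field_simps)
      next
        case False
        then show ?thesis
          using ab_outside[OF g(1)] disc_holomorphicD(2)[OF hardy_spaceD[OF F]] \<mu> by (simp add: norm_mult)
      qed
    qed
    finally show ?thesis .
  qed
  then obtain C where "\<And>z. cmod z < 1 \<Longrightarrow> cmod (z\<^sup>2 * (1 / \<psi> z)) \<le> C"
    using hardy_multiplier_bounded[OF p, of "\<lambda>z. z\<^sup>2 * (1 / \<psi> z)"] by blast
  then obtain C' where "\<And>z. cmod z < 1 \<Longrightarrow> cmod (1 / \<psi> z) \<le> C'"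
    using bounded_of_square_mult[OF i\<psi>] by blast
  with B' show thesis using that by blast
qed

lemma bounded_operator_continuous:
  assumes S: "S \<in> ab \<rightarrow> ab" and diff: "\<And>f g. f \<in> ab \<Longrightarrow> g \<in> ab \<Longrightarrow> S (\<lambda>z. f z - g z) = (\<lambda>z. S f z - S g z)"
    and K: "0 < K" "\<And>f. f \<in> ab \<Longrightarrow> hardy_norm p (S f) \<le> K * hardy_norm p f"
  shows "continuous_map (hardy_ab_topology p \<alpha> \<beta>) (hardy_ab_topology p \<alpha> \<beta>) S"
proof -
  let ?d = "\<lambda>f g. hardy_norm p (\<lambda>z. f z - g z)"
  interpret M: Metric_space "hardy_space p" ?d by (rule Metric_space_hardy[OF p])
  interpret M: Submetric "hardy_space p" ?d ab
    by unfold_locales (use ab_hardy in blast)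
  have "continuous_map M.sub.mtopology M.sub.mtopology S"
    unfolding M.sub.metric_continuous_map[OF M.sub.Metric_space_axioms]
  proof (intro conjI ballI allI impI)
    show "S ` ab \<subseteq> ab" using S by blast
    fix f and e :: real assume f: "f \<in> ab" and e: "0 < e"
    have "?d (S f) (S g) < e" if g: "g \<in> ab" "?d f g < e / K" for g
    proof -
      have "?d (S f) (S g) \<le> K * ?d f g" using K(2)[OF ab_diff[OF f g(1)]] by (simp add: diff[OF f g(1)])
      also have "\<dots> < e" using g(2) K(1) by (simp add: field_simps)
      finally show ?thesis .
    qed
    then show "\<exists>\<delta>>0. \<forall>g. g \<in> ab \<and> ?d f g < \<delta> \<longrightarrow> ?d (S f) (S g) < e"
      using e K(1) by (intro exI[of _ "e / K"]) auto
  qed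
  then show ?thesis by (simp add: M.mtopology_submetric hardy_ab_topology_def hardy_topology_def)
qed

theorem weighted_rotation:
  "hardy_ab_invertible p \<alpha> \<beta> T \<and>
    (\<exists>\<mu> \<psi>. cmod \<mu> = 1 \<and> H_infinity_invertible \<psi> \<and>
      (\<forall>f\<in>ab. \<forall>z\<in>ball 0 1. T f z = \<psi> z * f (\<mu> * z)))"
proof -
  obtain \<mu> where \<mu>: "cmod \<mu> = 1"
    and T0: "\<And>f w. f \<in> ab \<Longrightarrow> cmod w < 1 \<Longrightarrow> T f w = a w * (f (\<mu> * w) / E0 (\<mu> * w))"
    using rotation_form by blast
  have \<mu>0: "\<mu> \<noteq> 0" "cmod (1 / \<mu>) = 1" using \<mu> by (auto simp: norm_divide)
  \<comment> \<open>Absorbs the division by \<open>E0\<close> in the composition formula into the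
    weight.\<close>
  define \<psi> where "\<psi> w = a w / E0 (\<mu> * w)" for w
  have "(\<lambda>w. E0 (\<mu> * w)) holomorphic_on ball 0 1"
    by (rule holomorphic_on_compose_fun[of E0 UNIV]) (auto intro!: holomorphic_intros)
  then have \<psi>h: "\<psi> holomorphic_on ball 0 1"
    unfolding \<psi>_def by (intro holomorphic_intros a_holomorphic) auto
  have \<psi>nz: "\<psi> w \<noteq> 0" if "cmod w < 1" for w using a_nonzero[OF that] by (simp add: \<psi>_def)
  have T: "T f w = \<psi> w * f (\<mu> * w)" if "f \<in> ab" "cmod w < 1" for f w using T0[OF that] by (simp add: \<psi>_def)
  obtain B C where BC: "\<And>z. cmod z < 1 \<Longrightarrow> cmod (\<psi> z) \<le> B" "\<And>z. cmod z < 1 \<Longrightarrow> cmod (1 / \<psi> z) \<le> C"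
    using symbol_invertible[OF \<mu> \<psi>h \<psi>nz T] by blast
  \<comment> \<open>The inverse is written down explicitly. It maps \<open>ab\<close> into itself
    because \<open>T\<close> is surjective, and it is continuous because \<open>1 / \<psi>\<close>
    is bounded.\<close>
  define S where "S f z = 1 / \<psi> (1 / \<mu> * z) * f (1 / \<mu> * z)" for f z
  have n\<mu>: "cmod (1 / \<mu> * z) = cmod z" for z using \<mu>0 by (simp add: norm_mult norm_divide \<mu>)
  have ST: "S (T f) = f" if f: "f \<in> ab" for f
  proof
    fix z
    show "S (T f) z = f z"
    proof (cases "cmod z < 1")
      case True
      then show ?thesis
        using T[OF f, of "1 / \<mu> * z"] \<psi>nz[of "1 / \<mu> * z"] n\<mu>[of z] \<mu>0 by (simp add: S_def)
    next
      case False
      then show ?thesis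
        using ab_outside[OF T_in[OF f], of "1 / \<mu> * z"] ab_outside[OF f] n\<mu>[of z] by (simp add: S_def)
    qed
  qed
  have preimage: "\<exists>g\<in>ab. T g = f" if "f \<in> ab" for f using surj that by (metis imageE)
  have Sab: "S \<in> ab \<rightarrow> ab" using preimage ST by fastforce
  have TS: "T (S f) = f" if "f \<in> ab" for f using preimage[OF that] ST by auto
  have i\<psi>: "(\<lambda>z. 1 / \<psi> z) holomorphic_on ball 0 1" by (intro holomorphic_intros \<psi>h) (use \<psi>nz in auto)
  have C0: "0 \<le> C" using order_trans[OF norm_ge_zero BC(2)[of 0]] by simp
  have "continuous_map (hardy_ab_topology p \<alpha> \<beta>) (hardy_ab_topology p \<alpha> \<beta>) S"
  proof (rule bounded_operator_continuous[OF Sab])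
    \<comment> \<open>\<open>C\<close> is only known to be nonnegative, while
      \<open>bounded_operator_continuous\<close> asks for a positive constant.\<close>
    show "0 < C + 1" using C0 by simp
    fix f assume f: "f \<in> ab"
    have m: "(\<lambda>z. 1 / \<psi> z * f z) \<in> hardy_space p" "hardy_norm p (\<lambda>z. 1 / \<psi> z * f z) \<le> C * hardy_norm p f"
      using hardy_mult_bounded[OF p ab_hardy[OF f] i\<psi> BC(2)] by auto
    have "hardy_norm p (S f) \<le> hardy_norm p (\<lambda>z. 1 / \<psi> z * f z)"
      using hardy_rotate(2)[OF p m(1) \<mu>0(2)] by (simp add: S_def[abs_def])
    also have "\<dots> \<le> (C + 1) * hardy_norm p f" using m(2) hardy_norm_nonneg[of p f] by (simp add: distrib_right)
    finally show "hardy_norm p (S f) \<le> (C + 1) * hardy_norm p f" .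
  qed (simp add: S_def fun_eq_iff right_diff_distrib)
  then have "hardy_ab_operator p \<alpha> \<beta> S"
    using Sab by (simp add: hardy_ab_operator_def S_def fun_eq_iff distrib_left)
  then have "hardy_ab_invertible p \<alpha> \<beta> T"
    unfolding hardy_ab_invertible_def using op ST TS by blast
  moreover have "H_infinity_invertible (on_disc \<psi>)"
    by (rule H_infinity_invertibleI[OF \<psi>h \<psi>nz BC])
  ultimately show ?thesis using \<mu> T by (intro conjI exI[of _ \<mu>] exI[of _ "on_disc \<psi>"]) auto
qed

end

theorem theorem4p3:
  fixes p :: real and \<alpha> \<beta> :: complex
    and T :: "(complex \<Rightarrow> complex) \<Rightarrow> (complex \<Rightarrow> complex)"
  assumes "1 \<le> p"
    and "(cmod \<alpha>)\<^sup>2 + (cmod \<beta>)\<^sup>2 = 1"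
    and "\<alpha> \<noteq> 0"
    and "hardy_ab_operator p \<alpha> \<beta> T"
    and "T ` hardy_ab p \<alpha> \<beta> = hardy_ab p \<alpha> \<beta>"
    and "\<And>g z. cyclic_ab p \<alpha> \<beta> g \<Longrightarrow> z \<in> ball 0 1 \<Longrightarrow> T g z \<noteq> 0"
  shows "hardy_ab_invertible p \<alpha> \<beta> T \<and>
    (\<exists>\<mu> \<psi>. cmod \<mu> = 1 \<and> H_infinity_invertible \<psi> \<and>
      (\<forall>f\<in>hardy_ab p \<alpha> \<beta>. \<forall>z\<in>ball 0 1. T f z = \<psi> z * f (\<mu> * z)))"
proof -
  interpret nonvanishing_operator p \<alpha> \<beta> T
    by unfold_locales (use assms in auto)
  show ?thesis by (rule weighted_rotation)
qed

end
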